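(* Let $\gamma<1$, let $F$ be a distribution function in the domain of attraction $\mathscr{D}(G_\gamma)$, and let $X_1,X_2,\ldots$ be independent random variables with distribution function $F$. Let $0<c<1$ and $\lambda\in\Lambda$. Then for every intermediate sequence $m=m(n)$, $$\widehat{\gamma}_{n,m}(c,\lambda)\xrightarrow{p}\gamma\qquad\text{as } n\to\infty,$$ where $\xrightarrow{p}$ denotes convergence in probability.
   Context: Extreme value distribution: $G_\gamma(x)=\exp\{-(1+\gamma x)^{-1/\gamma}\}$ for $1+\gamma x>0$ if $\gamma\ne0$, and $G_0(x)=\exp\{-e^{-x}\}$, $x\in\mathbb{R}$. $F\in\mathscr{D}(G_\gamma)$ means that there are constants $a_n>0$, $b_n\in\mathbb{R}$ with $\lim_{n\to\infty}F^n(a_nx+b_n)=G_\gamma(x)$. Intermediate sequence: a sequence of positive integers $m=m(n)$ with $1\le m\le n-1$, $m\to\infty$ and $m/n\to0$ as $n\to\infty$. $\Lambda$ is the collection of signed Borel measures $\lambda$ on $(0,1]$ such that $\lambda((0,1])=0$, $\int\log(1/t)\,|\lambda|(dt)<\infty$ and $\int\log(1/t)\,\lambda(dt)=1$. All integrals with respect to $\lambda$ are over $(0,1]$. CVaR order statistics: let $X_1^{(n)}\ge X_2^{(n)}\ge\cdots\ge X_n^{(n)}$ be the descending order statistics of $X_1,\ldots,X_n$ and $Y_k^{(n)}=\frac1k\sum_{i=1}^kX_i^{(n)}$, $k=1,\ldots,n$. CVaR-based smoothed estimator: for $1\le m\le n-1$, $0<c<1$, $\lambda\in\Lambda$, $$\widehat{\gamma}_{n,m}(c,\lambda)=\int\log\bigl(Y^{(n)}_{\lfloor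 c\lceil tm\rceil\rfloor+1}-Y^{(n)}_{\lceil tm\rceil+1}\bigr)\,\lambda(dt),$$ with the convention $\log(0):=0$. Here $\lfloor\cdot\rfloor$ is the floor and $\lceil x\rceil$ is the smallest integer at least as large as $x$. *)

theory Defs
  imports "HOL-Probability.Probability"
begin

section \<open>Signed measures\<close>

text \<open>
  Only finite signed measures are needed: a signed measure that is finite on the whole space is
  finite on every measurable set.  The Jordan components are the upper and lower variations,
  and their sum is the total variation measure.
\<close>

definition signed_measure :: "'a measure \<Rightarrow> ('a set \<Rightarrow> real) \<Rightarrow> bool" where
  "signed_measure M \<nu> \<longleftrightarrow>
     \<nu> {} = 0 \<and>
     (\<forall>A :: nat \<Rightarrow> 'a set. range A \<subseteq> sets M \<longrightarrow> disjoint_family A \<longrightarrow>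
        (\<lambda>i. \<nu> (A i)) sums \<nu> (\<Union>i. A i))"

definition upper_variation :: "'a measure \<Rightarrow> ('a set \<Rightarrow> real) \<Rightarrow> 'a measure" where
  "upper_variation M \<nu> =
     measure_of (space M) (sets M) (\<lambda>A. SUP B\<in>{B \<in> sets M. B \<subseteq> A}. ennreal (\<nu> B))"

definition lower_variation :: "'a measure \<Rightarrow> ('a set \<Rightarrow> real) \<Rightarrow> 'a measure" where
  "lower_variation M \<nu> = upper_variation M (\<lambda>A. - \<nu> A)"

definition total_variation :: "'a measure \<Rightarrow> ('a set \<Rightarrow> real) \<Rightarrow> 'a measure" where
  "total_variation M \<nu> =
     measure_of (space M) (sets M)
       (\<lambda>A. emeasure (upper_variation M \<nu>) A + emeasure (lower_variation M \<nu>) A)"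

definition signed_integral :: "'a measure \<Rightarrow> ('a set \<Rightarrow> real) \<Rightarrow> ('a \<Rightarrow> real) \<Rightarrow> real" where
  "signed_integral M \<nu> f =
     (\<integral>x. f x \<partial>upper_variation M \<nu>) - (\<integral>x. f x \<partial>lower_variation M \<nu>)"

lemma sets_variation [simp, measurable_cong]:
  "sets (upper_variation M \<nu>) = sets M"
  "sets (lower_variation M \<nu>) = sets M"
  "sets (total_variation M \<nu>) = sets M"
  by (simp_all add: upper_variation_def lower_variation_def total_variation_def)

lemma space_variation [simp]:
  "space (upper_variation M \<nu>) = space M"
  "space (lower_variation M \<nu>) = space M"
  "space (total_variation M \<nu>) = space M"
  by (simp_all add: upper_variation_def lower_variation_def total_variation_def
      space_measure_of_conv)

text \<open>
  An ill-formed argument of \<^const>\<open>measure_of\<close> would silently give the null measure; the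
  following lemmas rule this out.
\<close>

lemma signed_measure_Un:
  assumes "signed_measure M \<nu>" "A \<in> sets M" "B \<in> sets M" "A \<inter> B = {}"
  shows "\<nu> (A \<union> B) = \<nu> A + \<nu> B"
proof -
  have "range (binaryset A B) \<subseteq> sets M" "disjoint_family (binaryset A B)"
    using assms by (auto simp: binaryset_def disjoint_family_on_def)
  with assms(1) have "(\<lambda>i. \<nu> (binaryset A B i)) sums \<nu> (\<Union>i. binaryset A B i)"
    unfolding signed_measure_def by blast
  moreover have "(\<lambda>i. \<nu> (binaryset A B i)) sums (\<nu> A + \<nu> B)"
    using assms(1) by (intro binaryset_sums) (simp add: signed_measure_def)
  ultimately show ?thesis
    by (simp add: UN_binaryset_eq sums_unique2)
qed

lemma emeasure_upper_variation:
  assumes \<nu>: "signed_measure M \<nu>" and A: "A \<in> sets M"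
  shows "emeasure (upper_variation M \<nu>) A = (SUP B\<in>{B \<in> sets M. B \<subseteq> A}. ennreal (\<nu> B))"
proof -
  define U where "U A = (SUP B\<in>{B \<in> sets M. B \<subseteq> A}. ennreal (\<nu> B))" for A
  have U_upper: "ennreal (\<nu> B) \<le> U C" if "B \<in> sets M" "B \<subseteq> C" for B C
    unfolding U_def using that by (intro SUP_upper) auto
  have U_mono: "U B \<le> U C" if "B \<subseteq> C" for B C
    unfolding U_def using that by (intro SUP_subset_mono) auto
  have U_empty: "U {} = 0"
    using \<nu> by (auto simp: U_def signed_measure_def bot_ennreal intro!: antisym SUP_least)
  have U_super: "U B + U C \<le> U (B \<union> C)" if "B \<inter> C = {}" for B C
  proof -
    have ne: "{D \<in> sets M. D \<subseteq> E} \<noteq> {}" for E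
      by auto
    have pair: "ennreal (\<nu> D) + ennreal (\<nu> E) \<le> U (B \<union> C)"
      if "D \<in> sets M" "D \<subseteq> B" "E \<in> sets M" "E \<subseteq> C" for D E
    proof -
      have "\<nu> (D \<union> E) = \<nu> D + \<nu> E"
        using that \<open>B \<inter> C = {}\<close> by (intro signed_measure_Un[OF \<nu>]) auto
      moreover have "ennreal (\<nu> D) \<le> U (B \<union> C)" "ennreal (\<nu> E) \<le> U (B \<union> C)"
        "ennreal (\<nu> (D \<union> E)) \<le> U (B \<union> C)"
        using that by (auto intro!: U_upper)
      ultimately show ?thesis
        by (cases "\<nu> D \<ge> 0"; cases "\<nu> E \<ge> 0") (auto simp: ennreal_neg)
    qed
    have "U B + U C = (SUP D\<in>{D \<in> sets M. D \<subseteq> B}. ennreal (\<nu> D) + U C)"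
      unfolding U_def[of B] by (rule ennreal_SUP_add_left[OF ne, symmetric])
    also have "\<dots> = (SUP D\<in>{D \<in> sets M. D \<subseteq> B}. SUP E\<in>{E \<in> sets M. E \<subseteq> C}.
        ennreal (\<nu> D) + ennreal (\<nu> E))"
      unfolding U_def[of C]
      by (intro SUP_cong refl ennreal_SUP_add_right ne)
    also have "\<dots> \<le> U (B \<union> C)"
      using pair by (auto intro!: SUP_least)
    finally show ?thesis .
  qed
  have "countably_additive (sets M) U"
  proof (rule countably_additiveI)
    fix A :: "nat \<Rightarrow> 'a set"
    assume A: "range A \<subseteq> sets M" "disjoint_family A" "(\<Union>i. A i) \<in> sets M"
    have "(\<Sum>i<n. U (A i)) \<le> U (\<Union>i<n. A i)" for n
    proof (induction n)
      case (Suc n)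
      have "(\<Sum>i<Suc n. U (A i)) \<le> U (\<Union>i<n. A i) + U (A n)"
        using Suc by (simp add: add_right_mono)
      also have "\<dots> \<le> U ((\<Union>i<n. A i) \<union> A n)"
      proof (rule U_super)
        have "A i \<inter> A n = {}" if "i < n" for i
          using disjoint_family_onD[OF A(2), of i n] that by simp
        then show "(\<Union>i<n. A i) \<inter> A n = {}"
          by blast
      qed
      also have "(\<Union>i<n. A i) \<union> A n = (\<Union>i<Suc n. A i)"
        by (auto simp: lessThan_Suc)
      finally show ?case .
    qed (simp add: U_empty)
    then have "(\<Sum>i<n. U (A i)) \<le> U (\<Union>i. A i)" for n
      by (rule order_trans) (rule U_mono, blast)
    then have "(\<Sum>i. U (A i)) \<le> U (\<Union>i. A i)"
      unfolding suminf_eq_SUP by (intro SUP_least)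
    moreover have "U (\<Union>i. A i) \<le> (\<Sum>i. U (A i))"
      unfolding U_def[of "\<Union>i. A i"]
    proof (rule SUP_least)
      fix B assume "B \<in> {B \<in> sets M. B \<subseteq> (\<Union>i. A i)}"
      then have B: "B \<in> sets M" "(\<Union>i. B \<inter> A i) = B" by auto
      have "range (\<lambda>i. B \<inter> A i) \<subseteq> sets M" "disjoint_family (\<lambda>i. B \<inter> A i)"
        using A B by (auto simp: disjoint_family_on_def)
      with \<nu> have "(\<lambda>i. \<nu> (B \<inter> A i)) sums \<nu> (\<Union>i. B \<inter> A i)"
        unfolding signed_measure_def by blast
      then have "(\<lambda>i. \<nu> (B \<inter> A i)) sums \<nu> B"
        unfolding B(2) .
      then have "(\<lambda>n. ennreal (\<Sum>i<n. \<nu> (B \<inter> A i))) \<longlonglongrightarrow> ennreal (\<nu> B)"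
        unfolding sums_def by (rule tendsto_ennrealI)
      moreover have "ennreal (\<Sum>i<n. \<nu> (B \<inter> A i)) \<le> (\<Sum>i. U (A i))" for n
      proof -
        have "ennreal (\<Sum>i<n. \<nu> (B \<inter> A i)) \<le> ennreal (\<Sum>i<n. max 0 (\<nu> (B \<inter> A i)))"
          by (intro ennreal_leI sum_mono) simp
        also have "\<dots> = (\<Sum>i<n. ennreal (max 0 (\<nu> (B \<inter> A i))))"
          by (rule sum_ennreal[symmetric]) simp
        also have "\<dots> \<le> (\<Sum>i<n. U (A i))"
        proof (rule sum_mono)
          fix i
          have "B \<inter> A i \<in> sets M"
            using A(1) B(1) by blast
          then have "ennreal (\<nu> (B \<inter> A i)) \<le> U (A i)"
            by (rule U_upper) simp
          then show "ennreal (max 0 (\<nu> (B \<inter> A i))) \<le> U (A i)"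
            by (simp add: max_def)
        qed
        also have "\<dots> \<le> (\<Sum>i. U (A i))"
          by (intro sum_le_suminf) auto
        finally show ?thesis .
      qed
      ultimately show "ennreal (\<nu> B) \<le> (\<Sum>i. U (A i))"
        by (intro LIMSEQ_le_const2[where X = "\<lambda>n. ennreal (\<Sum>i<n. \<nu> (B \<inter> A i))"]) auto
    qed
    ultimately show "(\<Sum>i. U (A i)) = U (\<Union>i. A i)"
      by (rule antisym)
  qed
  moreover have "positive (sets M) U"
    by (simp add: positive_def U_empty)
  moreover have "upper_variation M \<nu> = measure_of (space M) (sets M) U"
    by (simp add: upper_variation_def U_def[abs_def])
  ultimately have "emeasure (upper_variation M \<nu>) A = U A"
    using A sets.space_closed by (intro emeasure_measure_of) auto
  then show ?thesis
    by (simp add: U_def)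
qed

lemma emeasure_total_variation:
  assumes "A \<in> sets M"
  shows "emeasure (total_variation M \<nu>) A =
           emeasure (upper_variation M \<nu>) A + emeasure (lower_variation M \<nu>) A"
proof (rule emeasure_measure_of[OF total_variation_def])
  show "countably_additive (sets (total_variation M \<nu>))
     (\<lambda>A. emeasure (upper_variation M \<nu>) A + emeasure (lower_variation M \<nu>) A)"
  proof (rule countably_additiveI)
    fix A :: "nat \<Rightarrow> 'a set"
    assume "range A \<subseteq> sets (total_variation M \<nu>)" "disjoint_family A"
    then show "(\<Sum>i. emeasure (upper_variation M \<nu>) (A i) + emeasure (lower_variation M \<nu>) (A i)) =
      emeasure (upper_variation M \<nu>) (\<Union>i. A i) + emeasure (lower_variation M \<nu>) (\<Union>i. A i)"
      by (subst suminf_add[symmetric]) (auto simp: suminf_emeasure)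
  qed
qed (use assms sets.space_closed in \<open>auto simp: positive_def\<close>)

section \<open>The weight class and the estimator\<close>

abbreviation unit_borel :: "real measure" where
  "unit_borel \<equiv> restrict_space borel {0<..1}"

definition weight_class :: "(real set \<Rightarrow> real) set"  (\<open>\<Lambda>\<close>) where
  "\<Lambda> = {\<nu>. signed_measure unit_borel \<nu> \<and> \<nu> {0<..1} = 0 \<and>
          (\<integral>\<^sup>+t. ennreal (ln (1 / t)) \<partial>total_variation unit_borel \<nu>) < \<infinity> \<and>
          signed_integral unit_borel \<nu> (\<lambda>t. ln (1 / t)) = 1}"

definition desc_order_stat :: "(nat \<Rightarrow> 'a \<Rightarrow> real) \<Rightarrow> nat \<Rightarrow> nat \<Rightarrow> 'a \<Rightarrow> real" where
  "desc_order_stat X n i \<omega> = rev (sort (map (\<lambda>j. X j \<omega>) [1..<n + 1])) ! (i - 1)"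

definition cvar_order_stat :: "(nat \<Rightarrow> 'a \<Rightarrow> real) \<Rightarrow> nat \<Rightarrow> nat \<Rightarrow> 'a \<Rightarrow> real" where
  "cvar_order_stat X n k \<omega> = (\<Sum>i=1..k. desc_order_stat X n i \<omega>) / real k"

definition log_conv :: "real \<Rightarrow> real" where
  "log_conv x = (if x = 0 then 0 else ln x)"

definition cvar_estimator ::
    "(nat \<Rightarrow> 'a \<Rightarrow> real) \<Rightarrow> nat \<Rightarrow> nat \<Rightarrow> real \<Rightarrow> (real set \<Rightarrow> real) \<Rightarrow> 'a \<Rightarrow> real" where
  "cvar_estimator X n m c \<nu> \<omega> =
     signed_integral unit_borel \<nu> (\<lambda>t.
       log_conv (cvar_order_stat X n (nat \<lfloor>c * real_of_int \<lceil>t * real m\<rceil>\<rfloor> + 1) \<omega>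
               - cvar_order_stat X n (nat \<lceil>t * real m\<rceil> + 1) \<omega>))"

section \<open>Extreme value theory and asymptotics\<close>

text \<open>
  The distribution function is only used on its natural domain \<open>1 + \<gamma> * x > 0\<close>.
\<close>

definition gev :: "real \<Rightarrow> real \<Rightarrow> real" where
  "gev \<gamma> x = (if \<gamma> = 0 then exp (- exp (- x)) else exp (- ((1 + \<gamma> * x) powr (- 1 / \<gamma>))))"

definition attraction_domain :: "real \<Rightarrow> (real \<Rightarrow> real) set" where
  "attraction_domain \<gamma> =
     {F. \<exists>a b :: nat \<Rightarrow> real. (\<forall>n. a n > 0) \<and>
        (\<forall>x. 1 + \<gamma> * x > 0 \<longrightarrow> (\<lambda>n. F (a n * x + b n) ^ n) \<longlonglongrightarrow> gev \<gamma> x)}"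

definition intermediate_sequence :: "(nat \<Rightarrow> nat) \<Rightarrow> bool" where
  "intermediate_sequence m \<longleftrightarrow>
     (\<forall>n\<ge>2. 1 \<le> m n \<and> m n \<le> n - 1) \<and>
     filterlim m at_top sequentially \<and>
     (\<lambda>n. real (m n) / real n) \<longlonglongrightarrow> 0"

text \<open>
  Eventual measurability ensures that the sets below really are events: \<^const>\<open>measure\<close> is \<open>0\<close>
  on non-measurable sets.
\<close>

definition tendsto_in_prob :: "'a measure \<Rightarrow> (nat \<Rightarrow> 'a \<Rightarrow> real) \<Rightarrow> real \<Rightarrow> bool" where
  "tendsto_in_prob M Z z \<longleftrightarrow>
     (\<forall>\<^sub>F n in sequentially. Z n \<in> borel_measurable M) \<and>
     (\<forall>\<epsilon>>0. (\<lambda>n. measure M {\<omega> \<in> space M. \<bar>Z n \<omega> - z\<bar> > \<epsilon>}) \<longlonglongrightarrow> 0)"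

end

theory Submission
  imports Defs
begin

text \<open>
  Let \<open>U\<close> be the tail quantile function of \<open>F\<close>, and let \<open>\<alpha> s = U (2 * s) - U s\<close> be the scale at level
  \<open>s\<close>. The domain of attraction condition gives \<open>(U (s * x) - U s) / \<alpha> s \<longlonglongrightarrow> H x\<close> with \<open>H\<close> satisfying
  \<open>H (x * y) = H x + x powr \<gamma> * H y\<close>. Writing \<open>Y j\<close> as the integral of \<open>t \<mapsto> X\<^sub>\<lceil>\<^sub>t\<^sub>j\<^sub>\<rceil>\<close> over the unit interval
  and using \<open>\<gamma> < 1\<close> to bound moments, one gets \<open>(Y (c * k) - Y k) / \<alpha> (n / m) \<longlonglongrightarrow> t powr (- \<gamma>) * K\<close> in
  probability for \<open>k = \<lceil>t * m\<rceil>\<close>, where \<open>K = H (1 / c) / (1 - \<gamma>) > 0\<close>. The integral of the logarithm of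
  the limit with respect to the weight is \<open>\<gamma>\<close>, since the weight annihilates constants; the same fact
  permits normalising by the unknown scale.

  The integral is controlled by bounding the second moment of the logarithm of the normalised gap by
  a multiple of \<open>(1 + log (1 / t))\<^sup>2\<close> on events of probability close to one. The delicate part is a
  gap close to zero: the two largest observations differ by at least a multiple of \<open>\<alpha> n\<close>, which
  suffices up to \<open>k = sqrt m\<close>, and Chebyshev's inequality takes over from there.
\<close>

section \<open>Finite signed measures\<close>

text \<open>The weight is only known to integrate log (1 / t) once. The bound for the log gap at
  \<open>t\<close> must therefore have exactly this order: a loss of log m, harmless for fixed
  \<open>k\<close>, would destroy domination uniformly in n, and this forces the split at sqrt m. As
  F may have atoms, gaps can vanish with positive probability, so moments of their logarithms are
  taken on an event that is fixed before \<open>t\<close> and makes all relevant gaps positive.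
  Tonelli then lets each \<open>t\<close> be treated on its own, and no uniformity in
  \<open>k\<close> is needed beyond that event. Order statistics are reached by counting exceedances
  of quantile levels. For this only P (X > U s) <= 1 / s <= P (X >= U s) is required, which holds
  for every F. The scale is an increment of \<open>U\<close> over one doubling instead of a
  normalising constant \<open>a n\<close>: it is a function of a real argument, it is free of the
  centring \<open>b n\<close>, and it telescopes along powers of two, which is the source of all
  non-asymptotic bounds.\<close>

lemma signed_measure_uminus:
  assumes "signed_measure M \<nu>" shows "signed_measure M (\<lambda>A. - \<nu> A)"
  using assms unfolding signed_measure_def by (auto intro!: sums_minus)

lemma signed_measure_Diff:
  assumes "signed_measure M \<nu>" "A \<in> sets M" "B \<in> sets M" "B \<subseteq> A"
  shows "\<nu> (A - B) = \<nu> A - \<nu> B"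
proof -
  have "\<nu> ((A - B) \<union> B) = \<nu> (A - B) + \<nu> B"
    using assms by (intro signed_measure_Un) auto
  moreover have "(A - B) \<union> B = A" using assms by auto
  ultimately show ?thesis by simp
qed

lemma emeasure_lower_variation:
  assumes "signed_measure M \<nu>" "A \<in> sets M"
  shows "emeasure (lower_variation M \<nu>) A = (SUP B\<in>{B \<in> sets M. B \<subseteq> A}. ennreal (- \<nu> B))"
  unfolding lower_variation_def
  by (rule emeasure_upper_variation[OF signed_measure_uminus[OF assms(1)] assms(2)])

text \<open>If \<open>\<bar>\<nu> B\<bar>\<close> were at most \<open>r\<close> for all measurable
  subsets of \<open>A\<close>, both suprema that give the variations would be at most
  \<open>r\<close>, and the total variation of \<open>A\<close> would be finite.\<close>

lemma signed_measure_large_subset: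
  assumes \<nu>: "signed_measure M \<nu>" and A: "A \<in> sets M"
    and inf: "emeasure (total_variation M \<nu>) A = \<infinity>"
  shows "\<exists>B\<in>sets M. B \<subseteq> A \<and> \<bar>\<nu> B\<bar> > r"
proof (rule ccontr)
  assume "\<not> ?thesis"
  then have *: "\<bar>\<nu> B\<bar> \<le> r" if "B \<in> sets M" "B \<subseteq> A" for B
    using that by force
  have "emeasure (upper_variation M \<nu>) A \<le> ennreal r"
    unfolding emeasure_upper_variation[OF \<nu> A]
    by (rule SUP_least) (use * in \<open>fastforce intro!: ennreal_leI\<close>)
  moreover have "emeasure (lower_variation M \<nu>) A \<le> ennreal r"
    unfolding emeasure_lower_variation[OF \<nu> A]
    by (rule SUP_least) (use * in \<open>fastforce intro!: ennreal_leI\<close>)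
  ultimately have "emeasure (total_variation M \<nu>) A \<le> ennreal r + ennreal r"
    unfolding emeasure_total_variation[OF A] by (rule add_mono)
  then show False using inf by (simp add: top_unique)
qed

text \<open>
  If the total variation were infinite, one could repeatedly split off a set of mass at least
  one in absolute value while keeping infinite total variation on the rest; the sets split off
  are disjoint, so this contradicts countable additivity.
\<close>

lemma finite_total_variation:
  assumes \<nu>: "signed_measure M \<nu>"
  shows "emeasure (total_variation M \<nu>) (space M) < \<infinity>"
proof (rule ccontr)
  let ?T = "emeasure (total_variation M \<nu>)"
  assume "\<not> ?T (space M) < \<infinity>"
  then have inf: "?T (space M) = \<infinity>" by (simp add: less_top[symmetric])
  define P where "P = (\<lambda>(n::nat) A. A \<in> sets M \<and> ?T A = \<infinity>)"
  define Q where "Q = (\<lambda>(n::nat) A B. B \<subseteq> A \<and> \<bar>\<nu> (A - B)\<bar> > 1)"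
  have "\<exists>f. \<forall>n. P n (f n) \<and> Q n (f n) (f (Suc n))"
  proof (rule dependent_nat_choice)
    show "\<exists>A. P 0 A" using inf by (auto simp: P_def)
  next
    fix A :: "'a set" and n :: nat assume "P n A"
    then have A: "A \<in> sets M" "?T A = \<infinity>" by (auto simp: P_def)
    \<comment> \<open>The slack \<open>\<bar>\<nu> A\<bar>\<close> forces mass above 1 in absolute
      value on \<open>A - C\<close> as well, so whichever of the two pieces keeps infinite total
      variation may be retained and the other split off.\<close>
    obtain C where C: "C \<in> sets M" "C \<subseteq> A" "\<bar>\<nu> C\<bar> > 1 + \<bar>\<nu> A\<bar>"
      using signed_measure_large_subset[OF \<nu> A] by blast
    have D: "\<bar>\<nu> (A - C)\<bar> > 1"
      using C signed_measure_Diff[OF \<nu> A(1) C(1,2)] by auto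
    have "?T A = ?T (C \<union> (A - C))" using C by (simp add: Un_absorb1)
    also have "\<dots> = ?T C + ?T (A - C)"
      using C A by (intro plus_emeasure[symmetric]) auto
    finally have "?T C + ?T (A - C) = top" using A(2) by simp
    then have "?T C = \<infinity> \<or> ?T (A - C) = \<infinity>" by (simp add: ennreal_add_eq_top)
    then show "\<exists>B. P (Suc n) B \<and> Q n A B"
    proof
      assume "?T C = \<infinity>" then show ?thesis using C D by (auto simp: P_def Q_def)
    next
      assume "?T (A - C) = \<infinity>"
      moreover have "A - (A - C) = C" using C by auto
      ultimately show ?thesis using C A by (intro exI[of _ "A - C"]) (auto simp: P_def Q_def)
    qed
  qed
  then obtain f where f: "\<And>n. f n \<in> sets M" "\<And>n. f (Suc n) \<subseteq> f n"
    "\<And>n. \<bar>\<nu> (f n - f (Suc n))\<bar> > 1"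
    unfolding P_def Q_def by auto
  have anti: "f j \<subseteq> f i" if "i \<le> j" for i j
    using lift_Suc_antimono_le[of f, OF f(2) that] .
  define B where "B n = f n - f (Suc n)" for n
  have "disjoint_family B"
    unfolding disjoint_family_on_def
  proof safe
    fix i j x assume "i \<noteq> j" "x \<in> B i" "x \<in> B j"
    moreover have "i < j \<or> j < i" using \<open>i \<noteq> j\<close> by auto
    ultimately show "x \<in> {}"
      using anti[of "Suc i" j] anti[of "Suc j" i] by (auto simp: B_def)
  qed
  moreover have "range B \<subseteq> sets M" using f by (auto simp: B_def)
  ultimately have "summable (\<lambda>i. \<nu> (B i))"
    using \<nu> unfolding signed_measure_def by (meson sums_summable)
  then have "(\<lambda>i. \<nu> (B i)) \<longlonglongrightarrow> 0" by (rule summable_LIMSEQ_zero)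
  then have "eventually (\<lambda>i. \<bar>\<nu> (B i)\<bar> < 1) sequentially"
    by (auto simp: tendsto_iff dist_real_def)
  then show False using f(3) by (force simp: eventually_sequentially B_def dest: less_asym)
qed

lemma finite_measure_variation:
  assumes "signed_measure M \<nu>"
  shows "finite_measure (upper_variation M \<nu>)" "finite_measure (lower_variation M \<nu>)"
proof -
  have "emeasure (upper_variation M \<nu>) (space M) + emeasure (lower_variation M \<nu>) (space M) < \<infinity>"
    using finite_total_variation[OF assms] by (simp add: emeasure_total_variation)
  then show "finite_measure (upper_variation M \<nu>)" "finite_measure (lower_variation M \<nu>)"
    by (auto intro!: finite_measureI)
qed

text \<open>When the whole space has mass zero, passing to the complement flips the sign of
  \<open>\<nu>\<close>, so the two suprema run over the same set of values. Equal total masses are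
  what makes constants cancel in \<open>signed_integral\<close>.\<close>

lemma variation_space_eq:
  assumes \<nu>: "signed_measure M \<nu>" and 0: "\<nu> (space M) = 0"
  shows "measure (upper_variation M \<nu>) (space M) = measure (lower_variation M \<nu>) (space M)"
proof -
  have "(\<lambda>B. ennreal (\<nu> B)) ` {B \<in> sets M. B \<subseteq> space M}
      = (\<lambda>B. ennreal (- \<nu> B)) ` {B \<in> sets M. B \<subseteq> space M}" (is "?f ` ?S = ?g ` ?S")
  proof (intro set_eqI iffI)
    fix x assume "x \<in> ?f ` ?S"
    then obtain B where "B \<in> sets M" "x = ennreal (\<nu> B)" by auto
    then show "x \<in> ?g ` ?S"
      using signed_measure_Diff[OF \<nu> sets.top, of B] 0 sets.sets_into_space[of B M]
      by (intro image_eqI[of _ _ "space M - B"]) auto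
  next
    fix x assume "x \<in> ?g ` ?S"
    then obtain B where "B \<in> sets M" "x = ennreal (- \<nu> B)" by auto
    then show "x \<in> ?f ` ?S"
      using signed_measure_Diff[OF \<nu> sets.top, of B] 0 sets.sets_into_space[of B M]
      by (intro image_eqI[of _ _ "space M - B"]) auto
  qed
  then show ?thesis
    unfolding measure_def
    by (simp add: emeasure_upper_variation[OF \<nu>] emeasure_lower_variation[OF \<nu>])
qed

lemma nn_integral_variation_le:
  assumes [measurable]: "f \<in> borel_measurable M"
  shows "(\<integral>\<^sup>+x. f x \<partial>upper_variation M \<nu>) \<le> (\<integral>\<^sup>+x. f x \<partial>total_variation M \<nu>)"
    and "(\<integral>\<^sup>+x. f x \<partial>lower_variation M \<nu>) \<le> (\<integral>\<^sup>+x. f x \<partial>total_variation M \<nu>)"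
  by (auto intro!: nn_integral_mono_measure simp: le_measure emeasure_total_variation)

section \<open>Tail quantiles and the domain of attraction\<close>

text \<open>The Box-Cox function. It is the quantile of \<open>gev\<close> at probability
  \<open>exp (- 1 / x)\<close>, and hence the limit shape of normalised tail quantiles.\<close>

definition gev_quantile :: "real \<Rightarrow> real \<Rightarrow> real" where
  "gev_quantile \<gamma> x = (if \<gamma> = 0 then ln x else (x powr \<gamma> - 1) / \<gamma>)"

lemma gev_quantile_1 [simp]: "gev_quantile \<gamma> 1 = 0"
  by (simp add: gev_quantile_def)

lemma gev_quantile_mult:
  assumes "x > 0" "y > 0"
  shows "gev_quantile \<gamma> (x * y) = gev_quantile \<gamma> x + x powr \<gamma> * gev_quantile \<gamma> y"
  using assms by (auto simp: gev_quantile_def ln_mult powr_mult field_simps)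

lemma gev_quantile_pos: "x > 1 \<Longrightarrow> gev_quantile \<gamma> x > 0"
  by (cases "\<gamma> > 0")
     (auto simp: gev_quantile_def divide_simps gr_one_powr powr_less_one zero_less_divide_iff
       not_less order_le_less)

lemma gev_quantile_strict_mono:
  assumes "0 < x" "x < y" shows "gev_quantile \<gamma> x < gev_quantile \<gamma> y"
proof -
  have "gev_quantile \<gamma> (x * (y / x)) = gev_quantile \<gamma> x + x powr \<gamma> * gev_quantile \<gamma> (y / x)"
    using assms by (intro gev_quantile_mult) auto
  moreover have "gev_quantile \<gamma> (y / x) > 0"
    using assms by (intro gev_quantile_pos) auto
  ultimately show ?thesis using assms by simp
qed

lemma isCont_gev_quantile: "x > 0 \<Longrightarrow> isCont (gev_quantile \<gamma>) x"
  by (cases "\<gamma> = 0") (auto simp: gev_quantile_def[abs_def] intro!: continuous_intros)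

lemma gev_gev_quantile:
  assumes "x > 0"
  shows "1 + \<gamma> * gev_quantile \<gamma> x > 0" "gev \<gamma> (gev_quantile \<gamma> x) = exp (- 1 / x)"
  using assms by (auto simp: gev_quantile_def gev_def powr_powr exp_minus powr_minus_divide field_simps)

text \<open>The generalised inverse of 1 / (1 - F), that is, the quantile at level
  \<open>1 - 1 / s\<close>. The set is nonempty and bounded below for \<open>s > 1\<close>, so
  \<open>Inf\<close> is meaningful there.\<close>

definition tail_quantile :: "(real \<Rightarrow> real) \<Rightarrow> real \<Rightarrow> real" where
  "tail_quantile F s = Inf {x. 1 - F x \<le> 1 / s}"

context real_distribution
begin

lemma tail_quantile_set:
  assumes "s > 1"
  shows "{x. 1 - cdf M x \<le> 1 / s} \<noteq> {}" "bdd_below {x. 1 - cdf M x \<le> 1 / s}"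
proof -
  have "eventually (\<lambda>x. cdf M x > 1 - 1 / s) at_top"
    using cdf_lim_at_top_prob assms by (intro order_tendstoD(1)[of _ 1]) auto
  then obtain x where "cdf M x > 1 - 1 / s" by (auto simp: eventually_at_top_linorder)
  then show "{x. 1 - cdf M x \<le> 1 / s} \<noteq> {}" by (auto intro!: exI[of _ x])
  have "eventually (\<lambda>x. cdf M x < 1 - 1 / s) at_bot"
    using cdf_lim_at_bot assms by (intro order_tendstoD(2)[of _ 0]) auto
  then obtain b where b: "\<And>x. x \<le> b \<Longrightarrow> cdf M x < 1 - 1 / s"
    by (auto simp: eventually_at_bot_linorder)
  show "bdd_below {x. 1 - cdf M x \<le> 1 / s}"
  proof (rule bdd_belowI)
    fix x assume "x \<in> {x. 1 - cdf M x \<le> 1 / s}"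
    with b[of x] show "b \<le> x" by (cases "x \<le> b") auto
  qed
qed

lemma tail_quantile_le: "s > 1 \<Longrightarrow> 1 - cdf M y \<le> 1 / s \<Longrightarrow> tail_quantile (cdf M) s \<le> y"
  unfolding tail_quantile_def using tail_quantile_set by (intro cInf_lower) auto

lemma tail_quantile_ge:
  assumes "s > 1" "1 - cdf M y > 1 / s" shows "y \<le> tail_quantile (cdf M) s"
  unfolding tail_quantile_def
proof (rule cInf_greatest)
  show "{x. 1 - cdf M x \<le> 1 / s} \<noteq> {}" using tail_quantile_set assms by simp
  fix x assume "x \<in> {x. 1 - cdf M x \<le> 1 / s}"
  then show "y \<le> x" using assms cdf_nondecreasing[of x y] by (cases "y \<le> x") auto
qed

lemma tail_quantile_mono:
  assumes "1 < s" "s \<le> t" shows "tail_quantile (cdf M) s \<le> tail_quantile (cdf M) t"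
proof -
  have "1 / t \<le> 1 / s" using assms by (simp add: field_simps)
  then show ?thesis
    unfolding tail_quantile_def using assms tail_quantile_set[of t] tail_quantile_set[of s]
    by (intro cInf_superset_mono) auto
qed

text \<open>By right continuity the infimum is attained: a strict violation at the quantile would
  persist just to its right, against \<open>tail_quantile_ge\<close>.\<close>

lemma cdf_tail_quantile: 
  assumes "s > 1" shows "1 - cdf M (tail_quantile (cdf M) s) \<le> 1 / s"
proof (rule ccontr)
  let ?u = "tail_quantile (cdf M) s"
  assume "\<not> ?thesis"
  then have "cdf M ?u < 1 - 1 / s" by simp
  moreover have "(cdf M \<longlongrightarrow> cdf M ?u) (at_right ?u)"
    using cdf_is_right_cont[of ?u] by (simp add: continuous_within)
  ultimately have "eventually (\<lambda>y. cdf M y < 1 - 1 / s) (at_right ?u)"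
    by (intro order_tendstoD(2)) auto
  then obtain b where b: "b > ?u" "\<And>y. ?u < y \<Longrightarrow> y < b \<Longrightarrow> cdf M y < 1 - 1 / s"
    unfolding eventually_at_right_field by auto
  obtain y where y: "?u < y" "y < b" using dense b(1) by blast
  then have "y \<le> ?u" using b(2)[of y] assms by (intro tail_quantile_ge) auto
  with y show False by simp
qed

lemma prob_greaterThan: "prob {y<..} = 1 - cdf M y"
proof -
  have "{y<..} = space M - {..y}" by auto
  then show ?thesis by (simp add: cdf_def prob_compl del: space_eq_univ)
qed

lemma prob_greater_tail_quantile:
  assumes "s > 1" shows "prob {tail_quantile (cdf M) s<..} \<le> 1 / s"
  using cdf_tail_quantile[OF assms] by (simp add: prob_greaterThan)

text \<open>The closed half-line keeps a possible atom at the quantile. With the open half-line in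
  \<open>prob_greater_tail_quantile\<close> this pair of bounds is all that is used about the sample
  distribution when observations are counted.\<close>

lemma prob_atLeast_tail_quantile:
  assumes "s > 1" shows "prob {tail_quantile (cdf M) s..} \<ge> 1 / s"
proof -
  let ?u = "tail_quantile (cdf M) s"
  have lim: "(cdf M \<longlongrightarrow> prob {..<?u}) (at_left ?u)" by (rule cdf_at_left)
  have "prob {..<?u} \<le> 1 - 1 / s"
  proof (rule tendsto_upperbound[OF lim])
    show "eventually (\<lambda>y. cdf M y \<le> 1 - 1 / s) (at_left ?u)"
      unfolding eventually_at_left_field
    proof (intro exI[of _ "?u - 1"] conjI allI impI)
      fix y assume "y > ?u - 1" "y < ?u"
      then show "cdf M y \<le> 1 - 1 / s"
        using tail_quantile_le[OF assms, of y] by (cases "cdf M y \<le> 1 - 1 / s") auto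
    qed simp
  qed simp
  moreover have "{?u..} = space M - {..<?u}" by auto
  then have "prob {?u..} = 1 - prob {..<?u}" by (simp add: prob_compl del: space_eq_univ)
  ultimately show ?thesis by simp
qed

text \<open>Taking logarithms gives \<open>n * ln (f n) \<longlonglongrightarrow> - \<tau>\<close>,
  so \<open>f n\<close> tends to 1. The inequality \<open>ln y \<le> y - 1\<close>, applied at
  \<open>f n\<close> and at its reciprocal, then traps \<open>n * (1 - f n)\<close>.\<close>

lemma tail_of_power_limit:
  fixes f :: "nat \<Rightarrow> real"
  assumes "(\<lambda>n. f n ^ n) \<longlonglongrightarrow> exp (- \<tau>)" "\<And>n. 0 \<le> f n" "\<And>n. f n \<le> 1"
  shows "(\<lambda>n. real n * (1 - f n)) \<longlonglongrightarrow> \<tau>"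
proof -
  have ev0: "eventually (\<lambda>n. f n > 0 \<and> n > 0) sequentially"
  proof -
    have "eventually (\<lambda>n. f n ^ n > 0) sequentially"
      using assms(1) by (rule order_tendstoD) simp
    moreover have "eventually (\<lambda>n::nat. n > 0) sequentially" by (rule eventually_gt_at_top)
    ultimately show ?thesis
      by eventually_elim (use assms(2) in \<open>metis less_eq_real_def power_zero_numeral zero_power less_irrefl\<close>)
  qed
  have l1: "(\<lambda>n. real n * ln (f n)) \<longlonglongrightarrow> - \<tau>"
  proof -
    have "(\<lambda>n. ln (f n ^ n)) \<longlonglongrightarrow> ln (exp (- \<tau>))"
      using assms(1) by (intro tendsto_ln) auto
    moreover have "eventually (\<lambda>n. ln (f n ^ n) = real n * ln (f n)) sequentially"
      using ev0 by eventually_elim (simp add: ln_realpow)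
    ultimately show ?thesis by (simp add: tendsto_cong)
  qed
  have l2: "(\<lambda>n. ln (f n)) \<longlonglongrightarrow> 0"
  proof -
    have "(\<lambda>n. real n * ln (f n) * (1 / real n)) \<longlonglongrightarrow> - \<tau> * 0"
      by (intro tendsto_mult l1 lim_1_over_n)
    moreover have "eventually (\<lambda>n. real n * ln (f n) * (1 / real n) = ln (f n)) sequentially"
      using ev0 by eventually_elim simp
    ultimately show ?thesis by (simp add: tendsto_cong)
  qed
  have l3: "(\<lambda>n. real n * (1 - f n)) \<longlonglongrightarrow> \<tau>"
  proof (rule real_tendsto_sandwich)
    \<comment> \<open>\<open>exp (ln (f n))\<close> is eventually just \<open>f n\<close>; in this
      form its limit 1 is read off \<open>l2\<close>.\<close>
    show "(\<lambda>n. - (real n * ln (f n)) * exp (ln (f n))) \<longlonglongrightarrow> \<tau>"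
      using tendsto_mult[OF tendsto_minus[OF l1] tendsto_exp[OF l2]] by simp
    show "(\<lambda>n. - (real n * ln (f n))) \<longlonglongrightarrow> \<tau>"
      using tendsto_minus[OF l1] by simp
    show "eventually (\<lambda>n. real n * (1 - f n) \<le> - (real n * ln (f n))) sequentially"
      using ev0
    proof eventually_elim
      case (elim n)
      then have "1 - f n \<le> - ln (f n)" using ln_le_minus_one[of "f n"] by simp
      then have "real n * (1 - f n) \<le> real n * (- ln (f n))" by (intro mult_left_mono) auto
      then show ?case by simp
    qed
    show "eventually (\<lambda>n. - (real n * ln (f n)) * exp (ln (f n)) \<le> real n * (1 - f n)) sequentially"
      using ev0
    proof eventually_elim
      case (elim n)
      then have "ln (1 / f n) \<le> 1 / f n - 1" using ln_le_minus_one[of "1 / f n"] by simp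
      then have "- ln (f n) * f n \<le> 1 - f n" using elim by (simp add: ln_div field_simps)
      then have "real n * (- ln (f n) * f n) \<le> real n * (1 - f n)" by (intro mult_left_mono) auto
      then show ?case using elim by (simp add: mult_ac)
    qed
  qed
  show ?thesis by (rule l3)
qed

text \<open>
  With \<open>x = gev_quantile \<gamma> y\<close> the domain of attraction condition reads
  \<open>n (1 - F (a n x + b n)) \<longlonglongrightarrow> 1 / y\<close>.
\<close>

lemma attraction_quantile_limit:
  assumes a: "\<And>n. a n > 0"
    and lim: "\<And>x. 1 + \<gamma> * x > 0 \<Longrightarrow> (\<lambda>n. cdf M (a n * x + b n) ^ n) \<longlonglongrightarrow> gev \<gamma> x"
    and x: "x > 0"
  shows "((\<lambda>s. (tail_quantile (cdf M) (s * x) - b (nat \<lfloor>s\<rfloor>)) / a (nat \<lfloor>s\<rfloor>))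
    \<longlongrightarrow> gev_quantile \<gamma> x) at_top"
proof -
  let ?U = "tail_quantile (cdf M)" and ?h = "gev_quantile \<gamma>"
  let ?N = "\<lambda>s::real. nat \<lfloor>s\<rfloor>"
  have N_lim: "filterlim ?N sequentially at_top"
    by (intro filterlim_compose[OF filterlim_nat_sequentially] filterlim_floor_sequentially)
  \<comment> \<open>Passing from integers to real \<open>s\<close> costs only the factor
    \<open>s / \<lfloor>s\<rfloor>\<close>, which tends to 1.\<close>
  have tail: "((\<lambda>s. s * (1 - cdf M (a (?N s) * ?h y + b (?N s)))) \<longlongrightarrow> 1 / y) at_top"
    if y: "y > 0" for y
  proof -
    have "(\<lambda>n. cdf M (a n * ?h y + b n) ^ n) \<longlonglongrightarrow> exp (- (1 / y))"
      using lim[OF gev_gev_quantile(1)[OF y, of \<gamma>]] gev_gev_quantile(2)[OF y, of \<gamma>] by simp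
    from tail_of_power_limit[OF this] have
      "(\<lambda>n. real n * (1 - cdf M (a n * ?h y + b n))) \<longlonglongrightarrow> 1 / y"
      by (simp add: cdf_nonneg cdf_bounded_prob)
    from filterlim_compose[OF this N_lim]
    have 1: "((\<lambda>s. real (?N s) * (1 - cdf M (a (?N s) * ?h y + b (?N s)))) \<longlongrightarrow> 1 / y) at_top" .
    have 2: "((\<lambda>s::real. s / real (?N s)) \<longlongrightarrow> 1) at_top" by real_asymp
    have "((\<lambda>s. s / real (?N s) * (real (?N s) * (1 - cdf M (a (?N s) * ?h y + b (?N s)))))
      \<longlongrightarrow> 1 * (1 / y)) at_top"
      by (intro tendsto_mult 1 2)
    moreover have "eventually (\<lambda>s. s / real (?N s) * (real (?N s) * (1 - cdf M (a (?N s) * ?h y + b (?N s))))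
      = s * (1 - cdf M (a (?N s) * ?h y + b (?N s)))) at_top"
      using eventually_ge_at_top[of 1]
    proof eventually_elim
      case (elim s)
      then have "\<lfloor>s\<rfloor> \<ge> 1" by simp
      then have "real (?N s) \<noteq> 0" by linarith
      then show ?case by (metis (no_types, opaque_lifting) mult.assoc nonzero_divide_eq_eq)
    qed
    ultimately show ?thesis by (simp add: tendsto_cong)
  qed
  have big: "eventually (\<lambda>s. s * x > 1 \<and> s > 0) at_top"
    using eventually_gt_at_top[of "1 / x"] eventually_gt_at_top[of 0]
    by eventually_elim (use x in \<open>simp add: field_simps\<close>)
  show ?thesis
  proof (rule order_tendstoI)
    fix l assume l: "l < ?h x"
    \<comment> \<open>Continuity leaves room for some \<open>y < x\<close> with
      \<open>l < ?h y\<close>. Since \<open>1 / y > 1 / x\<close>, the tail at the level belonging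
      to \<open>y\<close> eventually exceeds \<open>1 / (s * x)\<close>, so the quantile lies above
      that level. The upper half is symmetric.\<close>
    have "eventually (\<lambda>y. l < ?h y \<and> 0 < y \<and> y < x) (at_left x)"
    proof (intro eventually_conj)
      have "(?h \<longlongrightarrow> ?h x) (at_left x)"
        using isCont_gev_quantile[OF x, of \<gamma>] by (auto simp: isCont_def filterlim_at_split)
      then show "eventually (\<lambda>y. l < ?h y) (at_left x)" using l by (rule order_tendstoD)
      show "eventually (\<lambda>y. 0 < y) (at_left x)"
        by (rule eventually_at_leftI[of 0 x]) (use x in auto)
      show "eventually (\<lambda>y. y < x) (at_left x)"
        by (auto simp: eventually_at_filter)
    qed
    then obtain y where y: "l < ?h y" "0 < y" "y < x"
      using eventually_happens'[OF trivial_limit_at_left_real[of x]] by blast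
    have "eventually (\<lambda>s. s * (1 - cdf M (a (?N s) * ?h y + b (?N s))) > 1 / x) at_top"
      using y x by (intro order_tendstoD(1)[OF tail]) (auto simp: field_simps)
    then show "eventually (\<lambda>s. l < (?U (s * x) - b (?N s)) / a (?N s)) at_top"
      using big
    proof eventually_elim
      case (elim s)
      then have "1 - cdf M (a (?N s) * ?h y + b (?N s)) > 1 / (s * x)"
        using x by (simp add: field_simps)
      then have "a (?N s) * ?h y + b (?N s) \<le> ?U (s * x)"
        using elim by (intro tail_quantile_ge) auto
      then have "?h y \<le> (?U (s * x) - b (?N s)) / a (?N s)"
        using a[of "?N s"] by (simp add: field_simps)
      then show ?case using y by simp
    qed
  next
    fix l assume l: "?h x < l"
    have "eventually (\<lambda>y. ?h y < l \<and> x < y) (at_right x)"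
    proof (intro eventually_conj)
      have "(?h \<longlongrightarrow> ?h x) (at_right x)"
        using isCont_gev_quantile[OF x, of \<gamma>] by (auto simp: isCont_def filterlim_at_split)
      then show "eventually (\<lambda>y. ?h y < l) (at_right x)" using l by (rule order_tendstoD)
      show "eventually (\<lambda>y. x < y) (at_right x)"
        by (auto simp: eventually_at_filter)
    qed
    then obtain y where y: "?h y < l" "x < y"
      using eventually_happens'[OF trivial_limit_at_right_real[of x]] by blast
    have "eventually (\<lambda>s. s * (1 - cdf M (a (?N s) * ?h y + b (?N s))) < 1 / x) at_top"
      using y x by (intro order_tendstoD(2)[OF tail]) (auto simp: field_simps)
    then show "eventually (\<lambda>s. (?U (s * x) - b (?N s)) / a (?N s) < l) at_top"
      using big
    proof eventually_elim
      case (elim s)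
      then have "1 - cdf M (a (?N s) * ?h y + b (?N s)) \<le> 1 / (s * x)"
        using x by (simp add: field_simps)
      then have "?U (s * x) \<le> a (?N s) * ?h y + b (?N s)"
        using elim by (intro tail_quantile_le) auto
      then have "(?U (s * x) - b (?N s)) / a (?N s) \<le> ?h y"
        using a[of "?N s"] by (simp add: field_simps)
      then show ?case using y by simp
    qed
  qed
qed

text \<open>In a quotient of differences both the centring \<open>b\<close> and the scale
  \<open>a\<close> cancel, which leaves a statement about the quantile function alone.\<close>

lemma tail_quantile_regular_variation:
  assumes "cdf M \<in> attraction_domain \<gamma>" "x > 0"
  shows "((\<lambda>s. (tail_quantile (cdf M) (s * x) - tail_quantile (cdf M) s)
      / (tail_quantile (cdf M) (s * 2) - tail_quantile (cdf M) s))
    \<longlongrightarrow> gev_quantile \<gamma> x / gev_quantile \<gamma> 2) at_top"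
proof -
  from assms(1) obtain a b :: "nat \<Rightarrow> real" where ab: "\<And>n. a n > 0"
    "\<And>x. 1 + \<gamma> * x > 0 \<Longrightarrow> (\<lambda>n. cdf M (a n * x + b n) ^ n) \<longlonglongrightarrow> gev \<gamma> x"
    unfolding attraction_domain_def by blast
  let ?U = "tail_quantile (cdf M)" and ?N = "\<lambda>s::real. nat \<lfloor>s\<rfloor>"
  define V where "V y s = (?U (s * y) - b (?N s)) / a (?N s)" for y s
  have V: "(V y \<longlongrightarrow> gev_quantile \<gamma> y) at_top" if "y > 0" for y
    unfolding V_def[abs_def] using attraction_quantile_limit[OF ab that] by simp
  have "gev_quantile \<gamma> 2 > 0" by (rule gev_quantile_pos) simp
  then have "((\<lambda>s. (V x s - V 1 s) / (V 2 s - V 1 s)) \<longlongrightarrow>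
      (gev_quantile \<gamma> x - gev_quantile \<gamma> 1) / (gev_quantile \<gamma> 2 - gev_quantile \<gamma> 1)) at_top"
    using assms(2) by (intro tendsto_intros V) auto
  moreover have "V y s - V z s = (?U (s * y) - ?U (s * z)) / a (?N s)" for y z s
    by (simp add: V_def diff_divide_distrib)
  ultimately show ?thesis using ab(1) by (simp add: less_imp_neq[THEN not_sym])
qed

end

section \<open>Extended regular variation\<close>

lemma one_less_mult_ge_1:
  fixes s :: real assumes "1 < s" "1 \<le> y" shows "1 < s * y"
proof -
  have "s * 1 \<le> s * y" using assms by (intro mult_left_mono) auto
  then show ?thesis using assms(1) by linarith
qed

text \<open>De Haan's extended regular variation, with the increment over one doubling as auxiliary
  function, so that increments of \<open>U\<close> over powers of two telescope into values of
  it.\<close>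

locale extended_regular_variation =
  fixes U :: "real \<Rightarrow> real" and \<gamma> :: real
  assumes U_mono: "1 < s \<Longrightarrow> s \<le> t \<Longrightarrow> U s \<le> U t"
    and U_lim: "x > 0 \<Longrightarrow>
      ((\<lambda>s. (U (s * x) - U s) / (U (s * 2) - U s)) \<longlongrightarrow> gev_quantile \<gamma> x / gev_quantile \<gamma> 2) at_top"
begin

definition \<alpha> :: "real \<Rightarrow> real" where "\<alpha> s = U (s * 2) - U s"

definition H :: "real \<Rightarrow> real" where "H x = gev_quantile \<gamma> x / gev_quantile \<gamma> 2"

lemma h2_pos: "gev_quantile \<gamma> 2 > 0"
  by (rule gev_quantile_pos) simp

lemma H_1 [simp]: "H 1 = 0" and H_2 [simp]: "H 2 = 1"
  using h2_pos by (auto simp: H_def)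

lemma H_mult: "x > 0 \<Longrightarrow> y > 0 \<Longrightarrow> H (x * y) = H x + x powr \<gamma> * H y"
  by (simp add: H_def gev_quantile_mult add_divide_distrib)

lemma H_strict_mono: "0 < x \<Longrightarrow> x < y \<Longrightarrow> H x < H y"
  using h2_pos gev_quantile_strict_mono[of x y \<gamma>] by (simp add: H_def divide_strict_right_mono)

lemma H_pos: "x > 1 \<Longrightarrow> H x > 0"
  using H_strict_mono[of 1 x] by simp

lemma isCont_H: "x > 0 \<Longrightarrow> isCont H x"
  unfolding H_def[abs_def] using h2_pos isCont_gev_quantile[of x \<gamma>] by (intro continuous_intros) auto

lemma U_lim_H: "x > 0 \<Longrightarrow> ((\<lambda>s. (U (s * x) - U s) / \<alpha> s) \<longlongrightarrow> H x) at_top"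
  using U_lim by (simp add: \<alpha>_def H_def)

lemma eventually_\<alpha>_pos: "eventually (\<lambda>s. \<alpha> s > 0) at_top"
proof -
  have "eventually (\<lambda>s. (U (s * 2) - U s) / \<alpha> s > 0) at_top"
    by (rule order_tendstoD(1)[OF U_lim_H]) auto
  with eventually_gt_at_top[of 1] show ?thesis
  proof eventually_elim
    case (elim s)
    then have "U s \<le> U (s * 2)" by (intro U_mono) auto
    then show ?case using elim by (auto simp: \<alpha>_def split: if_splits)
  qed
qed

text \<open>Monotonicity of \<open>U\<close> and continuity of \<open>H\<close> upgrade the
  pointwise limit to varying arguments: \<open>x n\<close> is eventually caught on either side by a
  fixed \<open>y\<close> whose \<open>H y\<close> is close to \<open>H x0\<close>.\<close>

lemma U_lim_seq:
  assumes s: "filterlim s at_top F" and x: "(x \<longlongrightarrow> x0) F" and x0: "x0 > 0"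
  shows "((\<lambda>n. (U (s n * x n) - U (s n)) / \<alpha> (s n)) \<longlongrightarrow> H x0) F"
proof -
  have big: "eventually (\<lambda>n. s n * y > 1 \<and> \<alpha> (s n) > 0 \<and> s n > 0) F" if y: "y > 0" for y
  proof -
    have "eventually (\<lambda>s. s * y > 1 \<and> \<alpha> s > 0 \<and> s > 0) at_top"
      using eventually_gt_at_top[of "1 / y"] eventually_\<alpha>_pos eventually_gt_at_top[of 0]
      by eventually_elim (use y in \<open>simp add: field_simps\<close>)
    from eventually_compose_filterlim[OF this s] show ?thesis .
  qed
  show ?thesis
  proof (rule order_tendstoI)
    fix l assume l: "l < H x0"
    have "eventually (\<lambda>y. l < H y \<and> 0 < y \<and> y < x0) (at_left x0)"
    proof (intro eventually_conj)
      have "(H \<longlongrightarrow> H x0) (at_left x0)"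
        using isCont_H[OF x0] by (auto simp: isCont_def filterlim_at_split)
      then show "eventually (\<lambda>y. l < H y) (at_left x0)" using l by (rule order_tendstoD)
      show "eventually (\<lambda>y. 0 < y) (at_left x0)"
        by (rule eventually_at_leftI[of 0 x0]) (use x0 in auto)
      show "eventually (\<lambda>y. y < x0) (at_left x0)"
        by (auto simp: eventually_at_filter)
    qed
    then obtain y where y: "l < H y" "0 < y" "y < x0"
      using eventually_happens'[OF trivial_limit_at_left_real[of x0]] by blast
    have "eventually (\<lambda>n. l < (U (s n * y) - U (s n)) / \<alpha> (s n)) F"
      by (rule order_tendstoD(1)[OF filterlim_compose[OF U_lim_H[OF y(2)] s] y(1)])
    with big[OF y(2)] order_tendstoD(1)[OF x y(3)]
    show "eventually (\<lambda>n. l < (U (s n * x n) - U (s n)) / \<alpha> (s n)) F"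
    proof eventually_elim
      case (elim n)
      then have "U (s n * y) \<le> U (s n * x n)" by (intro U_mono) auto
      then have "(U (s n * y) - U (s n)) / \<alpha> (s n) \<le> (U (s n * x n) - U (s n)) / \<alpha> (s n)"
        using elim by (intro divide_right_mono) auto
      with elim show ?case by simp
    qed
  next
    fix l assume l: "H x0 < l"
    have "eventually (\<lambda>y. H y < l \<and> x0 < y) (at_right x0)"
    proof (intro eventually_conj)
      have "(H \<longlongrightarrow> H x0) (at_right x0)"
        using isCont_H[OF x0] by (auto simp: isCont_def filterlim_at_split)
      then show "eventually (\<lambda>y. H y < l) (at_right x0)" using l by (rule order_tendstoD)
      show "eventually (\<lambda>y. x0 < y) (at_right x0)"
        by (auto simp: eventually_at_filter)
    qed
    then obtain y where y: "H y < l" "x0 < y"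
      using eventually_happens'[OF trivial_limit_at_right_real[of x0]] by blast
    have "y > 0" using y x0 by simp
    have "eventually (\<lambda>n. (U (s n * y) - U (s n)) / \<alpha> (s n) < l) F"
      by (rule order_tendstoD(2)[OF filterlim_compose[OF U_lim_H[OF \<open>y > 0\<close>] s] y(1)])
    moreover have "eventually (\<lambda>n. s n * (x0 / 2) > 1 \<and> \<alpha> (s n) > 0 \<and> s n > 0) F"
      using x0 by (intro big) simp
    moreover have "eventually (\<lambda>n. x0 / 2 < x n) F"
      using x0 by (intro order_tendstoD(1)[OF x]) simp
    ultimately show "eventually (\<lambda>n. (U (s n * x n) - U (s n)) / \<alpha> (s n) < l) F"
      using order_tendstoD(2)[OF x y(2)]
    proof eventually_elim
      case (elim n)
      then have "s n * (x0 / 2) < s n * x n" by (intro mult_strict_left_mono) auto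
      then have "1 < s n * x n" using elim by linarith
      then have "U (s n * x n) \<le> U (s n * y)" using elim by (intro U_mono) auto
      then have "(U (s n * x n) - U (s n)) / \<alpha> (s n) \<le> (U (s n * y) - U (s n)) / \<alpha> (s n)"
        using elim by (intro divide_right_mono) auto
      with elim show ?case by simp
    qed
  qed
qed

text \<open>The numerator is the increment of \<open>U\<close> between \<open>s * x\<close> and
  \<open>s * (2 * x)\<close>. Its limit \<open>H (2 * x0) - H x0\<close> equals
  \<open>x0 powr \<gamma>\<close> because \<open>H 2 = 1\<close>.\<close>

lemma \<alpha>_lim_seq:
  assumes s: "filterlim s at_top F" and x: "(x \<longlongrightarrow> x0) F" and x0: "x0 > 0"
  shows "((\<lambda>n. \<alpha> (s n * x n) / \<alpha> (s n)) \<longlongrightarrow> x0 powr \<gamma>) F"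
proof -
  have "((\<lambda>n. (U (s n * (x n * 2)) - U (s n)) / \<alpha> (s n) - (U (s n * x n) - U (s n)) / \<alpha> (s n))
      \<longlongrightarrow> H (x0 * 2) - H x0) F"
    using x0 by (intro tendsto_diff U_lim_seq[OF s] tendsto_mult_right x) auto
  moreover have "H (x0 * 2) - H x0 = x0 powr \<gamma>"
    using H_mult[OF x0, of 2] by simp
  ultimately show ?thesis
    by (simp add: \<alpha>_def[of "s _ * x _"] diff_divide_distrib mult.assoc)
qed

text \<open>Potter-type bounds, obtained by iterating the limit relations along powers of two.\<close>

lemma U_increment_bound:
  assumes g: "\<gamma> < g" "0 < g"
  obtains C s0 where "C > 0" "s0 > 1" "\<And>s. s \<ge> s0 \<Longrightarrow> \<alpha> s > 0"
    "\<And>s x. s \<ge> s0 \<Longrightarrow> x \<ge> 1 \<Longrightarrow> U (s * x) - U s \<le> C * \<alpha> s * x powr g"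
proof -
  have "((\<lambda>s. \<alpha> (s * 2) / \<alpha> s) \<longlongrightarrow> 2 powr \<gamma>) at_top"
    by (rule \<alpha>_lim_seq) (auto simp: filterlim_ident)
  then have "eventually (\<lambda>s. \<alpha> (s * 2) / \<alpha> s < 2 powr g) at_top"
    using g by (intro order_tendstoD(2)) auto
  with eventually_\<alpha>_pos eventually_gt_at_top[of 1]
  have "eventually (\<lambda>s. \<alpha> s > 0 \<and> s > 1 \<and> \<alpha> (s * 2) \<le> 2 powr g * \<alpha> s) at_top"
    by eventually_elim (auto simp: field_simps)
  then obtain s0 where s0: "\<And>s. s \<ge> s0 \<Longrightarrow> \<alpha> s > 0 \<and> s > 1 \<and> \<alpha> (s * 2) \<le> 2 powr g * \<alpha> s"
    by (auto simp: eventually_at_top_linorder)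
  \<comment> \<open>Solves \<open>1 + K = K * 2 powr g\<close>, the identity that closes the
    induction for \<open>pow\<close>; it bounds a geometric sum relative to its next term.\<close>
  define K where "K = 1 / (2 powr g - 1)"
  have g1: "2 powr g > 1" using g by simp
  have step: "\<alpha> (s * 2 ^ i) \<le> (2 powr g) ^ i * \<alpha> s" if "s \<ge> s0" for s i
  proof (induction i)
    case (Suc i)
    have "s * 1 \<le> s * 2 ^ i" using s0[OF that] by (intro mult_left_mono) auto
    then have "s * 2 ^ i \<ge> s0" using that by simp
    then have "\<alpha> (s * 2 ^ i * 2) \<le> 2 powr g * \<alpha> (s * 2 ^ i)" using s0 by blast
    also have "\<dots> \<le> 2 powr g * ((2 powr g) ^ i * \<alpha> s)" by (intro mult_left_mono Suc) auto
    finally show ?case by (simp add: mult_ac)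
  qed simp
  have pow: "U (s * 2 ^ i) - U s \<le> K * \<alpha> s * (2 powr g) ^ i" if "s \<ge> s0" for s i
  proof (induction i)
    case 0
    show ?case using s0[OF that] g1 by (simp add: K_def)
  next
    case (Suc i)
    have "U (s * 2 ^ Suc i) - U s = \<alpha> (s * 2 ^ i) + (U (s * 2 ^ i) - U s)"
      by (simp add: \<alpha>_def mult_ac)
    also have "\<dots> \<le> (2 powr g) ^ i * \<alpha> s + K * \<alpha> s * (2 powr g) ^ i"
      by (intro add_mono step Suc that)
    also have "\<dots> = (2 powr g) ^ i * \<alpha> s * (1 + K)" by (simp add: algebra_simps)
    also have "K * (2 powr g - 1) = 1" using g1 g by (simp add: K_def)
    then have "1 + K = K * 2 powr g" by (simp add: algebra_simps)
    finally show ?case by (simp add: mult_ac)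
  qed
  show ?thesis
  proof
    show "K * 2 powr g > 0" using g1 by (simp add: K_def)
    show "s0 > 1" using s0[of s0] by simp
    show "\<alpha> s > 0" if "s \<ge> s0" for s using s0[OF that] by simp
    fix s x :: real assume s: "s \<ge> s0" and x: "x \<ge> 1"
    \<comment> \<open>Rounding \<open>x\<close> up to a power of two at most doubles it, which is
      absorbed by the factor \<open>2 powr g\<close>. Monotonicity of \<open>U\<close> justifies
      rounding up.\<close>
    define i where "i = nat \<lceil>log 2 x\<rceil>"
    have "log 2 x \<ge> 0" using x by simp
    then have i: "log 2 x \<le> real i" "real i < log 2 x + 1"
      unfolding i_def by linarith+
    have i1: "x \<le> 2 ^ i" using i(1) x by (simp add: log_le_iff powr_realpow)
    have "(2::real) ^ i = 2 powr real i" by (simp add: powr_realpow)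
    also have "\<dots> \<le> 2 powr (log 2 x + 1)" using i by (intro powr_mono) auto
    also have "\<dots> = 2 * x" using x by (simp add: powr_add)
    finally have i2: "2 ^ i \<le> 2 * x" .
    have "1 < s * x" using s0[OF s] x by (intro one_less_mult_ge_1) auto
    moreover have "s * x \<le> s * 2 ^ i" using s0[OF s] i1 by (intro mult_left_mono) auto
    ultimately have "U (s * x) \<le> U (s * 2 ^ i)" using s0[OF s] by (intro U_mono) auto
    then have "U (s * x) - U s \<le> K * \<alpha> s * (2 powr g) ^ i" using pow[OF s, of i] by simp
    also have "(2 powr g) ^ i = (2 ^ i) powr g" by (simp add: powr_power powr_realpow[symmetric] powr_powr mult.commute)
    also have "K * \<alpha> s * (2 ^ i) powr g \<le> K * \<alpha> s * (2 * x) powr g"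
      using i2 g s0[OF s] g1 by (intro mult_left_mono powr_mono2) (auto simp: K_def intro!: divide_nonneg_pos)
    finally show "U (s * x) - U s \<le> K * 2 powr g * \<alpha> s * x powr g"
      using x by (simp add: powr_mult mult_ac)
  qed
qed

text \<open>Since \<open>\<alpha>\<close> need not be monotone, iteration along powers of two does
  not reach intermediate arguments. A separate bound for factors in \<open>[1, 2]\<close> comes
  first, and the dyadic steps are then started from there.\<close>

lemma \<alpha>_lower_bound:
  obtains c \<kappa> s0 where "c > 0" "\<kappa> > 0" "s0 > 1"
    "\<And>s x. s \<ge> s0 \<Longrightarrow> x \<ge> 1 \<Longrightarrow> \<alpha> (s * x) \<ge> c * x powr (- \<kappa>) * \<alpha> s"
proof -
  \<comment> \<open>Any positive exponent with \<open>- \<kappa> < \<gamma>\<close> would do;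
    nothing sharper is required, because later only the logarithm of the bound matters.\<close>
  define \<kappa> where "\<kappa> = \<bar>\<gamma>\<bar> + 1"
  have \<kappa>: "\<kappa> > 0" "- \<kappa> < \<gamma>" by (auto simp: \<kappa>_def)
  have id: "filterlim (\<lambda>s. s) at_top (at_top :: real filter)" by (simp add: filterlim_ident)
  let ?q = "sqrt 2"
  have q: "1 < ?q" "?q < 2" "?q * ?q = 2" by (auto simp: real_less_lsqrt)
  \<comment> \<open>Half of the smaller limiting increment over \<open>[sqrt 2, 2]\<close> and over
    \<open>[2, 2 * sqrt 2]\<close>. For \<open>y\<close> in \<open>[1, 2]\<close> the interval
    \<open>[y, 2 * y]\<close> contains one of these two, according to whether
    \<open>y \<le> sqrt 2\<close>.\<close>
  define c where "c = min (H 2 - H ?q) (H (?q * 2) - H 2) / 2"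
  have c: "c > 0" "c < H 2 - H ?q" "c < H (?q * 2) - H 2"
    using H_strict_mono[of ?q 2] H_strict_mono[of 2 "?q * 2"] q by (auto simp: c_def)
  have "((\<lambda>s. \<alpha> (s * 2) / \<alpha> s) \<longlongrightarrow> 2 powr \<gamma>) at_top"
    by (rule \<alpha>_lim_seq[OF id]) auto
  then have "eventually (\<lambda>s. \<alpha> (s * 2) / \<alpha> s > 2 powr (- \<kappa>)) at_top"
    using \<kappa> by (intro order_tendstoD(1)) auto
  moreover have "eventually (\<lambda>s. (U (s * 2) - U s) / \<alpha> s - (U (s * ?q) - U s) / \<alpha> s > c) at_top"
    using c q by (intro order_tendstoD(1)[OF tendsto_diff[OF U_lim_H U_lim_H]]) auto
  moreover have "eventually (\<lambda>s. (U (s * (?q * 2)) - U s) / \<alpha> s - (U (s * 2) - U s) / \<alpha> s > c) at_top"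
    using c q by (intro order_tendstoD(1)[OF tendsto_diff[OF U_lim_H U_lim_H]]) auto
  ultimately have "eventually (\<lambda>s. \<alpha> s > 0 \<and> s > 1 \<and> \<alpha> (s * 2) \<ge> 2 powr (- \<kappa>) * \<alpha> s \<and>
     U (s * 2) - U (s * ?q) \<ge> c * \<alpha> s \<and> U (s * (?q * 2)) - U (s * 2) \<ge> c * \<alpha> s) at_top"
    using eventually_\<alpha>_pos eventually_gt_at_top[of 1]
    by eventually_elim (auto simp: field_simps)
  then obtain s0 where s0: "\<And>s. s \<ge> s0 \<Longrightarrow> \<alpha> s > 0 \<and> s > 1 \<and> \<alpha> (s * 2) \<ge> 2 powr (- \<kappa>) * \<alpha> s \<and>
     U (s * 2) - U (s * ?q) \<ge> c * \<alpha> s \<and> U (s * (?q * 2)) - U (s * 2) \<ge> c * \<alpha> s"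
    by (auto simp: eventually_at_top_linorder)
  have step: "\<alpha> (s * 2 ^ i) \<ge> (2 powr (- \<kappa>)) ^ i * \<alpha> s" if "s \<ge> s0" for s i
  proof (induction i)
    case (Suc i)
    have "s * 1 \<le> s * 2 ^ i" using s0[OF that] by (intro mult_left_mono) auto
    then have "s * 2 ^ i \<ge> s0" using that by simp
    then have "2 powr (- \<kappa>) * \<alpha> (s * 2 ^ i) \<le> \<alpha> (s * 2 ^ i * 2)" using s0 by blast
    moreover have "2 powr (- \<kappa>) * ((2 powr (- \<kappa>)) ^ i * \<alpha> s) \<le> 2 powr (- \<kappa>) * \<alpha> (s * 2 ^ i)"
      by (intro mult_left_mono Suc) auto
    ultimately have "2 powr (- \<kappa>) * ((2 powr (- \<kappa>)) ^ i * \<alpha> s) \<le> \<alpha> (s * 2 ^ i * 2)" by linarith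
    then show ?case by (simp add: mult_ac)
  qed simp
  have local: "\<alpha> (s * y) \<ge> c * \<alpha> s" if s: "s \<ge> s0" and y: "1 \<le> y" "y \<le> 2" for s y
  proof (cases "y \<le> ?q")
    case True
    have s1: "s > 1" using s0[OF s] by simp
    have "s * 1 \<le> s * y" "s * y \<le> s * ?q" "s * 2 \<le> s * (y * 2)"
      using True y s1 by (auto intro!: mult_left_mono)
    moreover have "1 < s * y" using s1 y by (intro one_less_mult_ge_1)
    ultimately have "U (s * y) \<le> U (s * ?q)" "U (s * 2) \<le> U (s * y * 2)"
      using s1 by (auto intro!: U_mono simp: mult.assoc)
    then show ?thesis using s0[OF s] by (auto simp: \<alpha>_def[of "s * y"])
  next
    case False
    have s1: "s > 1" using s0[OF s] by simp
    have "s * 1 \<le> s * y" "s * y \<le> s * 2" "s * (?q * 2) \<le> s * (y * 2)" "s * 1 \<le> s * (?q * 2)"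
      using False y s1 q by (intro mult_left_mono; linarith)+
    moreover have "1 < s * y" "1 < s * (?q * 2)"
      using s1 y q by (intro one_less_mult_ge_1; linarith)+
    ultimately have "U (s * y) \<le> U (s * 2)" "U (s * (?q * 2)) \<le> U (s * y * 2)"
      using s1 by (auto intro!: U_mono simp: mult.assoc)
    then show ?thesis using s0[OF s] by (auto simp: \<alpha>_def[of "s * y"])
  qed
  show ?thesis
  proof
    show "s0 > 1" using s0[of s0] by simp
    fix s x :: real assume s: "s \<ge> s0" and x: "x \<ge> 1"
    define i where "i = nat \<lfloor>log 2 x\<rfloor>"
    define y where "y = x / 2 ^ i"
    have "log 2 x \<ge> 0" using x by simp
    then have i: "real i \<le> log 2 x" "log 2 x < real i + 1"
      unfolding i_def by linarith+
    have i1: "2 ^ i \<le> x" using i(1) x by (simp add: le_log_iff powr_realpow)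
    have "x \<le> 2 powr (real i + 1)" using i x powr_mono[of "log 2 x" "real i + 1" 2] by simp
    also have "\<dots> = 2 ^ i * 2" by (simp add: powr_add powr_realpow)
    finally have y: "1 \<le> y" "y \<le> 2" using i1 by (auto simp: y_def field_simps)
    have "s * 1 \<le> s * y" using s0[OF s] y by (intro mult_left_mono) auto
    then have sy: "s * y \<ge> s0" using s by simp
    have "x powr (- \<kappa>) \<le> (2 ^ i) powr (- \<kappa>)"
      using i1 \<kappa> by (intro powr_mono2') auto
    also have "\<dots> = (2 powr (- \<kappa>)) ^ i"
      by (simp add: powr_power powr_realpow[symmetric] powr_powr mult.commute)
    finally have p: "x powr (- \<kappa>) \<le> (2 powr (- \<kappa>)) ^ i" .
    have "x powr (- \<kappa>) * (c * \<alpha> s) \<le> (2 powr (- \<kappa>)) ^ i * \<alpha> (s * y)"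
      using p local[OF s y] c s0[OF s] by (intro mult_mono) auto
    also have "\<dots> \<le> \<alpha> (s * y * 2 ^ i)" by (rule step[OF sy])
    also have "s * y * 2 ^ i = s * x" by (simp add: y_def)
    finally show "\<alpha> (s * x) \<ge> c * x powr (- \<kappa>) * \<alpha> s" by (simp add: mult_ac)
  qed (use c \<kappa> in auto)
qed

lemma H_measurable [measurable]: "H \<in> borel_measurable borel"
proof -
  have "gev_quantile \<gamma> \<in> borel_measurable borel"
    by (cases "\<gamma> = 0") (simp_all add: gev_quantile_def[abs_def])
  then show ?thesis unfolding H_def[abs_def] by measurable
qed

text \<open>The bound on increments of \<open>U\<close> has a constant independent of
  \<open>s\<close>, so it survives the limit that defines \<open>H\<close>.\<close>

lemma H_bound:
  assumes "\<gamma> < g" "0 < g"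
  obtains C where "C > 0" "\<And>x. x \<ge> 1 \<Longrightarrow> H x \<le> C * x powr g"
proof -
  obtain C s0 where C: "C > 0" "s0 > 1" "\<And>s. s \<ge> s0 \<Longrightarrow> \<alpha> s > 0"
    "\<And>s x. s \<ge> s0 \<Longrightarrow> x \<ge> 1 \<Longrightarrow> U (s * x) - U s \<le> C * \<alpha> s * x powr g"
    using U_increment_bound[OF assms] by blast
  have "H x \<le> C * x powr g" if "x \<ge> 1" for x
  proof (rule tendsto_upperbound[OF U_lim_H])
    show "eventually (\<lambda>s. (U (s * x) - U s) / \<alpha> s \<le> C * x powr g) at_top"
      using eventually_ge_at_top[of s0]
      by eventually_elim (use C that in \<open>simp add: field_simps\<close>)
  qed (use that in auto)
  with C(1) show ?thesis using that by blast
qed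

end

section \<open>Order statistics\<close>

text \<open>In a decreasing list the elements with an upward closed property form a prefix, so
  position \<open>k\<close> has the property exactly when the prefix is longer than
  \<open>k\<close>.\<close>

lemma sorted_wrt_nth_iff_filter:
  fixes xs :: "'b :: linorder list"
  assumes up: "\<And>x y. x \<le> y \<Longrightarrow> P x \<Longrightarrow> P y"
  shows "sorted_wrt (\<ge>) xs \<Longrightarrow> k < length xs \<Longrightarrow> P (xs ! k) \<longleftrightarrow> k < length (filter P xs)"
proof (induction xs arbitrary: k)
  case (Cons x xs)
  show ?case
  proof (cases "P x")
    case True
    then show ?thesis using Cons by (cases k) auto
  next
    case False
    then have "\<not> P y" if "y \<in> set (x # xs)" for y
      using Cons.prems(1) up that by auto
    then have "filter P (x # xs) = []" "\<not> P ((x # xs) ! k)"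
      using Cons.prems(2) nth_mem[OF Cons.prems(2)] by (auto simp: filter_empty_conv)
    then show ?thesis by simp
  qed
qed simp

text \<open>The bridge from order statistics to counts. A general upward closed \<open>P\<close>
  covers weak and strict exceedance at once, and both are needed in the presence of atoms.\<close>

lemma desc_order_stat_iff:
  assumes "1 \<le> i" "i \<le> n" and up: "\<And>x y. x \<le> y \<Longrightarrow> P x \<Longrightarrow> P y"
  shows "P (desc_order_stat X n i \<omega>) \<longleftrightarrow> i \<le> card {j \<in> {1..n}. P (X j \<omega>)}"
proof -
  let ?L = "map (\<lambda>j. X j \<omega>) [1..<n + 1]"
  have "P (rev (sort ?L) ! (i - 1)) \<longleftrightarrow> i - 1 < length (filter P (rev (sort ?L)))"
  proof (rule sorted_wrt_nth_iff_filter)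
    show "P x \<Longrightarrow> P y" if "x \<le> y" for x y using up that by blast
    have "sorted (sort ?L)" by simp
    then show "sorted_wrt (\<ge>) (rev (sort ?L))" by (simp only: sorted_wrt_rev)
    show "i - 1 < length (rev (sort ?L))" using assms(1,2) by simp
  qed
  also have "length (filter P (rev (sort ?L))) = size (mset (filter P (rev (sort ?L))))"
    by (rule size_mset[symmetric])
  also have "mset (filter P (rev (sort ?L))) = mset (filter P ?L)"
    by (simp only: mset_filter mset_rev mset_sort)
  also have "size \<dots> = length (filter (\<lambda>j. P (X j \<omega>)) [1..<n + 1])"
    by (simp only: size_mset filter_map length_map comp_def)
  also have "\<dots> = card ({j. P (X j \<omega>)} \<inter> set [1..<n + 1])"
    by (rule distinct_length_filter) simp
  also have "{j. P (X j \<omega>)} \<inter> set [1..<n + 1] = {j \<in> {1..n}. P (X j \<omega>)}" by auto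
  finally show ?thesis using assms(1) by (auto simp: desc_order_stat_def)
qed

lemma desc_order_stat_ge_iff:
  "1 \<le> i \<Longrightarrow> i \<le> n \<Longrightarrow> v \<le> desc_order_stat X n i \<omega> \<longleftrightarrow> i \<le> card {j \<in> {1..n}. v \<le> X j \<omega>}"
  by (rule desc_order_stat_iff[where P = "\<lambda>x. v \<le> x"]) auto

lemma desc_order_stat_greater_iff:
  "1 \<le> i \<Longrightarrow> i \<le> n \<Longrightarrow> v < desc_order_stat X n i \<omega> \<longleftrightarrow> i \<le> card {j \<in> {1..n}. v < X j \<omega>}"
  by (rule desc_order_stat_iff[where P = "\<lambda>x. v < x"]) auto

lemma desc_order_stat_antimono:
  assumes "1 \<le> i" "i \<le> k" "k \<le> n"
  shows "desc_order_stat X n k \<omega> \<le> desc_order_stat X n i \<omega>"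
proof -
  let ?v = "desc_order_stat X n k \<omega>"
  have "k \<le> card {j \<in> {1..n}. ?v \<le> X j \<omega>}"
    using assms desc_order_stat_ge_iff[of k n ?v X \<omega>] by simp
  then show ?thesis using assms by (subst desc_order_stat_ge_iff) auto
qed

lemma borel_measurable_desc_order_stat:
  assumes X [measurable]: "\<And>j. 1 \<le> j \<Longrightarrow> X j \<in> borel_measurable M" and "1 \<le> i" "i \<le> n"
  shows "desc_order_stat X n i \<in> borel_measurable M"
proof (rule borel_measurableI_ge)
  fix v
  have "{\<omega> \<in> space M. v \<le> desc_order_stat X n i \<omega>}
      = {\<omega> \<in> space M. real i \<le> (\<Sum>j = 1..n. if v \<le> X j \<omega> then 1 else 0)}"
    by (auto simp: desc_order_stat_ge_iff[OF assms(2,3)] sum.If_cases Int_def)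
  also have "\<dots> \<in> sets M" by measurable
  finally show "{\<omega> \<in> space M. v \<le> desc_order_stat X n i \<omega>} \<in> sets M" .
qed

lemma borel_measurable_cvar_order_stat:
  assumes "\<And>j. 1 \<le> j \<Longrightarrow> X j \<in> borel_measurable M" "k \<le> n"
  shows "cvar_order_stat X n k \<in> borel_measurable M"
  unfolding cvar_order_stat_def[abs_def] using assms
  by (intro borel_measurable_divide borel_measurable_sum borel_measurable_const
      borel_measurable_desc_order_stat) auto

section \<open>Deterministic inequalities for running averages of a decreasing sequence\<close>

context
  fixes x :: "nat \<Rightarrow> real" and n :: nat
  assumes anti: "\<And>i k. 1 \<le> i \<Longrightarrow> i \<le> k \<Longrightarrow> k \<le> n \<Longrightarrow> x k \<le> x i"
begin

private abbreviation "avg k \<equiv> (\<Sum>i = 1..k. x i) / real k"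

text \<open>Every term after position \<open>j\<close> is at most \<open>x (j + 1)\<close>.
  Replacing all of them by this value only raises the longer average, which then is a convex
  combination of \<open>avg j\<close> and \<open>x (j + 1)\<close>.\<close>

lemma avg_diff_lower:
  assumes "1 \<le> j" "j < k" "k \<le> n"
  shows "avg j - avg k \<ge> (1 - real j / real k) * (avg j - x (j + 1))"
proof -
  have "(\<Sum>i = 1..k. x i) = (\<Sum>i = 1..j. x i) + (\<Sum>i = j + 1..k. x i)"
    using assms sum.ub_add_nat[of 1 j x "k - j"] by simp
  also have "(\<Sum>i = j + 1..k. x i) \<le> (\<Sum>i = j + 1..k. x (j + 1))"
    using assms by (intro sum_mono anti) auto
  finally have 1: "(\<Sum>i = 1..k. x i) \<le> real j * avg j + (real k - real j) * x (j + 1)"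
    using assms by (simp add: of_nat_diff)
  have "avg k \<le> (real j * avg j + (real k - real j) * x (j + 1)) / real k"
    by (intro divide_right_mono 1) simp
  also have "\<dots> = avg j - (1 - real j / real k) * (avg j - x (j + 1))"
    using assms by (simp add: field_simps)
  finally show ?thesis by simp
qed

text \<open>All excesses over \<open>x (j + 1)\<close> are nonnegative, so those after the first
  \<open>i\<close> may be dropped, and each of the first \<open>i\<close> is at least
  \<open>x i - x (j + 1)\<close>.\<close>

lemma avg_minus_next:
  assumes "1 \<le> i" "i \<le> j" "j < n"
  shows "avg j - x (j + 1) \<ge> real i / real j * (x i - x (j + 1))"
proof -
  have "real i * (x i - x (j + 1)) = (\<Sum>l = 1..i. x i - x (j + 1))" by simp
  also have "\<dots> \<le> (\<Sum>l = 1..i. x l - x (j + 1))"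
    using assms by (intro sum_mono diff_right_mono anti) auto
  also have "\<dots> \<le> (\<Sum>l = 1..j. x l - x (j + 1))"
    using assms by (intro sum_mono2) (auto intro!: anti)
  also have "\<dots> = real j * (avg j - x (j + 1))"
    using assms by (simp add: sum_subtractf algebra_simps)
  finally show ?thesis using assms by (simp add: field_simps)
qed

lemma avg_diff_lower_bound:
  assumes c: "0 < c" "c < 1" and k: "1 \<le> k" "k < n" and i: "1 \<le> i" "i \<le> j"
    and j: "j = nat \<lfloor>c * real k\<rfloor> + 1"
  shows "avg j - avg (k + 1) \<ge> (1 - c) / 2 * (real i / real j * (x i - x (j + 1)))"
proof -
  have ck: "c * real k < real k" "c * real k \<ge> 0" using c k by auto
  have j_le: "real j \<le> c * real k + 1" using ck by (simp add: j)
  have "real j < real k + 1" using ck j_le by linarith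
  then have jk: "j \<le> k" by linarith
  \<comment> \<open>From \<open>j \<le> c * k + 1\<close> the right-hand side is at least
    \<open>(1 - c) * k / (k + 1)\<close>, and \<open>k \<ge> 1\<close> makes the last quotient at
    least one half.\<close>
  have 1: "(1 - c) / 2 \<le> 1 - real j / real (k + 1)"
  proof -
    have "(1 - c) * (real k + 1) \<le> (1 - c) * (2 * real k)" using c k by (intro mult_left_mono) auto
    then show ?thesis using j_le by (simp add: field_simps)
  qed
  have 2: "real i / real j * (x i - x (j + 1)) \<ge> 0"
    using anti[of i "j + 1"] i jk k by (intro mult_nonneg_nonneg) auto
  have "(1 - c) / 2 * (real i / real j * (x i - x (j + 1)))
      \<le> (1 - real j / real (k + 1)) * (real i / real j * (x i - x (j + 1)))"
    using 1 2 by (rule mult_right_mono)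
  also have "\<dots> \<le> (1 - real j / real (k + 1)) * (avg j - x (j + 1))"
  proof (rule mult_left_mono)
    show "real i / real j * (x i - x (j + 1)) \<le> avg j - x (j + 1)"
      using avg_minus_next[OF i] jk k by simp
    show "0 \<le> 1 - real j / real (k + 1)" using jk by simp
  qed
  also have "\<dots> \<le> avg j - avg (k + 1)"
    using i jk k by (intro avg_diff_lower) auto
  finally show "avg j - avg (k + 1) \<ge> (1 - c) / 2 * (real i / real j * (x i - x (j + 1)))" .
qed

text \<open>With \<open>u\<close> below the top \<open>m + 1\<close> values, the average of the
  first \<open>k + 1\<close> is at least \<open>u\<close>, and extending the nonnegative excess sum
  from \<open>j\<close> to \<open>m\<close> terms only enlarges it; the change of denominator gives
  \<open>m / j\<close>.\<close>

lemma avg_diff_upper_bound: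
  assumes "1 \<le> j" "j \<le> m" "1 \<le> k" "k \<le> m" "m < n" "u \<le> x (m + 1)"
  shows "avg j - avg (k + 1) \<le> real m / real j * (avg m - u)"
proof -
  have u: "u \<le> x i" if "1 \<le> i" "i \<le> m + 1" for i
    using anti[of i "m + 1"] that assms by auto
  have "real (k + 1) * u = (\<Sum>i = 1..k + 1. u)" by simp
  also have "\<dots> \<le> (\<Sum>i = 1..k + 1. x i)" using u assms by (intro sum_mono) auto
  finally have "u \<le> avg (k + 1)" by (simp add: field_simps)
  moreover have "(\<Sum>i = 1..j. x i - u) \<le> (\<Sum>i = 1..m. x i - u)"
    using u assms by (intro sum_mono2) auto
  then have "(\<Sum>i = 1..j. x i - u) / real j \<le> (\<Sum>i = 1..m. x i - u) / real j"
    by (rule divide_right_mono) simp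
  then have "avg j - u \<le> real m / real j * (avg m - u)"
    using assms by (simp add: sum_subtractf diff_divide_distrib right_diff_distrib)
  ultimately show ?thesis by simp
qed

end

section \<open>Counting exceedances in an i.i.d. sample\<close>

locale iid_sample = prob_space M + N: real_distribution N
  for M :: "'a measure" and N :: "real measure" +
  fixes X :: "nat \<Rightarrow> 'a \<Rightarrow> real"
  assumes indep: "indep_vars (\<lambda>_. borel) X {1..}"
    and distr: "\<And>i. 1 \<le> i \<Longrightarrow> distr M borel (X i) = N"
begin

lemma X_measurable [measurable]: "1 \<le> i \<Longrightarrow> X i \<in> borel_measurable M"
  using indep unfolding indep_vars_def by auto

lemma order_stat_measurable [measurable]:
  "1 \<le> i \<Longrightarrow> i \<le> n \<Longrightarrow> desc_order_stat X n i \<in> borel_measurable M"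
  by (rule borel_measurable_desc_order_stat) auto

lemma prob_X:
  assumes "1 \<le> i" "B \<in> sets borel"
  shows "prob {\<omega> \<in> space M. X i \<omega> \<in> B} = N.prob B"
proof -
  have "N.prob B = measure (distr M borel (X i)) B" unfolding distr[OF assms(1)] ..
  also have "\<dots> = prob (X i -` B \<inter> space M)" using assms by (intro measure_distr) auto
  finally show ?thesis by (simp add: vimage_def Int_def conj_commute)
qed

lemma prob_X_pair:
  assumes "1 \<le> i" "1 \<le> j" "i \<noteq> j" "B \<in> sets borel"
  shows "prob {\<omega> \<in> space M. X i \<omega> \<in> B \<and> X j \<omega> \<in> B} = (N.prob B)\<^sup>2"
proof -
  have "prob (\<Inter>l\<in>{i, j}. X l -` B \<inter> space M) = (\<Prod>l\<in>{i, j}. prob (X l -` B \<inter> space M))"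
    using assms by (intro indep_varsD[OF indep]) auto
  also have "\<dots> = prob (X i -` B \<inter> space M) * prob (X j -` B \<inter> space M)" using assms by simp
  also have "X i -` B \<inter> space M = {\<omega> \<in> space M. X i \<omega> \<in> B}" by auto
  also have "X j -` B \<inter> space M = {\<omega> \<in> space M. X j \<omega> \<in> B}" by auto
  also have "(\<Inter>l\<in>{i, j}. X l -` B \<inter> space M) = {\<omega> \<in> space M. X i \<omega> \<in> B \<and> X j \<omega> \<in> B}" by auto
  finally show ?thesis using assms by (simp add: prob_X power2_eq_square)
qed

definition count :: "nat \<Rightarrow> real set \<Rightarrow> 'a \<Rightarrow> real" where
  "count n B \<omega> = (\<Sum>j = 1..n. indicator B (X j \<omega>))"

lemma count_eq_card: "count n B \<omega> = real (card {j \<in> {1..n}. X j \<omega> \<in> B})"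
  by (simp add: count_def indicator_def of_bool_def sum.If_cases Int_def)

lemma count_measurable [measurable]: "B \<in> sets borel \<Longrightarrow> count n B \<in> borel_measurable M"
  unfolding count_def[abs_def]
  by (intro borel_measurable_sum measurable_compose[OF X_measurable borel_measurable_indicator]) auto

lemma count_bounds: "0 \<le> count n B \<omega>" "count n B \<omega> \<le> real n"
proof -
  have "(\<Sum>j = 1..n. indicator B (X j \<omega>)) \<le> (\<Sum>j = 1..n. 1::real)"
    by (intro sum_mono) (auto simp: indicator_def)
  then show "count n B \<omega> \<le> real n" by (simp add: count_def)
qed (auto simp: count_def intro!: sum_nonneg)

lemma integrable_indicator_X: "1 \<le> j \<Longrightarrow> B \<in> sets borel \<Longrightarrow> integrable M (\<lambda>\<omega>. indicat_real B (X j \<omega>))"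
  by (rule integrable_const_bound[where B = 1]) auto

lemma expectation_indicator_X:
  assumes "1 \<le> j" "B \<in> sets borel"
  shows "expectation (\<lambda>\<omega>. indicat_real B (X j \<omega>)) = N.prob B"
proof -
  have "expectation (\<lambda>\<omega>. indicat_real B (X j \<omega>)) = expectation (indicat_real {\<omega> \<in> space M. X j \<omega> \<in> B})"
    by (intro Bochner_Integration.integral_cong) (auto simp: indicator_def)
  also have "\<dots> = prob {\<omega> \<in> space M. X j \<omega> \<in> B}" using assms by simp
  finally show ?thesis using assms by (simp add: prob_X)
qed

lemma expectation_count:
  assumes "B \<in> sets borel"
  shows "integrable M (count n B)" "expectation (count n B) = real n * N.prob B"
  unfolding count_def[abs_def] using assms
  by (auto simp: integrable_indicator_X expectation_indicator_X Bochner_Integration.integral_sum)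

lemma expectation_count_sq:
  assumes B: "B \<in> sets borel"
  shows "integrable M (\<lambda>\<omega>. (count n B \<omega>)\<^sup>2)"
    and "expectation (\<lambda>\<omega>. (count n B \<omega>)\<^sup>2)
      = real n * N.prob B + (real n * real n - real n) * (N.prob B)\<^sup>2"
proof -
  show int: "integrable M (\<lambda>\<omega>. (count n B \<omega>)\<^sup>2)"
    by (rule integrable_const_bound[where B = "(real n)\<^sup>2"])
       (use B count_bounds in \<open>auto simp: power_mono\<close>)
  let ?e = "\<lambda>i j. expectation (\<lambda>\<omega>. indicat_real B (X i \<omega>) * indicat_real B (X j \<omega>))"
  have integ: "integrable M (\<lambda>\<omega>. indicat_real B (X i \<omega>) * indicator B (X j \<omega>))" if "1 \<le> i" "1 \<le> j" for i j
    by (rule integrable_const_bound[where B = 1]) (use that B in \<open>auto simp: indicator_def\<close>)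
  have e: "?e i j = (if i = j then N.prob B else (N.prob B)\<^sup>2)" if "1 \<le> i" "1 \<le> j" for i j
  proof (cases "i = j")
    case True
    have idem: "indicat_real B x * indicator B x = indicator B x" for x by (simp add: indicator_def)
    have "?e i j = expectation (\<lambda>\<omega>. indicat_real B (X j \<omega>))" by (simp only: True idem)
    then show ?thesis using True that B by (simp add: expectation_indicator_X)
  next
    case False
    have "?e i j = expectation (indicat_real {\<omega> \<in> space M. X i \<omega> \<in> B \<and> X j \<omega> \<in> B})"
      by (intro Bochner_Integration.integral_cong) (auto simp: indicator_def)
    also have "\<dots> = prob {\<omega> \<in> space M. X i \<omega> \<in> B \<and> X j \<omega> \<in> B}" using that B by simp
    finally show ?thesis using that B False by (simp add: prob_X_pair)
  qed
  have "expectation (\<lambda>\<omega>. (count n B \<omega>)\<^sup>2)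
      = expectation (\<lambda>\<omega>. \<Sum>i = 1..n. \<Sum>j = 1..n. indicat_real B (X i \<omega>) * indicat_real B (X j \<omega>))"
    by (simp add: count_def power2_eq_square sum_product)
  also have "\<dots> = (\<Sum>i = 1..n. expectation (\<lambda>\<omega>. \<Sum>j = 1..n. indicat_real B (X i \<omega>) * indicat_real B (X j \<omega>)))"
    by (rule Bochner_Integration.integral_sum) (intro Bochner_Integration.integrable_sum integ; simp)
  also have "\<dots> = (\<Sum>i = 1..n. \<Sum>j = 1..n. ?e i j)"
    by (intro sum.cong refl Bochner_Integration.integral_sum integ) auto
  also have "\<dots> = (\<Sum>i = 1..n. \<Sum>j = 1..n. (N.prob B)\<^sup>2 + (if i = j then N.prob B - (N.prob B)\<^sup>2 else 0))"
    by (intro sum.cong refl) (auto simp: e)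
  also have "\<dots> = real n * N.prob B + (real n * real n - real n) * (N.prob B)\<^sup>2"
    by (simp add: sum.distrib algebra_simps)
  finally show "expectation (\<lambda>\<omega>. (count n B \<omega>)\<^sup>2)
      = real n * N.prob B + (real n * real n - real n) * (N.prob B)\<^sup>2" .
qed

text \<open>Chebyshev's inequality, with the binomial variance bounded by the mean. The bound thus
  scales with the expected number of exceedances and not with the sample size.\<close>

lemma count_deviation:
  assumes B: "B \<in> sets borel" and "a > 0"
  shows "prob {\<omega> \<in> space M. \<bar>count n B \<omega> - real n * N.prob B\<bar> \<ge> a} \<le> real n * N.prob B / a\<^sup>2"
proof -
  have "variance (count n B) = real n * N.prob B - real n * (N.prob B)\<^sup>2"
    using B by (subst variance_eq)
      (simp_all add: expectation_count expectation_count_sq power_mult_distrib,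
       simp add: power2_eq_square algebra_simps)
  also have "\<dots> \<le> real n * N.prob B" by simp
  finally have "variance (count n B) / a\<^sup>2 \<le> real n * N.prob B / a\<^sup>2" by (rule divide_right_mono) simp
  moreover have "prob {\<omega> \<in> space M. \<bar>count n B \<omega> - expectation (count n B)\<bar> \<ge> a} \<le> variance (count n B) / a\<^sup>2"
    using assms by (intro Chebyshev_inequality) (auto simp: expectation_count_sq)
  ultimately show ?thesis using B by (simp add: expectation_count)
qed

lemma count_ge_bound:
  assumes B: "B \<in> sets borel" and k: "k > 0" and \<eta>: "0 < \<eta>" and p: "real n * N.prob B \<le> (1 - \<eta>) * k"
  shows "prob {\<omega> \<in> space M. k \<le> count n B \<omega>} \<le> 1 / (\<eta>\<^sup>2 * k)"
proof -
  have "prob {\<omega> \<in> space M. k \<le> count n B \<omega>}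
      \<le> prob {\<omega> \<in> space M. \<bar>count n B \<omega> - real n * N.prob B\<bar> \<ge> \<eta> * k}"
    using B p by (intro finite_measure_mono) (auto simp: algebra_simps)
  also have "\<dots> \<le> real n * N.prob B / (\<eta> * k)\<^sup>2" using B k \<eta> by (intro count_deviation) auto
  also have "\<dots> \<le> k / (\<eta> * k)\<^sup>2"
  proof (rule divide_right_mono)
    have "(1 - \<eta>) * k \<le> 1 * k" using k \<eta> by (intro mult_right_mono) auto
    then show "real n * N.prob B \<le> k" using p by simp
  qed simp
  also have "\<dots> = 1 / (\<eta>\<^sup>2 * k)" using k by (simp add: power2_eq_square)
  finally show ?thesis .
qed

lemma count_less_bound:
  assumes B: "B \<in> sets borel" and k: "k > 0" and \<eta>: "0 < \<eta>" and p: "real n * N.prob B \<ge> (1 + \<eta>) * k"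
  shows "prob {\<omega> \<in> space M. count n B \<omega> < k} \<le> (1 + \<eta>) / (\<eta>\<^sup>2 * k)"
proof -
  define \<mu> where "\<mu> = real n * N.prob B"
  have "(1 + \<eta>) * k > 0" using k \<eta> by simp
  then have \<mu>: "\<mu> > 0" "(1 + \<eta>) * k \<le> \<mu>" using p by (auto simp: \<mu>_def)
  \<comment> \<open>The deviation is taken proportional to the mean, which may far exceed
    \<open>(1 + \<eta>) * k\<close>; a deviation \<open>\<eta> * k\<close> would leave an
    uncontrolled factor \<open>\<mu>\<close>. It is admissible because
    \<open>k \<le> \<mu> / (1 + \<eta>)\<close>.\<close>
  define a where "a = \<eta> / (1 + \<eta>) * \<mu>"
  have a: "a > 0" "a \<le> \<mu> - k" using \<mu> k \<eta> by (auto simp: a_def field_simps)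
  have "prob {\<omega> \<in> space M. count n B \<omega> < k} \<le> prob {\<omega> \<in> space M. \<bar>count n B \<omega> - \<mu>\<bar> \<ge> a}"
    using B a by (intro finite_measure_mono) auto
  also have "\<dots> \<le> \<mu> / a\<^sup>2" using B a unfolding \<mu>_def by (intro count_deviation) auto
  also have "\<dots> = (1 + \<eta>)\<^sup>2 / (\<eta>\<^sup>2 * \<mu>)"
    using \<mu> \<eta> by (simp add: a_def power2_eq_square divide_simps)
  also have "\<dots> \<le> (1 + \<eta>)\<^sup>2 / (\<eta>\<^sup>2 * ((1 + \<eta>) * k))"
    using \<mu> \<eta> k by (intro divide_left_mono mult_left_mono mult_pos_pos) auto
  also have "\<dots> = (1 + \<eta>) / (\<eta>\<^sup>2 * k)"
    using \<eta> k by (simp add: power2_eq_square)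
  finally show ?thesis .
qed

lemma count_markov:
  assumes B: "B \<in> sets borel" and k: "k > 0"
  shows "prob {\<omega> \<in> space M. k \<le> count n B \<omega>} \<le> real n * N.prob B / k"
  using integral_Markov_inequality_measure[of M "count n B" "space M" k] B k count_bounds
  by (auto simp: expectation_count)

text \<open>Markov's inequality for the second factorial moment: count squared minus count is
  nonnegative, is at least 1 as soon as two points fall into \<open>B\<close>, and has mean
  \<open>n * (n - 1)\<close> times the squared probability. The quadratic order is what makes fine
  grids pay off.\<close>

lemma count_two_bound:
  assumes B: "B \<in> sets borel"
  shows "prob {\<omega> \<in> space M. 2 \<le> count n B \<omega>} \<le> (real n * N.prob B)\<^sup>2"
proof -
  let ?f = "\<lambda>\<omega>. (count n B \<omega>)\<^sup>2 - count n B \<omega>"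
  have nn: "0 \<le> ?f \<omega>" for \<omega>
  proof -
    have "count n B \<omega> \<in> \<nat>" by (simp add: count_eq_card)
    then obtain l where "count n B \<omega> = real l" by (auto elim: Nats_cases)
    moreover have "real l \<le> real l * real l" by (cases l) (auto simp: algebra_simps)
    ultimately show ?thesis by (simp add: power2_eq_square)
  qed
  have "{\<omega> \<in> space M. 2 \<le> count n B \<omega>} \<subseteq> {\<omega> \<in> space M. 1 \<le> ?f \<omega>}"
  proof safe
    fix \<omega> assume "2 \<le> count n B \<omega>"
    then have "2 * count n B \<omega> \<le> count n B \<omega> * count n B \<omega>" by (intro mult_right_mono) auto
    then have "1 \<le> count n B \<omega> * count n B \<omega> - count n B \<omega>" using \<open>2 \<le> count n B \<omega>\<close> by linarith
    then show "1 \<le> ?f \<omega>" by (simp add: power2_eq_square)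
  qed
  then have "prob {\<omega> \<in> space M. 2 \<le> count n B \<omega>} \<le> prob {\<omega> \<in> space M. 1 \<le> ?f \<omega>}"
    using B by (intro finite_measure_mono) auto
  also have "\<dots> \<le> expectation ?f / 1"
    using B nn by (intro integral_Markov_inequality_measure[where A = "space M"])
      (auto simp: expectation_count expectation_count_sq)
  also have "\<dots> = (real n * real n - real n) * (N.prob B)\<^sup>2"
    using B by (simp add: expectation_count expectation_count_sq)
  also have "\<dots> \<le> (real n * real n) * (N.prob B)\<^sup>2" by (intro mult_right_mono) auto
  finally show ?thesis by (simp add: power2_eq_square mult_ac)
qed

section \<open>Order statistics against quantile levels\<close>

abbreviation "U \<equiv> tail_quantile (cdf N)"

lemma order_stat_greater_iff_count:
  "1 \<le> k \<Longrightarrow> k \<le> n \<Longrightarrow> v < desc_order_stat X n k \<omega> \<longleftrightarrow> real k \<le> count n {v<..} \<omega>"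
  by (simp add: desc_order_stat_greater_iff count_eq_card)

lemma order_stat_ge_iff_count:
  "1 \<le> k \<Longrightarrow> k \<le> n \<Longrightarrow> v \<le> desc_order_stat X n k \<omega> \<longleftrightarrow> real k \<le> count n {v..} \<omega>"
  by (simp add: desc_order_stat_ge_iff count_eq_card)

text \<open>The level \<open>U s\<close> is exceeded at most \<open>n / s\<close> times on average,
  so \<open>k\<close> exceedances are a deviation by a fixed proportion. The bound improves with
  \<open>k\<close>, which suits intermediate indices.\<close>

lemma order_stat_upper:
  assumes "1 \<le> k" "k \<le> n" "s > 1" "0 < \<eta>" "real n / s \<le> (1 - \<eta>) * real k"
  shows "prob {\<omega> \<in> space M. U s < desc_order_stat X n k \<omega>} \<le> 1 / (\<eta>\<^sup>2 * real k)"
proof -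
  have "real n * N.prob {U s<..} \<le> real n * (1 / s)"
    using N.prob_greater_tail_quantile assms by (intro mult_left_mono) auto
  then have "real n * N.prob {U s<..} \<le> (1 - \<eta>) * real k" using assms by simp
  then show ?thesis
    using assms by (simp only: order_stat_greater_iff_count, intro count_ge_bound) auto
qed

lemma order_stat_lower:
  assumes "1 \<le> k" "k \<le> n" "s > 1" "0 < \<eta>" "real n / s \<ge> (1 + \<eta>) * real k"
  shows "prob {\<omega> \<in> space M. desc_order_stat X n k \<omega> < U s} \<le> (1 + \<eta>) / (\<eta>\<^sup>2 * real k)"
proof -
  have "real n * N.prob {U s..} \<ge> real n * (1 / s)"
    using N.prob_atLeast_tail_quantile assms by (intro mult_left_mono) auto
  then have "real n * N.prob {U s..} \<ge> (1 + \<eta>) * real k" using assms by simp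
  then show ?thesis
    using assms by (simp only: not_le[symmetric] order_stat_ge_iff_count) (simp only: not_le, intro count_less_bound, auto)
qed

text \<open>In contrast to the Chebyshev bounds this one decays in the level \<open>s\<close> and is
  informative for every index, including the maximum; the decay is what moments are summed
  against.\<close>

lemma order_stat_markov:
  assumes "1 \<le> k" "k \<le> n" "s > 1"
  shows "prob {\<omega> \<in> space M. U s < desc_order_stat X n k \<omega>} \<le> real n / (s * real k)"
proof -
  have "prob {\<omega> \<in> space M. U s < desc_order_stat X n k \<omega>} \<le> real n * N.prob {U s<..} / real k"
    using assms by (simp only: order_stat_greater_iff_count, intro count_markov) auto
  also have "\<dots> \<le> real n * (1 / s) / real k"
    using N.prob_greater_tail_quantile assms by (intro mult_left_mono divide_right_mono) auto
  finally show ?thesis by simp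
qed

end

section \<open>Moments and gaps of extreme order statistics\<close>

lemma single_le_suminf: "f l \<le> (\<Sum>l. f l)" for f :: "nat \<Rightarrow> ennreal"
  using sum_le_suminf[of f "{l}"] by simp

locale iid_extremes = iid_sample M N X + extended_regular_variation "tail_quantile (cdf N)" \<gamma>
  for M :: "'a measure" and N :: "real measure" and X :: "nat \<Rightarrow> 'a \<Rightarrow> real" and \<gamma> :: real
begin

text \<open>
  The tail \<open>P (X\<^sub>(\<^sub>i\<^sub>) > U (2 ^ l * n / i)) \<le> 2 ^ -l\<close> is summed against the growth of \<open>U\<close> along
  powers of two.
\<close>

lemma order_stat_moment:
  assumes g: "\<gamma> < g" "0 < g" and q: "0 < q" "q * g < 1"
  obtains C s0 where "C > 0" "s0 > 1" "\<And>s. s \<ge> s0 \<Longrightarrow> \<alpha> s > 0"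
    "\<And>s n i. s \<ge> s0 \<Longrightarrow> 1 \<le> i \<Longrightarrow> i \<le> n \<Longrightarrow> real i * s \<le> real n \<Longrightarrow>
      (\<integral>\<^sup>+\<omega>. ennreal (max 0 ((desc_order_stat X n i \<omega> - U s) / \<alpha> s) powr q) \<partial>M)
        \<le> ennreal (C * (real n / (real i * s)) powr (q * g))"
proof -
  obtain C s0 where C: "C > 0" "s0 > 1" "\<And>s. s \<ge> s0 \<Longrightarrow> \<alpha> s > 0"
    "\<And>s x. s \<ge> s0 \<Longrightarrow> x \<ge> 1 \<Longrightarrow> U (s * x) - U s \<le> C * \<alpha> s * x powr g"
    using U_increment_bound[OF g] by blast
  \<comment> \<open>Ratio of the geometric series: each doubling of the level multiplies the bound
    on the moment by \<open>2 powr (q * g)\<close> and the tail probability by one half. It is below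
    1 because \<open>q * g < 1\<close>.\<close>
  define r where "r = 2 powr (q * g - 1)"
  have r: "0 < r" "r < 1" using q by (auto simp: r_def powr_less_one)
  \<comment> \<open>The 1 covers values below the lowest level. In the series, exceeding level
    \<open>l\<close> is paired with the bound at level \<open>l + 1\<close>, which costs one factor
    \<open>2 powr (q * g)\<close>.\<close>
  define K where "K = 1 + 2 powr (q * g) * (1 / (1 - r))"
  have K: "K > 0" using r by (auto simp: K_def intro!: add_pos_pos mult_pos_pos)
  show ?thesis
  proof
    show "C powr q * K > 0" using C K by simp
    fix s :: real and n i :: nat
    assume s: "s \<ge> s0" and i: "1 \<le> i" "i \<le> n" and le: "real i * s \<le> real n"
    \<comment> \<open>Chosen so that \<open>s * x0 = n / i\<close>, the level at which Markov's
      bound starts from the trivial value 1.\<close>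
    define x0 where "x0 = real n / (real i * s)"
    have s1: "s > 1" using s C(2) by simp
    have x0: "x0 \<ge> 1" using le i s1 by (simp add: x0_def)
    define D where "D = (C * x0 powr g) powr q"
    have D: "D \<ge> 0" "D = C powr q * x0 powr (q * g)"
      using C(1) by (auto simp: D_def powr_mult powr_powr mult.commute)
    define T where "T l = U (s * (x0 * 2 ^ l))" for l :: nat
    let ?Z = "desc_order_stat X n i"
    define V where "V \<omega> = max 0 ((?Z \<omega> - U s) / \<alpha> s) powr q" for \<omega>
    have Z [measurable]: "?Z \<in> borel_measurable M" using i by simp
    have x2: "x0 * 2 ^ l \<ge> 1" for l :: nat
      using x0 mult_mono[of 1 x0 1 "2 ^ l"] by simp
    have prob_T: "prob {\<omega> \<in> space M. T l < ?Z \<omega>} \<le> (1 / 2) ^ l" for l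
    proof -
      have "prob {\<omega> \<in> space M. T l < ?Z \<omega>} \<le> real n / (s * (x0 * 2 ^ l) * real i)"
        unfolding T_def using i s1 x2[of l] by (intro order_stat_markov one_less_mult_ge_1) auto
      also have "\<dots> = (1 / 2) ^ l"
        using i s1 by (simp add: x0_def field_simps)
      finally show ?thesis .
    qed
    have bound: "V \<omega> \<le> D * (2 ^ l) powr (q * g)" if "?Z \<omega> \<le> T l" for \<omega> l
    proof -
      have "(?Z \<omega> - U s) / \<alpha> s \<le> (U (s * (x0 * 2 ^ l)) - U s) / \<alpha> s"
        using that C(3)[OF s] by (intro divide_right_mono) (auto simp: T_def)
      also have "\<dots> \<le> (C * \<alpha> s * (x0 * 2 ^ l) powr g) / \<alpha> s"
        using C(3)[OF s] C(4)[OF s x2] by (intro divide_right_mono) auto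
      also have "\<dots> = C * (x0 * 2 ^ l) powr g" using C(3)[OF s] by simp
      finally have "max 0 ((?Z \<omega> - U s) / \<alpha> s) \<le> C * (x0 * 2 ^ l) powr g" using C(1) by simp
      then have "V \<omega> \<le> (C * (x0 * 2 ^ l) powr g) powr q"
        unfolding V_def using q by (intro powr_mono2) auto
      also have "\<dots> = D * (2 ^ l) powr (q * g)"
        using C(1) x0 by (simp add: D powr_mult powr_powr mult.commute mult.left_commute)
      finally show ?thesis .
    qed
    let ?S = "\<lambda>\<omega>. ennreal D + (\<Sum>l. ennreal (D * (2 ^ (l + 1)) powr (q * g)) *
      indicator {\<omega> \<in> space M. T l < ?Z \<omega>} \<omega>)"
    have "AE \<omega> in M. \<exists>l. ?Z \<omega> \<le> T l"
    proof (rule AE_I)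
      let ?A = "{\<omega> \<in> space M. \<not> (\<exists>l. ?Z \<omega> \<le> T l)}"
      show "?A \<subseteq> ?A" by simp
      show A: "?A \<in> sets M" by measurable
      have "prob ?A \<le> (1 / 2) ^ l" for l
        using prob_T[of l] by (rule order_trans[rotated]) (intro finite_measure_mono, auto simp: not_le)
      moreover have "(\<lambda>l. (1 / 2 :: real) ^ l) \<longlonglongrightarrow> 0" by (rule LIMSEQ_realpow_zero) auto
      ultimately have "prob ?A \<le> 0" by (intro LIMSEQ_le_const) auto
      then show "emeasure M ?A = 0" by (simp add: emeasure_eq_measure measure_le_0_iff)
    qed
    then have "AE \<omega> in M. ennreal (V \<omega>) \<le> ?S \<omega>"
    proof (rule AE_mp, intro AE_I2 impI)
      fix \<omega> assume \<omega>: "\<omega> \<in> space M" and ex: "\<exists>l. ?Z \<omega> \<le> T l"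
      define l where "l = (LEAST l. ?Z \<omega> \<le> T l)"
      have l: "?Z \<omega> \<le> T l" unfolding l_def by (rule LeastI_ex[OF ex])
      show "ennreal (V \<omega>) \<le> ?S \<omega>"
      proof (cases l)
        case 0
        then have "V \<omega> \<le> D" using bound[OF l] by simp
        then have "ennreal (V \<omega>) \<le> ennreal D" by (rule ennreal_leI)
        then show ?thesis by (rule add_increasing2[OF zero_le])
      next
        case (Suc l')
        then have "\<not> ?Z \<omega> \<le> T l'" using not_less_Least[of l' "\<lambda>l. ?Z \<omega> \<le> T l"] by (simp add: l_def)
        then have "ennreal (V \<omega>) \<le> ennreal (D * (2 ^ (l' + 1)) powr (q * g)) *
            indicator {\<omega> \<in> space M. T l' < ?Z \<omega>} \<omega>"
          using bound[OF l] \<omega> Suc by (auto intro!: ennreal_leI simp: not_le)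
        also have "\<dots> \<le> (\<Sum>l. ennreal (D * (2 ^ (l + 1)) powr (q * g)) *
            indicator {\<omega> \<in> space M. T l < ?Z \<omega>} \<omega>)"
          by (rule single_le_suminf)
        finally show ?thesis by (rule add_increasing[OF zero_le])
      qed
    qed
    then have "(\<integral>\<^sup>+\<omega>. ennreal (V \<omega>) \<partial>M) \<le> (\<integral>\<^sup>+\<omega>. ?S \<omega> \<partial>M)" by (rule nn_integral_mono_AE)
    also have "\<dots> = ennreal D + (\<Sum>l. ennreal (D * (2 ^ (l + 1)) powr (q * g)) *
        emeasure M {\<omega> \<in> space M. T l < ?Z \<omega>})"
      by (subst nn_integral_add, measurable, subst nn_integral_suminf, measurable)
         (simp add: emeasure_space_1 nn_integral_cmult)
    also have "\<dots> \<le> ennreal D + (\<Sum>l. ennreal (D * 2 powr (q * g) * r ^ l))"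
    proof (intro add_left_mono suminf_le allI)
      fix l
      have "ennreal (D * (2 ^ (l + 1)) powr (q * g)) * emeasure M {\<omega> \<in> space M. T l < ?Z \<omega>}
          \<le> ennreal (D * (2 ^ (l + 1)) powr (q * g)) * ennreal ((1 / 2) ^ l)"
        unfolding emeasure_eq_measure by (intro mult_left_mono ennreal_leI prob_T) auto
      also have "\<dots> = ennreal (D * (2 ^ (l + 1)) powr (q * g) * (1 / 2) ^ l)"
        using D by (simp add: ennreal_mult)
      also have "(2 ^ (l + 1)) powr (q * g) * (1 / 2) ^ l = 2 powr (q * g) * r ^ l"
        by (simp add: r_def powr_mult powr_diff power_divide powr_power powr_realpow[symmetric]
            powr_powr mult.commute field_simps)
      then have "D * (2 ^ (l + 1)) powr (q * g) * (1 / 2) ^ l = D * 2 powr (q * g) * r ^ l"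
        by (simp only: mult.assoc)
      finally show "ennreal (D * (2 ^ (l + 1)) powr (q * g)) * emeasure M {\<omega> \<in> space M. T l < ?Z \<omega>}
          \<le> ennreal (D * 2 powr (q * g) * r ^ l)" .
    qed auto
    also have "(\<Sum>l. ennreal (D * 2 powr (q * g) * r ^ l)) = ennreal (D * 2 powr (q * g) * (1 / (1 - r)))"
      using r D by (subst suminf_ennreal2) (auto intro!: mult_nonneg_nonneg
          simp: suminf_mult suminf_geometric)
    also have "ennreal D + \<dots> = ennreal (D * K)"
      using r D by (subst ennreal_plus[symmetric]) (auto simp: K_def distrib_left mult.assoc)
    also have "D * K = C powr q * K * (real n / (real i * s)) powr (q * g)"
      unfolding D(2) by (simp add: x0_def)
    finally show "(\<integral>\<^sup>+\<omega>. ennreal (max 0 ((?Z \<omega> - U s) / \<alpha> s) powr q) \<partial>M)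
        \<le> ennreal (C powr q * K * (real n / (real i * s)) powr (q * g))"
      by (simp add: V_def)
  qed (use C in auto)
qed

text \<open>
  Cover the range of the maximum by overlapping cells between quantiles, each with expected number
  of observations at most \<open>3 * \<epsilon>\<close>. If the two largest observations are too close, either one of the
  cells contains two observations or the maximum is outside the grid.
\<close>

lemma top_gap_grid:
  assumes T: "T > 2" and L: "0 < L" and \<epsilon>: "\<epsilon> = T / real L"
  obtains \<delta> where "\<delta> > 0" "eventually (\<lambda>n. prob {\<omega> \<in> space M.
      desc_order_stat X n 1 \<omega> - desc_order_stat X n 2 \<omega> \<le> \<delta> * \<alpha> (real n)}
      \<le> T / (T - 1)\<^sup>2 + 2 * \<epsilon> + 9 * T * \<epsilon>) sequentially"
proof -
  have \<epsilon>0: "\<epsilon> > 0" using T L by (simp add: \<epsilon>)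
  \<comment> \<open>Quantile levels whose expected number of exceedances is about
    \<open>\<epsilon> * l\<close>. They decrease in \<open>l\<close>, and the last one used for the
    maximum, \<open>l = L\<close>, corresponds to \<open>T\<close> exceedances.\<close>
  define v where "v n l = U (real n * (1 / (\<epsilon> * real l)))" for n l :: nat
  define I where "I = {1..L + 2}"
  define \<delta> where "\<delta> = Min ((\<lambda>l. H (1 / (\<epsilon> * real l)) - H (1 / (\<epsilon> * real (l + 1)))) ` I) / 2"
  have H_gap: "H (1 / (\<epsilon> * real l)) - H (1 / (\<epsilon> * real (l + 1))) > 0" if "l \<in> I" for l
  proof -
    have "1 / (\<epsilon> * real (l + 1)) < 1 / (\<epsilon> * real l)"
      using that \<epsilon>0 by (intro divide_strict_left_mono mult_strict_left_mono mult_pos_pos) (auto simp: I_def)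
    then show ?thesis using H_strict_mono[of "1 / (\<epsilon> * real (l + 1))" "1 / (\<epsilon> * real l)"] \<epsilon>0 by simp
  qed
  have \<delta>0: "\<delta> > 0" using H_gap by (auto simp: \<delta>_def I_def)
  have \<delta>_less: "\<delta> < H (1 / (\<epsilon> * real l)) - H (1 / (\<epsilon> * real (l + 1)))" if "l \<in> I" for l
  proof -
    have "2 * \<delta> \<le> H (1 / (\<epsilon> * real l)) - H (1 / (\<epsilon> * real (l + 1)))"
      unfolding \<delta>_def using that by (auto simp: I_def intro!: Min_le)
    then show ?thesis using \<delta>0 by linarith
  qed
  have ev_gap: "eventually (\<lambda>n. \<forall>l\<in>I. \<delta> < (v n l - v n (l + 1)) / \<alpha> (real n)) sequentially"
  proof (rule eventually_ball_finite, simp add: I_def, rule ballI)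
    fix l assume l: "l \<in> I"
    have "(\<lambda>n. (v n l - U (real n)) / \<alpha> (real n) - (v n (l + 1) - U (real n)) / \<alpha> (real n))
       \<longlonglongrightarrow> H (1 / (\<epsilon> * real l)) - H (1 / (\<epsilon> * real (l + 1)))"
      unfolding v_def using \<epsilon>0 l
      by (intro tendsto_diff filterlim_compose[OF U_lim_H filterlim_real_sequentially])
         (auto simp: I_def)
    then have "eventually (\<lambda>n. \<delta> < (v n l - U (real n)) / \<alpha> (real n) - (v n (l + 1) - U (real n)) / \<alpha> (real n)) sequentially"
      by (rule order_tendstoD) (rule \<delta>_less[OF l])
    then show "eventually (\<lambda>n. \<delta> < (v n l - v n (l + 1)) / \<alpha> (real n)) sequentially"
      by (simp add: diff_divide_distrib)
  qed
  have ev_\<alpha>: "eventually (\<lambda>n. \<alpha> (real n) > 0) sequentially"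
    by (rule eventually_compose_filterlim[OF eventually_\<alpha>_pos filterlim_real_sequentially])
  have ev_n: "eventually (\<lambda>n. real n > \<epsilon> * real (L + 3) \<and> n \<ge> 2) sequentially"
    by (intro eventually_conj eventually_ge_at_top
        eventually_compose_filterlim[OF eventually_gt_at_top filterlim_real_sequentially])
  show ?thesis
  proof
    show "\<delta> > 0" by (rule \<delta>0)
    show "eventually (\<lambda>n. prob {\<omega> \<in> space M.
      desc_order_stat X n 1 \<omega> - desc_order_stat X n 2 \<omega> \<le> \<delta> * \<alpha> (real n)}
      \<le> T / (T - 1)\<^sup>2 + 2 * \<epsilon> + 9 * T * \<epsilon>) sequentially"
      using ev_gap ev_\<alpha> ev_n
    proof eventually_elim
      case (elim n)
      let ?X1 = "desc_order_stat X n 1" and ?X2 = "desc_order_stat X n 2"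
      have n2: "n \<ge> 2" using elim by simp
      have meas [measurable]: "?X1 \<in> borel_measurable M" "?X2 \<in> borel_measurable M"
        using n2 by auto
      have meas' [measurable]: "desc_order_stat X n (Suc 0) \<in> borel_measurable M"
        using n2 by auto
      have s1: "real n * (1 / (\<epsilon> * real l)) > 1" if "1 \<le> l" "l \<le> L + 3" for l
      proof -
        have "\<epsilon> * real l \<le> \<epsilon> * real (L + 3)" using that \<epsilon>0 by (intro mult_left_mono) auto
        then show ?thesis using that \<epsilon>0 elim(3) by (simp add: field_simps)
      qed
      have gap: "\<delta> * \<alpha> (real n) < v n l - v n (l + 1)" if "1 \<le> l" "l \<le> L + 2" for l
        using elim(1,2) that by (auto simp: I_def field_simps)
      have v_less: "v n (l + 1) < v n l" if "1 \<le> l" "l \<le> L + 2" for l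
        using gap[OF that] mult_pos_pos[OF \<delta>0 elim(2)] by linarith
      \<comment> \<open>If the maximum lies between \<open>v n l\<close> and
        \<open>v n (l - 1)\<close> and the second largest observation is closer than the spacing
        \<open>v n l - v n (l + 1)\<close>, then both belong to this union of two neighbouring
        spacings.\<close>
      define B where "B l = {v n (l + 1)..<v n (l - 1)}" for l
      have pB: "real n * N.prob (B l) \<le> 3 * \<epsilon>" if l: "2 \<le> l" "l \<le> L" for l
      proof -
        have "v n (l + 1) < v n l" "v n l < v n (l - 1)"
          using v_less[of l] v_less[of "l - 1"] l by auto
        then have "B l = {v n (l + 1)..} - {v n (l - 1)..}" "{v n (l - 1)..} \<subseteq> {v n (l + 1)..}"
          by (auto simp: B_def)
        then have "N.prob (B l) = N.prob {v n (l + 1)..} - N.prob {v n (l - 1)..}"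
          by (simp add: N.finite_measure_Diff)
        \<comment> \<open>An upper bound is available only for open half-lines, so one moves to the
          next level; this turns the expected count of \<open>B l\<close> from the natural
          \<open>2 * \<epsilon>\<close> into \<open>3 * \<epsilon>\<close>.\<close>
        moreover have "N.prob {v n (l + 1)..} \<le> N.prob {v n (l + 2)<..}"
          using v_less[of "l + 1"] l by (intro N.finite_measure_mono) auto
        moreover have "N.prob {v n (l + 2)<..} \<le> 1 / (real n * (1 / (\<epsilon> * real (l + 2))))"
          unfolding v_def using s1[of "l + 2"] l by (intro N.prob_greater_tail_quantile) auto
        moreover have "N.prob {v n (l - 1)..} \<ge> 1 / (real n * (1 / (\<epsilon> * real (l - 1))))"
          unfolding v_def using s1[of "l - 1"] l by (intro N.prob_atLeast_tail_quantile) auto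
        moreover have "a \<le> x - y" if "a = p - q" "p \<le> p'" "p' \<le> x" "y \<le> q" for a p p' q x y :: real
          using that by linarith
        ultimately have "N.prob (B l) \<le> 1 / (real n * (1 / (\<epsilon> * real (l + 2)))) -
           1 / (real n * (1 / (\<epsilon> * real (l - 1))))" by blast
        then have "real n * N.prob (B l) \<le> real n * (1 / (real n * (1 / (\<epsilon> * real (l + 2)))) -
           1 / (real n * (1 / (\<epsilon> * real (l - 1)))))"
          by (rule mult_left_mono) simp
        also have "\<dots> = \<epsilon> * real (l + 2) - \<epsilon> * real (l - 1)"
          using n2 by (simp add: right_diff_distrib)
        also have "\<dots> = 3 * \<epsilon>" using l by (simp add: of_nat_diff algebra_simps)
        finally show ?thesis .
      qed
      have sub: "{\<omega> \<in> space M. ?X1 \<omega> - ?X2 \<omega> \<le> \<delta> * \<alpha> (real n)}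
        \<subseteq> {\<omega> \<in> space M. ?X1 \<omega> < v n L} \<union> {\<omega> \<in> space M. v n 2 < ?X1 \<omega>}
          \<union> (\<Union>l\<in>{2..L}. {\<omega> \<in> space M. 2 \<le> count n (B l) \<omega>})"
      proof
        fix \<omega> assume \<omega>: "\<omega> \<in> {\<omega> \<in> space M. ?X1 \<omega> - ?X2 \<omega> \<le> \<delta> * \<alpha> (real n)}"
        show "\<omega> \<in> {\<omega> \<in> space M. ?X1 \<omega> < v n L} \<union> {\<omega> \<in> space M. v n 2 < ?X1 \<omega>}
          \<union> (\<Union>l\<in>{2..L}. {\<omega> \<in> space M. 2 \<le> count n (B l) \<omega>})"
        proof (cases "?X1 \<omega> < v n L \<or> v n 2 < ?X1 \<omega>")
          case True
          then show ?thesis using \<omega> by auto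
        next
          case False
          define l where "l = (LEAST l. 1 \<le> l \<and> v n l \<le> ?X1 \<omega>)"
          have L1: "1 \<le> L \<and> v n L \<le> ?X1 \<omega>" using False L by auto
          have l: "1 \<le> l" "v n l \<le> ?X1 \<omega>"
            using LeastI[of "\<lambda>l. 1 \<le> l \<and> v n l \<le> ?X1 \<omega>", OF L1] unfolding l_def by auto
          have lL: "l \<le> L" unfolding l_def by (rule Least_le[of "\<lambda>l. 1 \<le> l \<and> v n l \<le> ?X1 \<omega>", OF L1])
          have "v n 2 < v n 1" using v_less[of 1] by (simp add: numeral_2_eq_2)
          then have "l \<noteq> 1" using l False by auto
          then have l2: "2 \<le> l" using l by simp
          have less: "?X1 \<omega> < v n (l - 1)"
          proof (rule ccontr)
            assume "\<not> ?thesis"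
            then have "1 \<le> l - 1 \<and> v n (l - 1) \<le> ?X1 \<omega>" using l2 by auto
            from Least_le[of "\<lambda>l. 1 \<le> l \<and> v n l \<le> ?X1 \<omega>", OF this]
            have "l \<le> l - 1" by (simp add: l_def)
            then show False using l2 by simp
          qed
          have X2: "v n (l + 1) \<le> ?X2 \<omega>" using gap[of l] l lL \<omega> by auto
          have "2 \<le> card {j \<in> {1..n}. v n (l + 1) \<le> X j \<omega>}"
            using X2 n2 desc_order_stat_ge_iff[of 2 n "v n (l + 1)" X \<omega>] by simp
          also have "{j \<in> {1..n}. v n (l + 1) \<le> X j \<omega>} = {j \<in> {1..n}. X j \<omega> \<in> B l}"
          proof -
            have "X j \<omega> < v n (l - 1)" if "j \<in> {1..n}" for j
            proof (rule ccontr)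
              assume "\<not> ?thesis"
              then have "{j} \<subseteq> {j \<in> {1..n}. v n (l - 1) \<le> X j \<omega>}" using that by auto
              then have "1 \<le> card {j \<in> {1..n}. v n (l - 1) \<le> X j \<omega>}"
                using card_mono[of "{j \<in> {1..n}. v n (l - 1) \<le> X j \<omega>}" "{j}"] by auto
              then show False
                using less n2 desc_order_stat_ge_iff[of 1 n "v n (l - 1)" X \<omega>] by simp
            qed
            then show ?thesis by (auto simp: B_def)
          qed
          finally have "2 \<le> count n (B l) \<omega>" by (simp add: count_eq_card)
          then show ?thesis using \<omega> l2 lL by auto
        qed
      qed
      have Bm [measurable]: "B l \<in> sets borel" for l by (simp add: B_def)
      have "prob {\<omega> \<in> space M. ?X1 \<omega> - ?X2 \<omega> \<le> \<delta> * \<alpha> (real n)}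
        \<le> prob ({\<omega> \<in> space M. ?X1 \<omega> < v n L} \<union> {\<omega> \<in> space M. v n 2 < ?X1 \<omega>}
          \<union> (\<Union>l\<in>{2..L}. {\<omega> \<in> space M. 2 \<le> count n (B l) \<omega>}))"
        by (rule finite_measure_mono[OF sub]) measurable
      also have "\<dots> \<le> prob {\<omega> \<in> space M. ?X1 \<omega> < v n L} + prob {\<omega> \<in> space M. v n 2 < ?X1 \<omega>}
          + (\<Sum>l = 2..L. prob {\<omega> \<in> space M. 2 \<le> count n (B l) \<omega>})"
        by (intro order_trans[OF measure_Un_le] add_mono measure_UNION_le order_refl) auto
      \<comment> \<open>Here \<open>n / s = \<epsilon> * L = T\<close>, so the Chebyshev bound
        applies to the maximum, \<open>k = 1\<close>, with \<open>\<eta> = T - 1\<close>.\<close>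
      also have "prob {\<omega> \<in> space M. ?X1 \<omega> < v n L} \<le> (1 + (T - 1)) / ((T - 1)\<^sup>2 * real 1)"
        unfolding v_def using s1[of L] L T n2
        by (intro order_stat_lower) (auto simp: \<epsilon>)
      also have "prob {\<omega> \<in> space M. v n 2 < ?X1 \<omega>} \<le> real n / (real n * (1 / (\<epsilon> * real 2)) * real 1)"
        unfolding v_def using s1[of 2] L n2 by (intro order_stat_markov) auto
      also have "(\<Sum>l = 2..L. prob {\<omega> \<in> space M. 2 \<le> count n (B l) \<omega>}) \<le> (\<Sum>l = 2..L. (3 * \<epsilon>)\<^sup>2)"
      proof (rule sum_mono)
        fix l assume "l \<in> {2..L}"
        then have "(real n * N.prob (B l))\<^sup>2 \<le> (3 * \<epsilon>)\<^sup>2"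
          using pB[of l] by (intro power_mono) auto
        then show "prob {\<omega> \<in> space M. 2 \<le> count n (B l) \<omega>} \<le> (3 * \<epsilon>)\<^sup>2"
          using count_two_bound[OF Bm[of l], of n] by simp
      qed
      also have "(\<Sum>l = 2..L. (3 * \<epsilon>)\<^sup>2) \<le> real L * (3 * \<epsilon>)\<^sup>2"
        by (simp, intro mult_right_mono) auto
      also have "real L * (3 * \<epsilon>)\<^sup>2 = 9 * T * \<epsilon>" using L by (simp add: \<epsilon> power2_eq_square)
      finally show ?case using n2 by (simp add: mult.commute)
    qed
  qed
qed

text \<open>First \<open>T\<close> is fixed so large that the maximum rarely falls below the grid.
  Refining the grid then removes the other terms: the number of cells grows like \<open>L\<close>,
  while the probability of a pair in one cell is of order \<open>1 / L\<close> squared.\<close>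

lemma top_gap:
  assumes e: "e > 0"
  obtains \<delta> where "\<delta> > 0" "eventually (\<lambda>n. prob {\<omega> \<in> space M.
      desc_order_stat X n 1 \<omega> - desc_order_stat X n 2 \<omega> \<le> \<delta> * \<alpha> (real n)} \<le> e) sequentially"
proof -
  have "((\<lambda>T::real. T / (T - 1)\<^sup>2) \<longlongrightarrow> 0) at_top" by real_asymp
  then have "eventually (\<lambda>T::real. T / (T - 1)\<^sup>2 < e / 2) at_top"
    using e by (intro order_tendstoD(2)) auto
  with eventually_gt_at_top[of 2] have "eventually (\<lambda>T::real. T > 2 \<and> T / (T - 1)\<^sup>2 < e / 2) at_top"
    by eventually_elim simp
  then obtain T :: real where T: "T > 2" "T / (T - 1)\<^sup>2 < e / 2"
    by (auto simp: eventually_at_top_linorder)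
  have "(\<lambda>L. 2 * (T / real L) + 9 * T * (T / real L)) \<longlonglongrightarrow> 0" by real_asymp
  then have "eventually (\<lambda>L. 2 * (T / real L) + 9 * T * (T / real L) < e / 2) sequentially"
    using e by (intro order_tendstoD(2)) auto
  with eventually_gt_at_top[of 0]
  have "eventually (\<lambda>L. 0 < L \<and> 2 * (T / real L) + 9 * T * (T / real L) < e / 2) sequentially"
    by eventually_elim simp
  then obtain L where L: "0 < L" "2 * (T / real L) + 9 * T * (T / real L) < e / 2"
    by (auto simp: eventually_sequentially)
  obtain \<delta> where \<delta>: "\<delta> > 0" "eventually (\<lambda>n. prob {\<omega> \<in> space M.
      desc_order_stat X n 1 \<omega> - desc_order_stat X n 2 \<omega> \<le> \<delta> * \<alpha> (real n)}
      \<le> T / (T - 1)\<^sup>2 + 2 * (T / real L) + 9 * T * (T / real L)) sequentially"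
    using top_gap_grid[OF T(1) L(1) refl] by blast
  show ?thesis
  proof
    show "eventually (\<lambda>n. prob {\<omega> \<in> space M.
      desc_order_stat X n 1 \<omega> - desc_order_stat X n 2 \<omega> \<le> \<delta> * \<alpha> (real n)} \<le> e) sequentially"
      using \<delta>(2) by eventually_elim (use T L in linarith)
  qed (rule \<delta>(1))
qed

end

section \<open>Convergence in probability under the integral sign\<close>

text \<open>The three summands cover \<open>w \<le> \<eta>\<close>,
  \<open>\<eta> < w \<le> R\<close> and \<open>w > R\<close>. In the last case
  \<open>w = w powr (1 - p) * w powr p\<close>, and the first factor is at most
  \<open>R powr (1 - p)\<close>.\<close>

lemma truncation_bound:
  fixes w \<eta> R p :: real
  assumes "p > 1" "w \<ge> 0" "R > 0" "\<eta> \<ge> 0"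
  shows "w \<le> \<eta> + R powr (1 - p) * w powr p + R * (if w > \<eta> then 1 else 0)"
proof (cases "w > R")
  case True
  have "w = w powr (1 - p) * w powr p" using True assms by (simp add: powr_add[symmetric])
  also have "\<dots> \<le> R powr (1 - p) * w powr p"
    using True assms by (intro mult_right_mono powr_mono2') auto
  finally show ?thesis using assms by (auto intro: add_increasing add_increasing2)
next
  case False
  then show ?thesis using assms by (auto intro: add_increasing add_increasing2)
qed

lemma ennreal_tendsto_0I:
  fixes f :: "nat \<Rightarrow> ennreal"
  assumes "\<And>e::real. e > 0 \<Longrightarrow> eventually (\<lambda>n. f n \<le> ennreal e) sequentially"
  shows "f \<longlonglongrightarrow> 0"
proof (rule order_tendstoI)
  fix a :: ennreal assume "0 < a"
  then obtain b where b: "0 < b" "b < a" using dense by blast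
  then obtain r where r: "b = ennreal r" "0 \<le> r" by (cases b) auto
  then have "r > 0" using b by simp
  from assms[OF this] show "eventually (\<lambda>n. f n < a) sequentially"
    by eventually_elim (use b r in auto)
qed simp

text \<open>
  Pointwise convergence in probability is passed under the integral: bounded moments of order
  \<open>p > 1\<close> turn it into convergence in mean, and the means are handled by dominated convergence
  and Tonelli's theorem.
\<close>

lemma (in prob_space) nn_integral_tendsto_0_in_prob:
  fixes Z :: "nat \<Rightarrow> 'a \<Rightarrow> 'b \<Rightarrow> real" and L :: "'b \<Rightarrow> real"
  assumes \<mu>: "sigma_finite_measure \<mu>" and p: "p > 1"
    and meas: "\<And>n. n \<ge> n0 \<Longrightarrow> (\<lambda>(\<omega>, t). Z n \<omega> t) \<in> borel_measurable (M \<Otimes>\<^sub>M \<mu>)"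
    and Z0: "\<And>n \<omega> t. Z n \<omega> t \<ge> 0"
    and G: "\<And>n. n \<ge> n0 \<Longrightarrow> G n \<in> events"
    and lim: "\<And>t e. t \<in> space \<mu> \<Longrightarrow> e > 0 \<Longrightarrow> (\<lambda>n. prob {\<omega> \<in> G n. Z n \<omega> t > e}) \<longlonglongrightarrow> 0"
    and L: "\<And>t. t \<in> space \<mu> \<Longrightarrow> L t > 0" "L \<in> borel_measurable \<mu>" "(\<integral>\<^sup>+t. ennreal (L t) \<partial>\<mu>) < \<infinity>"
    and mom: "\<And>n t. n \<ge> n0 \<Longrightarrow> t \<in> space \<mu> \<Longrightarrow>
      (\<integral>\<^sup>+\<omega>. ennreal (Z n \<omega> t powr p) * indicator (G n) \<omega> \<partial>M) \<le> ennreal (L t powr p)"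
    and e: "e > 0"
  shows "(\<lambda>n. prob {\<omega> \<in> G n. ennreal e \<le> (\<integral>\<^sup>+t. ennreal (Z n \<omega> t) \<partial>\<mu>)}) \<longlonglongrightarrow> 0"
proof -
  interpret \<mu>: sigma_finite_measure \<mu> by fact
  interpret P: pair_sigma_finite M \<mu> ..
  define E where "E n t = (\<integral>\<^sup>+\<omega>. ennreal (Z n \<omega> t) * indicator (G n) \<omega> \<partial>M)" for n t
  have meas_t: "(\<lambda>\<omega>. Z n \<omega> t) \<in> borel_measurable M" if "n \<ge> n0" "t \<in> space \<mu>" for n t
    using measurable_compose[OF measurable_Pair2'[OF that(2)] meas[OF that(1)]] by simp
  have E_bound: "E n t \<le> ennreal (\<eta> + R powr (1 - p) * L t powr p + R * prob {\<omega> \<in> G n. Z n \<omega> t > \<eta>})"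
    if n: "n \<ge> n0" and t: "t \<in> space \<mu>" and R: "R > 0" and \<eta>: "\<eta> \<ge> 0" for n t \<eta> R
  proof -
    note [measurable] = meas_t[OF n t] G[OF n]
    have sub: "G n \<subseteq> space M" using G[OF n] sets.sets_into_space by blast
    then have A: "{\<omega> \<in> G n. Z n \<omega> t > \<eta>} = {\<omega> \<in> space M. \<omega> \<in> G n \<and> Z n \<omega> t > \<eta>}" by auto
    have [measurable]: "{\<omega> \<in> G n. Z n \<omega> t > \<eta>} \<in> events" unfolding A by measurable
    have "E n t \<le> (\<integral>\<^sup>+\<omega>. ennreal \<eta> + ennreal (R powr (1 - p)) * (ennreal (Z n \<omega> t powr p) * indicator (G n) \<omega>)
        + ennreal R * indicator {\<omega> \<in> G n. Z n \<omega> t > \<eta>} \<omega> \<partial>M)"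
      unfolding E_def
    proof (rule nn_integral_mono)
      fix \<omega>
      have "ennreal (Z n \<omega> t) \<le> ennreal (\<eta> + R powr (1 - p) * Z n \<omega> t powr p + R * (if Z n \<omega> t > \<eta> then 1 else 0))"
        using truncation_bound[OF p Z0 R \<eta>] by (rule ennreal_leI)
      also have "\<dots> = ennreal \<eta> + ennreal (R powr (1 - p)) * ennreal (Z n \<omega> t powr p)
        + ennreal R * (if Z n \<omega> t > \<eta> then 1 else 0)"
        using R \<eta> Z0 by (auto simp: ennreal_mult)
      finally show "ennreal (Z n \<omega> t) * indicator (G n) \<omega> \<le> ennreal \<eta> + ennreal (R powr (1 - p)) *
          (ennreal (Z n \<omega> t powr p) * indicator (G n) \<omega>)
        + ennreal R * indicator {\<omega> \<in> G n. Z n \<omega> t > \<eta>} \<omega>"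
        by (auto simp: indicator_def split: if_splits)
    qed
    also have "\<dots> = ennreal \<eta> + ennreal (R powr (1 - p)) * (\<integral>\<^sup>+\<omega>. ennreal (Z n \<omega> t powr p) * indicator (G n) \<omega> \<partial>M)
        + ennreal R * emeasure M {\<omega> \<in> G n. Z n \<omega> t > \<eta>}"
      by (simp add: nn_integral_add nn_integral_cmult emeasure_space_1)
    also have "\<dots> \<le> ennreal \<eta> + ennreal (R powr (1 - p)) * ennreal (L t powr p)
        + ennreal R * ennreal (prob {\<omega> \<in> G n. Z n \<omega> t > \<eta>})"
      unfolding emeasure_eq_measure by (intro add_mono mult_left_mono mom n t) auto
    also have "\<dots> = ennreal (\<eta> + R powr (1 - p) * L t powr p + R * prob {\<omega> \<in> G n. Z n \<omega> t > \<eta>})"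
      using \<eta> R by (simp add: ennreal_mult)
    finally show ?thesis .
  qed
  have E_dom: "E n t \<le> ennreal (3 * L t)" if n: "n \<ge> n0" and t: "t \<in> space \<mu>" for n t
  proof -
    \<comment> \<open>Truncating at \<open>R = \<eta> = L t\<close> makes all three terms linear in
      \<open>L t\<close>. So the moment bound \<open>L t powr p\<close> produces a dominating
      function of first order in \<open>L\<close>, which is integrable.\<close>
    have "E n t \<le> ennreal (L t + L t powr (1 - p) * L t powr p + L t * prob {\<omega> \<in> G n. Z n \<omega> t > L t})"
      using L(1)[OF t] by (intro E_bound n t) auto
    also have "L t powr (1 - p) * L t powr p = L t"
      using L(1)[OF t] by (simp add: powr_add[symmetric])
    also have "ennreal (L t + L t + L t * prob {\<omega> \<in> G n. Z n \<omega> t > L t}) \<le> ennreal (3 * L t)"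
      using L(1)[OF t] mult_left_mono[OF prob_le_1, of "L t" "{\<omega> \<in> G n. Z n \<omega> t > L t}"]
      by (intro ennreal_leI) auto
    finally show ?thesis .
  qed
  have E_lim: "(\<lambda>n. E n t) \<longlonglongrightarrow> 0" if t: "t \<in> space \<mu>" for t
  proof (rule ennreal_tendsto_0I)
    fix \<epsilon> :: real assume \<epsilon>: "\<epsilon> > 0"
    \<comment> \<open>First \<open>R\<close> is chosen to make the moment term small, uniformly in
      \<open>n\<close>; with \<open>R\<close> fixed, convergence in probability disposes of the last
      term.\<close>
    have "((\<lambda>R. R powr (1 - p) * L t powr p) \<longlongrightarrow> 0 * L t powr p) at_top"
      using p by (intro tendsto_mult_right tendsto_neg_powr filterlim_ident) auto
    then have "eventually (\<lambda>R. R powr (1 - p) * L t powr p < \<epsilon> / 3) at_top"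
      using \<epsilon> by (intro order_tendstoD(2)) auto
    with eventually_gt_at_top[of 0]
    have "eventually (\<lambda>R. R > 0 \<and> R powr (1 - p) * L t powr p < \<epsilon> / 3) at_top"
      by eventually_elim simp
    then obtain R where R: "R > 0" "R powr (1 - p) * L t powr p < \<epsilon> / 3"
      by (auto simp: eventually_at_top_linorder)
    have "(\<lambda>n. R * prob {\<omega> \<in> G n. Z n \<omega> t > \<epsilon> / 3}) \<longlonglongrightarrow> R * 0"
      using \<epsilon> by (intro tendsto_mult_left lim t) auto
    then have "eventually (\<lambda>n. R * prob {\<omega> \<in> G n. Z n \<omega> t > \<epsilon> / 3} < \<epsilon> / 3) sequentially"
      using \<epsilon> by (intro order_tendstoD(2)) auto
    then show "eventually (\<lambda>n. E n t \<le> ennreal \<epsilon>) sequentially"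
      using eventually_ge_at_top[of n0]
    proof eventually_elim
      case (elim n)
      have "E n t \<le> ennreal (\<epsilon> / 3 + R powr (1 - p) * L t powr p + R * prob {\<omega> \<in> G n. Z n \<omega> t > \<epsilon> / 3})"
        using elim t R \<epsilon> by (intro E_bound) auto
      also have "\<dots> \<le> ennreal \<epsilon>" using elim R by (intro ennreal_leI) auto
      finally show ?case .
    qed
  qed
  have Z_prod: "(\<lambda>(\<omega>, t). ennreal (Z n \<omega> t) * indicator (G n) \<omega>) \<in> borel_measurable (M \<Otimes>\<^sub>M \<mu>)"
    if n: "n \<ge> n0" for n
  proof -
    note [measurable] = meas[OF n] G[OF n]
    have "(\<lambda>x. ennreal (case x of (\<omega>, t) \<Rightarrow> Z n \<omega> t) * indicator (G n) (fst x)) \<in> borel_measurable (M \<Otimes>\<^sub>M \<mu>)"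
      by measurable
    then show ?thesis by (simp add: case_prod_beta')
  qed
  have E_meas: "E n \<in> borel_measurable \<mu>" if n: "n \<ge> n0" for n
  proof -
    have "(\<lambda>t. \<integral>\<^sup>+\<omega>. (\<lambda>(\<omega>, t). ennreal (Z n \<omega> t) * indicator (G n) \<omega>) (\<omega>, t) \<partial>M) \<in> borel_measurable \<mu>"
      using measurable_compose[OF measurable_pair_swap' Z_prod[OF n]]
      by (intro borel_measurable_nn_integral) (auto simp: comp_def split_beta')
    then show ?thesis by (simp add: E_def[abs_def])
  qed
  have "(\<lambda>n. \<integral>\<^sup>+t. E (n + n0) t \<partial>\<mu>) \<longlonglongrightarrow> (\<integral>\<^sup>+t. 0 \<partial>\<mu>)"
  proof (rule nn_integral_dominated_convergence)
    show "(\<lambda>t. ennreal (3 * L t)) \<in> borel_measurable \<mu>" using L(2) by simp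
    have "(\<integral>\<^sup>+t. ennreal (3 * L t) \<partial>\<mu>) = (\<integral>\<^sup>+t. 3 * ennreal (L t) \<partial>\<mu>)"
      by (intro nn_integral_cong) (simp add: ennreal_mult L(1) less_imp_le)
    also have "\<dots> = 3 * (\<integral>\<^sup>+t. ennreal (L t) \<partial>\<mu>)"
      using L(2) by (intro nn_integral_cmult) simp
    also have "\<dots> < \<infinity>" using L(3) by (simp add: ennreal_mult_less_top)
    finally show "(\<integral>\<^sup>+t. ennreal (3 * L t) \<partial>\<mu>) < \<infinity>" .
    show "AE t in \<mu>. E (j + n0) t \<le> ennreal (3 * L t)" for j by (intro AE_I2 E_dom) auto
    show "AE t in \<mu>. (\<lambda>i. E (i + n0) t) \<longlonglongrightarrow> 0"
      by (intro AE_I2 LIMSEQ_ignore_initial_segment E_lim)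
  qed (use E_meas in auto)
  then have int_lim: "(\<lambda>n. \<integral>\<^sup>+t. E n t \<partial>\<mu>) \<longlonglongrightarrow> 0"
    using LIMSEQ_offset[of "\<lambda>n. \<integral>\<^sup>+t. E n t \<partial>\<mu>" n0 0] by simp
  define J where "J n \<omega> = (\<integral>\<^sup>+t. ennreal (Z n \<omega> t) \<partial>\<mu>)" for n \<omega>
  have markov: "emeasure M {\<omega> \<in> G n. ennreal e \<le> J n \<omega>} \<le> ennreal (1 / e) * (\<integral>\<^sup>+t. E n t \<partial>\<mu>)"
    if n: "n \<ge> n0" for n
  proof -
    have "(\<integral>\<^sup>+t. E n t \<partial>\<mu>) = (\<integral>\<^sup>+\<omega>. (\<integral>\<^sup>+t. ennreal (Z n \<omega> t) * indicator (G n) \<omega> \<partial>\<mu>) \<partial>M)"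
      unfolding E_def using P.Fubini[OF Z_prod[OF n]] by simp
    also have "\<dots> = (\<integral>\<^sup>+\<omega>. J n \<omega> * indicator (G n) \<omega> \<partial>M)"
    proof (intro nn_integral_cong)
      fix \<omega> assume "\<omega> \<in> space M"
      then have "(\<lambda>t. Z n \<omega> t) \<in> borel_measurable \<mu>"
        using measurable_compose[OF measurable_Pair1' meas[OF n]] by simp
      then show "(\<integral>\<^sup>+t. ennreal (Z n \<omega> t) * indicator (G n) \<omega> \<partial>\<mu>) = J n \<omega> * indicator (G n) \<omega>"
        unfolding J_def by (intro nn_integral_multc) simp
    qed
    finally have eq: "(\<integral>\<^sup>+t. E n t \<partial>\<mu>) = (\<integral>\<^sup>+\<omega>. J n \<omega> * indicator (G n) \<omega> \<partial>M)" .
    have "J n \<in> borel_measurable M"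
    proof -
      note [measurable] = meas[OF n]
      show ?thesis unfolding J_def[abs_def] by measurable
    qed
    then have "emeasure M {\<omega> \<in> G n. 1 \<le> ennreal (1 / e) * J n \<omega>}
        \<le> ennreal (1 / e) * (\<integral>\<^sup>+\<omega>. J n \<omega> * indicator (G n) \<omega> \<partial>M)"
      using G[OF n] by (intro nn_integral_Markov_inequality) auto
    moreover have "1 \<le> ennreal (1 / e) * x \<longleftrightarrow> ennreal e \<le> x" for x
    proof (cases x)
      case (real r)
      then show ?thesis using e by (simp add: ennreal_mult[symmetric] field_simps flip: ennreal_1)
    next
      case top
      then show ?thesis using e by (simp add: ennreal_mult_top)
    qed
    ultimately show ?thesis by (simp add: eq)
  qed
  have "(\<lambda>n. ennreal (1 / e) * (\<integral>\<^sup>+t. E n t \<partial>\<mu>)) \<longlonglongrightarrow> ennreal (1 / e) * 0"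
    by (intro ennreal_tendsto_cmult int_lim) auto
  then have lim0: "(\<lambda>n. ennreal (1 / e) * (\<integral>\<^sup>+t. E n t \<partial>\<mu>)) \<longlonglongrightarrow> 0" by simp
  have "(\<lambda>n. emeasure M {\<omega> \<in> G n. ennreal e \<le> J n \<omega>}) \<longlonglongrightarrow> 0"
  proof (rule tendsto_sandwich[OF _ _ tendsto_const lim0])
    show "eventually (\<lambda>n. emeasure M {\<omega> \<in> G n. ennreal e \<le> J n \<omega>}
        \<le> ennreal (1 / e) * (\<integral>\<^sup>+t. E n t \<partial>\<mu>)) sequentially"
      using eventually_ge_at_top[of n0] by eventually_elim (rule markov)
  qed simp
  then show ?thesis
    unfolding emeasure_eq_measure J_def by (simp add: ennreal_tendsto_0_iff)
qed

section \<open>Convergence of intermediate order statistics\<close>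

abbreviation unit_lborel :: "real measure" where
  "unit_lborel \<equiv> restrict_space lborel {0<..1}"

lemma space_unit_lborel [simp]: "space unit_lborel = {0<..1}"
  by (simp add: space_restrict_space)

lemma sets_unit_lborel [measurable_cong]: "sets unit_lborel = sets unit_borel"
  by (simp add: sets_restrict_space)

lemma finite_measure_unit_lborel: "finite_measure unit_lborel"
  by (rule finite_measureI) (simp add: emeasure_restrict_space)

lemma nn_integral_unit_lborel_powr:
  assumes "g < 1"
  shows "(\<integral>\<^sup>+t. ennreal (t powr (- g)) \<partial>unit_lborel) = ennreal (1 / (1 - g))"
proof -
  have "((\<lambda>t. t powr (- g)) has_integral (1 powr (- g + 1) / (- g + 1))) {0..1}"
    using assms by (intro has_integral_powr_from_0) auto
  then have *: "((\<lambda>t. t powr (- g) * indicator {0<..1} t) has_integral (1 / (1 - g))) UNIV"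
  proof (subst (asm) has_integral_restrict_UNIV[symmetric])
    have eq: "(\<lambda>t. t powr (- g) * indicator {0<..1} t) = (\<lambda>t. if t \<in> {0..1} then t powr (- g) else 0)"
      by (auto simp: fun_eq_iff indicator_def)
    assume "((\<lambda>t. if t \<in> {0..1} then t powr (- g) else 0) has_integral 1 powr (- g + 1) / (- g + 1)) UNIV"
    then show ?thesis unfolding eq by simp
  qed
  have "(\<integral>\<^sup>+t. ennreal (t powr (- g)) \<partial>unit_lborel)
      = (\<integral>\<^sup>+t. ennreal (t powr (- g) * indicator {0<..1} t) \<partial>lborel)"
    by (subst nn_integral_restrict_space) (auto simp: ennreal_mult' ennreal_indicator intro!: nn_integral_cong)
  also have "\<dots> = ennreal (1 / (1 - g))"
    using * by (intro nn_integral_has_integral_lborel) auto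
  finally show ?thesis .
qed

lemma integral_unit_lborel_powr:
  assumes "g < 1"
  shows "integrable unit_lborel (\<lambda>t. t powr (- g))" "(\<integral>t. t powr (- g) \<partial>unit_lborel) = 1 / (1 - g)"
proof -
  show "integrable unit_lborel (\<lambda>t. t powr (- g))"
    by (rule integrableI_nonneg)
       (auto simp: nn_integral_unit_lborel_powr[OF assms] intro!: measurable_restrict_space1)
  show "(\<integral>t. t powr (- g) \<partial>unit_lborel) = 1 / (1 - g)"
    by (subst integral_eq_nn_integral)
       (use assms in \<open>auto simp: nn_integral_unit_lborel_powr intro!: measurable_restrict_space1\<close>)
qed

lemma nat_ceiling_bounds:
  assumes "0 < t" "t \<le> 1" "1 \<le> j"
  shows "1 \<le> nat \<lceil>t * real j\<rceil>" "nat \<lceil>t * real j\<rceil> \<le> j" "t * real j \<le> real (nat \<lceil>t * real j\<rceil>)"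
    "real (nat \<lceil>t * real j\<rceil>) < t * real j + 1"
proof -
  have pos: "t * real j > 0" using assms by simp
  then show "1 \<le> nat \<lceil>t * real j\<rceil>" by linarith
  have "t * real j \<le> 1 * real j" using assms by (intro mult_right_mono) auto
  then show "nat \<lceil>t * real j\<rceil> \<le> j" by (simp add: ceiling_le_iff nat_le_iff)
  show "t * real j \<le> real (nat \<lceil>t * real j\<rceil>)" "real (nat \<lceil>t * real j\<rceil>) < t * real j + 1"
    using pos by linarith+
qed

lemma nat_floor_bounds:
  assumes "0 < c" "c < 1" "1 \<le> k" and j: "j = nat \<lfloor>c * real k\<rfloor> + 1"
  shows "1 \<le> j" "j \<le> k" "c * real k < real j" "real j \<le> c * real k + 1"
proof -
  have "0 \<le> c * real k" "c * real k < real k" using assms by auto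
  then show "1 \<le> j" "j \<le> k" "c * real k < real j" "real j \<le> c * real k + 1"
    unfolding j by linarith+
qed

lemma measurable_nat_ceiling:
  assumes "1 \<le> j"
  shows "(\<lambda>t. nat \<lceil>t * real j\<rceil>) \<in> measurable unit_borel (count_space {1..j})"
proof (rule measurable_count_space_extend[where B = UNIV])
  show "(\<lambda>t. nat \<lceil>t * real j\<rceil>) \<in> space unit_borel \<rightarrow> {1..j}"
    using assms nat_ceiling_bounds by (auto simp: space_restrict_space)
  show "(\<lambda>t. nat \<lceil>t * real j\<rceil>) \<in> measurable unit_borel (count_space UNIV)"
    by (rule measurable_restrict_space1) measurable
qed simp

text \<open>The index takes finitely many values, so joint measurability reduces to that of the
  finitely many \<open>f k\<close>.\<close>

lemma measurable_random_index:
  assumes f: "\<And>k. k \<in> {1..j} \<Longrightarrow> f k \<in> borel_measurable M" and j: "1 \<le> j"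
    and \<mu>: "sets \<mu> = sets unit_borel"
  shows "(\<lambda>(\<omega>, t). f (nat \<lceil>t * real j\<rceil>) \<omega> :: real) \<in> borel_measurable (M \<Otimes>\<^sub>M \<mu>)"
proof -
  have "(\<lambda>t. nat \<lceil>t * real j\<rceil>) \<in> measurable \<mu> (count_space {1..j})"
    using measurable_nat_ceiling[OF j] measurable_cong_sets[OF \<mu> refl] by blast
  note index = measurable_compose[OF measurable_snd this]
  have "(\<lambda>x. f (nat \<lceil>snd x * real j\<rceil>) (fst x)) \<in> borel_measurable (M \<Otimes>\<^sub>M \<mu>)"
  proof (rule measurable_compose_countable'[where I = "{1..j}" and f = "\<lambda>k x. f k (fst x)"])
    show "(\<lambda>x. f k (fst x)) \<in> borel_measurable (M \<Otimes>\<^sub>M \<mu>)" if "k \<in> {1..j}" for k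
      by (rule measurable_compose[OF measurable_fst f[OF that]])
  qed (use index in simp_all)
  then show ?thesis by (simp add: case_prod_beta')
qed

text \<open>The ceiling equals \<open>i\<close> exactly on \<open>((i - 1) / j, i / j]\<close>, an
  interval of length \<open>1 / j\<close>. Reading an average as an integral reduces its convergence
  to that of single order statistics at fixed \<open>t\<close>.\<close>

lemma integral_step:
  fixes f :: "nat \<Rightarrow> real"
  assumes j: "1 \<le> j"
  shows "integrable unit_lborel (\<lambda>t. f (nat \<lceil>t * real j\<rceil>))"
    and "(\<integral>t. f (nat \<lceil>t * real j\<rceil>) \<partial>unit_lborel) = (\<Sum>i = 1..j. f i) / real j"
proof -
  define A where "A i = {(real i - 1) / real j <.. real i / real j}" for i
  have A: "A i \<in> sets unit_lborel" "measure unit_lborel (A i) = 1 / real j" "emeasure unit_lborel (A i) < \<infinity>"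
    if "i \<in> {1..j}" for i
  proof -
    have "0 \<le> (real i - 1) / real j" "real i / real j \<le> 1" using that j by auto
    then have sub: "A i \<subseteq> {0<..1}" unfolding A_def by auto
    then show "A i \<in> sets unit_lborel" by (auto simp: sets_restrict_space A_def)
    have "measure unit_lborel (A i) = measure lborel (A i)"
      using sub by (intro measure_restrict_space) auto
    also have "\<dots> = 1 / real j" using j by (simp add: A_def divide_simps)
    finally show "measure unit_lborel (A i) = 1 / real j" .
    have "(real i - 1) / real j \<le> real i / real j" by (intro divide_right_mono) auto
    then show "emeasure unit_lborel (A i) < \<infinity>"
      using sub by (subst emeasure_restrict_space) (auto simp: A_def)
  qed
  have eq: "f (nat \<lceil>t * real j\<rceil>) = (\<Sum>i = 1..j. f i * indicator (A i) t)" if t: "t \<in> {0<..1}" for t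
  proof -
    have ind: "indicator (A i) t = (if i = nat \<lceil>t * real j\<rceil> then 1 else 0 :: real)" if "i \<in> {1..j}" for i
    proof -
      have "t \<in> A i \<longleftrightarrow> real i - 1 < t * real j \<and> t * real j \<le> real i"
        using j by (simp add: A_def field_simps)
      also have "\<dots> \<longleftrightarrow> \<lceil>t * real j\<rceil> = int i" by (auto simp: ceiling_eq_iff)
      also have "\<dots> \<longleftrightarrow> i = nat \<lceil>t * real j\<rceil>" using that by auto
      finally show ?thesis by (simp add: indicator_def)
    qed
    have "(\<Sum>i = 1..j. f i * indicator (A i) t) = (\<Sum>i = 1..j. if i = nat \<lceil>t * real j\<rceil> then f i else 0)"
      by (intro sum.cong refl) (simp add: ind)
    also have "\<dots> = f (nat \<lceil>t * real j\<rceil>)"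
      using nat_ceiling_bounds[of t j] t j by simp
    finally show ?thesis by simp
  qed
  have int: "integrable unit_lborel (\<lambda>t. f i * indicator (A i) t)" if "i \<in> {1..j}" for i
    using A[OF that] by (intro integrable_mult_right integrable_real_indicator)
  have "integrable unit_lborel (\<lambda>t. \<Sum>i = 1..j. f i * indicator (A i) t)"
    by (intro Bochner_Integration.integrable_sum int)
  then show "integrable unit_lborel (\<lambda>t. f (nat \<lceil>t * real j\<rceil>))"
    by (subst Bochner_Integration.integrable_cong[OF refl eq]) auto
  have "(\<integral>t. f (nat \<lceil>t * real j\<rceil>) \<partial>unit_lborel) = (\<integral>t. (\<Sum>i = 1..j. f i * indicator (A i) t) \<partial>unit_lborel)"
    by (intro Bochner_Integration.integral_cong refl eq) auto
  also have "\<dots> = (\<Sum>i = 1..j. \<integral>t. f i * indicator (A i) t \<partial>unit_lborel)"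
    by (intro Bochner_Integration.integral_sum int)
  also have "\<dots> = (\<Sum>i = 1..j. f i * (1 / real j))"
  proof (intro sum.cong refl)
    fix i assume i: "i \<in> {1..j}"
    have "A i \<inter> space unit_lborel = A i" using A(1)[OF i] by (rule sets.Int_space_eq2)
    then have "(\<integral>t. f i * indicator (A i) t \<partial>unit_lborel) = f i * measure unit_lborel (A i)"
      by (simp del: space_unit_lborel)
    then show "(\<integral>t. f i * indicator (A i) t \<partial>unit_lborel) = f i * (1 / real j)"
      by (simp only: A(2)[OF i])
  qed
  also have "\<dots> = (\<Sum>i = 1..j. f i) / real j" by (simp add: sum_divide_distrib)
  finally show "(\<integral>t. f (nat \<lceil>t * real j\<rceil>) \<partial>unit_lborel) = (\<Sum>i = 1..j. f i) / real j" .
qed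

lemma ratio_at_top:
  fixes m :: "nat \<Rightarrow> nat"
  assumes "filterlim m at_top sequentially" "(\<lambda>n. real (m n) / real n) \<longlonglongrightarrow> 0"
  shows "filterlim (\<lambda>n. real n / real (m n)) at_top sequentially"
proof -
  have "eventually (\<lambda>n. m n > 0) sequentially"
    by (rule eventually_compose_filterlim[OF eventually_gt_at_top assms(1)])
  then have "eventually (\<lambda>n. 0 < real (m n) / real n) sequentially"
    using eventually_gt_at_top[of 0] by eventually_elim simp
  then have "filterlim (\<lambda>n. inverse (real (m n) / real n)) at_top sequentially"
    by (rule filterlim_inverse_at_top[OF assms(2)])
  then show ?thesis by simp
qed

context iid_extremes
begin

text \<open>Chebyshev's inequality traps the order statistic between \<open>U\<close> at
  \<open>n / ((1 + \<eta>) * i)\<close> and at \<open>n / ((1 - \<eta>) * i)\<close>. After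
  normalisation these converge to values of \<open>H\<close> that are within \<open>e\<close> of
  \<open>H (1 / \<theta>)\<close> for small \<open>\<eta>\<close>, by continuity.\<close>

lemma order_stat_in_prob:
  fixes m i :: "nat \<Rightarrow> nat"
  assumes m: "filterlim m at_top sequentially" "(\<lambda>n. real (m n) / real n) \<longlonglongrightarrow> 0"
    and i: "(\<lambda>n. real (i n) / real (m n)) \<longlonglongrightarrow> \<theta>" "\<theta> > 0" and e: "e > 0"
  shows "(\<lambda>n. prob {\<omega> \<in> space M.
    \<bar>(desc_order_stat X n (i n) \<omega> - U (real n / real (m n))) / \<alpha> (real n / real (m n)) - H (1 / \<theta>)\<bar> > e})
    \<longlonglongrightarrow> 0"
proof -
  define s where "s n = real n / real (m n)" for n
  have m_pos: "eventually (\<lambda>n. m n > 0) sequentially"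
    by (rule eventually_compose_filterlim[OF eventually_gt_at_top m(1)])
  have s_lim: "filterlim s at_top sequentially"
    unfolding s_def by (rule ratio_at_top[OF m])
  have m_real: "filterlim (\<lambda>n. real (m n)) at_top sequentially"
    by (rule filterlim_compose[OF filterlim_real_sequentially m(1)])
  have i_inf: "filterlim (\<lambda>n. real (i n)) at_top sequentially"
  proof -
    have inf: "filterlim (\<lambda>n. real (i n) / real (m n) * real (m n)) at_top sequentially"
      by (rule filterlim_tendsto_pos_mult_at_top[OF i m_real])
    have ev: "eventually (\<lambda>n. real (i n) / real (m n) * real (m n) = real (i n)) sequentially"
      using m_pos by eventually_elim simp
    from iffD1[OF filterlim_cong[OF refl refl ev] inf] show ?thesis .
  qed
  have i_small: "(\<lambda>n. real (i n) / real n) \<longlonglongrightarrow> 0"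
  proof -
    have "(\<lambda>n. real (i n) / real (m n) * (real (m n) / real n)) \<longlonglongrightarrow> \<theta> * 0"
      by (intro tendsto_mult i m)
    moreover have "eventually (\<lambda>n. real (i n) / real (m n) * (real (m n) / real n) = real (i n) / real n) sequentially"
      using m_pos by eventually_elim simp
    ultimately have "(\<lambda>n. real (i n) / real n) \<longlonglongrightarrow> \<theta> * 0" by (rule Lim_transform_eventually)
    then show ?thesis by simp
  qed
  have cont: "((\<lambda>\<eta>. H (1 / ((1 - \<eta>) * \<theta>))) \<longlongrightarrow> H (1 / \<theta>)) (at_right 0)"
    "((\<lambda>\<eta>. H (1 / ((1 + \<eta>) * \<theta>))) \<longlongrightarrow> H (1 / \<theta>)) (at_right 0)"
    using i(2) by (auto intro!: isCont_tendsto_compose[OF isCont_H] tendsto_eq_intros)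
  have "eventually (\<lambda>\<eta>. H (1 / ((1 - \<eta>) * \<theta>)) < H (1 / \<theta>) + e
      \<and> H (1 / ((1 + \<eta>) * \<theta>)) > H (1 / \<theta>) - e \<and> 0 < \<eta> \<and> \<eta> < 1) (at_right (0::real))"
    using e by (intro eventually_conj order_tendstoD[OF cont(1)] order_tendstoD[OF cont(2)]
        eventually_at_right_less eventually_at_rightI[of 0 1]) auto
  then obtain \<eta> where \<eta>: "H (1 / ((1 - \<eta>) * \<theta>)) < H (1 / \<theta>) + e"
      "H (1 / ((1 + \<eta>) * \<theta>)) > H (1 / \<theta>) - e" "0 < \<eta>" "\<eta> < 1"
    using eventually_happens'[OF trivial_limit_at_right_real] by blast
  have lim: "(\<lambda>n. (U (real n / (r * real (i n))) - U (s n)) / \<alpha> (s n)) \<longlonglongrightarrow> H (1 / (r * \<theta>))" if r: "r > 0" for r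
  proof -
    have "(\<lambda>n. 1 / (r * (real (i n) / real (m n)))) \<longlonglongrightarrow> 1 / (r * \<theta>)"
      using r i by (intro tendsto_intros) auto
    then have "(\<lambda>n. (U (s n * (1 / (r * (real (i n) / real (m n))))) - U (s n)) / \<alpha> (s n)) \<longlonglongrightarrow> H (1 / (r * \<theta>))"
      using r i(2) by (intro U_lim_seq[OF s_lim]) auto
    moreover have "eventually (\<lambda>n. s n * (1 / (r * (real (i n) / real (m n)))) = real n / (r * real (i n))) sequentially"
      using m_pos by eventually_elim (simp add: s_def)
    then have "eventually (\<lambda>n. (U (s n * (1 / (r * (real (i n) / real (m n))))) - U (s n)) / \<alpha> (s n)
        = (U (real n / (r * real (i n))) - U (s n)) / \<alpha> (s n)) sequentially"
      by eventually_elim (simp only:)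
    ultimately show ?thesis by (rule Lim_transform_eventually)
  qed
  have r: "1 - \<eta> > 0" "1 + \<eta> > 0" using \<eta> by auto
  note lim1 = lim[OF r(1)] and lim2 = lim[OF r(2)]
  have ev: "eventually (\<lambda>n. prob {\<omega> \<in> space M. \<bar>(desc_order_stat X n (i n) \<omega> - U (s n)) / \<alpha> (s n) - H (1 / \<theta>)\<bar> > e}
     \<le> 1 / (\<eta>\<^sup>2 * real (i n)) + (1 + \<eta>) / (\<eta>\<^sup>2 * real (i n))) sequentially"
    using order_tendstoD(2)[OF lim1 \<eta>(1)] order_tendstoD(1)[OF lim2 \<eta>(2)]
      order_tendstoD(2)[OF i_small half_gt_zero[OF zero_less_one]] eventually_compose_filterlim[OF eventually_ge_at_top[of 1] i_inf]
      eventually_compose_filterlim[OF eventually_\<alpha>_pos s_lim] eventually_gt_at_top[of 0]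
  proof eventually_elim
    case (elim n)
    have H1: "(U (real n / ((1 - \<eta>) * real (i n))) - U (s n)) / \<alpha> (s n) < H (1 / \<theta>) + e"
      using elim(1) \<eta> by simp
    have H2: "H (1 / \<theta>) - e < (U (real n / ((1 + \<eta>) * real (i n))) - U (s n)) / \<alpha> (s n)"
      using elim(2) \<eta> by simp
    have i1: "1 \<le> i n" using elim by simp
    have i2: "2 * real (i n) < real n" using elim by (simp add: field_simps)
    then have in_le: "i n \<le> n" by linarith
    note [measurable] = order_stat_measurable[OF i1 in_le]
    let ?Z = "desc_order_stat X n (i n)"
    have s1: "real n / ((1 - \<eta>) * real (i n)) > 1" "real n / ((1 + \<eta>) * real (i n)) > 1"
    proof -
      have "(1 - \<eta>) * real (i n) \<le> 2 * real (i n)" "(1 + \<eta>) * real (i n) \<le> 2 * real (i n)"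
        using \<eta> by (auto intro!: mult_right_mono)
      then have "(1 - \<eta>) * real (i n) < real n" "(1 + \<eta>) * real (i n) < real n" using i2 by linarith+
      moreover have "(1 - \<eta>) * real (i n) > 0" "(1 + \<eta>) * real (i n) > 0" using i1 \<eta> by auto
      ultimately show "real n / ((1 - \<eta>) * real (i n)) > 1" "real n / ((1 + \<eta>) * real (i n)) > 1"
        by (simp_all only: less_divide_eq_1_pos)
    qed
    have "{\<omega> \<in> space M. \<bar>(?Z \<omega> - U (s n)) / \<alpha> (s n) - H (1 / \<theta>)\<bar> > e}
      \<subseteq> {\<omega> \<in> space M. U (real n / ((1 - \<eta>) * real (i n))) < ?Z \<omega>}
       \<union> {\<omega> \<in> space M. ?Z \<omega> < U (real n / ((1 + \<eta>) * real (i n)))}"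
    proof (safe, rule ccontr)
      fix \<omega> assume *: "\<bar>(?Z \<omega> - U (s n)) / \<alpha> (s n) - H (1 / \<theta>)\<bar> > e"
        "\<not> ?Z \<omega> < U (real n / ((1 + \<eta>) * real (i n)))" "\<not> U (real n / ((1 - \<eta>) * real (i n))) < ?Z \<omega>"
      have "(?Z \<omega> - U (s n)) / \<alpha> (s n) \<le> (U (real n / ((1 - \<eta>) * real (i n))) - U (s n)) / \<alpha> (s n)"
        "(?Z \<omega> - U (s n)) / \<alpha> (s n) \<ge> (U (real n / ((1 + \<eta>) * real (i n))) - U (s n)) / \<alpha> (s n)"
        using * elim(5) by (auto intro!: divide_right_mono)
      then show False using H1 H2 *(1) by linarith
    qed
    then have "prob {\<omega> \<in> space M. \<bar>(?Z \<omega> - U (s n)) / \<alpha> (s n) - H (1 / \<theta>)\<bar> > e}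
      \<le> prob ({\<omega> \<in> space M. U (real n / ((1 - \<eta>) * real (i n))) < ?Z \<omega>}
       \<union> {\<omega> \<in> space M. ?Z \<omega> < U (real n / ((1 + \<eta>) * real (i n)))})"
      by (rule finite_measure_mono) measurable
    also have "\<dots> \<le> prob {\<omega> \<in> space M. U (real n / ((1 - \<eta>) * real (i n))) < ?Z \<omega>}
       + prob {\<omega> \<in> space M. ?Z \<omega> < U (real n / ((1 + \<eta>) * real (i n)))}"
      by (rule measure_Un_le) measurable
    also have "\<dots> \<le> 1 / (\<eta>\<^sup>2 * real (i n)) + (1 + \<eta>) / (\<eta>\<^sup>2 * real (i n))"
      using s1 \<eta> i1 in_le elim by (intro add_mono order_stat_upper order_stat_lower) auto
    finally show ?case .
  qed
  have "(\<lambda>n. 1 / (\<eta>\<^sup>2 * real (i n)) + (1 + \<eta>) / (\<eta>\<^sup>2 * real (i n))) \<longlonglongrightarrow> 0 + 0"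
  proof (rule tendsto_add)
    have "filterlim (\<lambda>n. \<eta>\<^sup>2 * real (i n)) at_top sequentially"
      by (rule filterlim_tendsto_pos_mult_at_top[OF tendsto_const _ i_inf]) (use \<eta> in simp)
    note lim_inf = real_tendsto_divide_at_top[OF tendsto_const this]
    show "(\<lambda>n. 1 / (\<eta>\<^sup>2 * real (i n))) \<longlonglongrightarrow> 0" by (rule lim_inf)
    show "(\<lambda>n. (1 + \<eta>) / (\<eta>\<^sup>2 * real (i n))) \<longlonglongrightarrow> 0" by (rule lim_inf)
  qed
  then have lim0: "(\<lambda>n. 1 / (\<eta>\<^sup>2 * real (i n)) + (1 + \<eta>) / (\<eta>\<^sup>2 * real (i n))) \<longlonglongrightarrow> 0" by simp
  show ?thesis
    by (rule tendsto_sandwich[OF _ ev[unfolded s_def] tendsto_const lim0]) simp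
qed

end

section \<open>Convergence of CVaR order statistics\<close>

lemma powr_add_le:
  fixes a b p :: real
  assumes "a \<ge> 0" "b \<ge> 0" "p > 0"
  shows "(a + b) powr p \<le> 2 powr p * (a powr p + b powr p)"
proof -
  have "(a + b) powr p \<le> (2 * max a b) powr p" using assms by (intro powr_mono2) auto
  also have "\<dots> = 2 powr p * max a b powr p" using assms by (simp add: powr_mult)
  also have "\<dots> \<le> 2 powr p * (a powr p + b powr p)" by (intro mult_left_mono) (auto simp: max_def)
  finally show ?thesis .
qed

context iid_extremes
begin

text \<open>By \<open>integral_step\<close> the deviation is at most an integral over
  \<open>t\<close> of deviations of single order statistics, each of which tends to 0 in
  probability. \<open>nn_integral_tendsto_0_in_prob\<close> applies with a multiple of
  \<open>t powr (- g)\<close> as majorant; its integrability needs \<open>g < 1\<close>, which is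
  where \<open>\<gamma> < 1\<close> enters.\<close>

lemma cvar_order_stat_in_prob:
  fixes m j :: "nat \<Rightarrow> nat"
  assumes \<gamma>: "\<gamma> < 1"
    and m: "filterlim m at_top sequentially" "(\<lambda>n. real (m n) / real n) \<longlonglongrightarrow> 0"
    and j: "(\<lambda>n. real (j n) / real (m n)) \<longlonglongrightarrow> \<tau>" and \<tau>: "0 < \<tau>" "\<tau> \<le> 1" and e: "e > 0"
  shows "(\<lambda>n. prob {\<omega> \<in> space M. \<bar>(cvar_order_stat X n (j n) \<omega> - U (real n / real (m n))) / \<alpha> (real n / real (m n))
      - (\<integral>t. H (1 / (\<tau> * t)) \<partial>unit_lborel)\<bar> > e}) \<longlonglongrightarrow> 0"
    and "integrable unit_lborel (\<lambda>t. H (1 / (\<tau> * t)))"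
proof -
  \<comment> \<open>The midpoint of \<open>max 0 \<gamma>\<close> and 1; likewise \<open>p\<close>
    below is the midpoint of 1 and \<open>1 / g\<close>, so that \<open>p > 1\<close> while
    \<open>p * g < 1\<close>, as the moment bound demands.\<close>
  define g where "g = (max 0 \<gamma> + 1) / 2"
  have g: "\<gamma> < g" "0 < g" "g < 1" using \<gamma> by (auto simp: g_def)
  define p where "p = (1 + 1 / g) / 2"
  have p: "p > 1" "p * g < 1" using g by (auto simp: p_def field_simps)
  then have p0: "0 < p" by simp
  define s where "s n = real n / real (m n)" for n
  have s_lim: "filterlim s at_top sequentially"
    unfolding s_def by (rule ratio_at_top[OF m])
  obtain C s0 where C: "C > 0" "s0 > 1" "\<And>s. s \<ge> s0 \<Longrightarrow> \<alpha> s > 0"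
    "\<And>s n i. s \<ge> s0 \<Longrightarrow> 1 \<le> i \<Longrightarrow> i \<le> n \<Longrightarrow> real i * s \<le> real n \<Longrightarrow>
      (\<integral>\<^sup>+\<omega>. ennreal (max 0 ((desc_order_stat X n i \<omega> - U s) / \<alpha> s) powr p) \<partial>M)
        \<le> ennreal (C * (real n / (real i * s)) powr (p * g))"
    using order_stat_moment[OF g(1,2) p0 p(2)] by blast
  obtain C2 where C2: "C2 > 0" "\<And>x. x \<ge> 1 \<Longrightarrow> H x \<le> C2 * x powr g"
    using H_bound[OF g(1,2)] by blast
  define Hb where "Hb = C2 * \<tau> powr (- g)"
  have H_abs: "\<bar>H (1 / (\<tau> * t))\<bar> \<le> Hb * t powr (- g)" if t: "t \<in> {0<..1}" for t
  proof -
    have "\<tau> * t \<le> 1" "\<tau> * t > 0" using t \<tau> by (auto intro!: mult_le_one)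
    then have x: "1 / (\<tau> * t) \<ge> 1" by simp
    have "H (1 / (\<tau> * t)) \<ge> 0"
      using H_pos[of "1 / (\<tau> * t)"] x by (cases "1 / (\<tau> * t) = 1") auto
    moreover have "(1 / (\<tau> * t)) powr g = \<tau> powr (- g) * t powr (- g)"
      using t \<tau> by (simp add: powr_divide powr_mult powr_minus_divide)
    ultimately show ?thesis using C2(2)[OF x] by (simp add: Hb_def mult.assoc)
  qed
  show H_int: "integrable unit_lborel (\<lambda>t. H (1 / (\<tau> * t)))"
  proof (rule Bochner_Integration.integrable_bound)
    show "integrable unit_lborel (\<lambda>t. Hb * t powr (- g))"
      using integral_unit_lborel_powr[OF g(3)] by simp
    show "(\<lambda>t. H (1 / (\<tau> * t))) \<in> borel_measurable unit_lborel"
      by (intro measurable_restrict_space1) measurable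
    show "AE t in unit_lborel. norm (H (1 / (\<tau> * t))) \<le> norm (Hb * t powr (- g))"
      using H_abs C2(1) by (intro AE_I2) (auto simp: Hb_def abs_mult)
  qed
  define R where "R = (1 / 2) powr \<gamma> + 1"
  define B where "B = \<bar>H (1 / (2 * \<tau>))\<bar> + 1"
  \<comment> \<open>The indices run up to \<open>j n \<le> 2 * m n\<close>, whereas the moment bound
    needs \<open>i * s \<le> n\<close>. Halving the level secures this, at the price of the bounded
    factor \<open>R\<close>.\<close>
  define s' where "s' n = s n * (1 / 2)" for n
  have R0: "R > 0" by (auto simp: R_def intro!: add_nonneg_pos)
  have ev_R: "eventually (\<lambda>n. \<alpha> (s' n) / \<alpha> (s n) < R) sequentially"
    unfolding s'_def by (rule order_tendstoD(2)[OF \<alpha>_lim_seq[OF s_lim tendsto_const]]) (auto simp: R_def)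
  have m_pos: "eventually (\<lambda>n. m n > 0) sequentially"
    by (rule eventually_compose_filterlim[OF eventually_gt_at_top m(1)])
  have lim_j: "(\<lambda>n. (U (s n * (1 / (2 * (real (j n) / real (m n))))) - U (s n)) / \<alpha> (s n)) \<longlonglongrightarrow> H (1 / (2 * \<tau>))"
    using \<tau> by (intro U_lim_seq[OF s_lim] tendsto_intros j) auto
  have ev_B: "eventually (\<lambda>n. - B < (U (s n * (1 / (2 * (real (j n) / real (m n))))) - U (s n)) / \<alpha> (s n)) sequentially"
    by (rule order_tendstoD(1)[OF lim_j]) (simp add: B_def)
  have "(\<lambda>n. real (j n) / real (m n) * (real (m n) / real n)) \<longlonglongrightarrow> \<tau> * 0"
    by (intro tendsto_mult j m)
  then have ev_small: "eventually (\<lambda>n. real (j n) / real (m n) * (real (m n) / real n) < 1 / 2) sequentially"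
    by (rule order_tendstoD) simp
  have ev_j: "eventually (\<lambda>n. \<tau> / 2 < real (j n) / real (m n) \<and> real (j n) / real (m n) < 2) sequentially"
    using \<tau> by (intro eventually_conj order_tendstoD[OF j]) auto
  have ev_s: "eventually (\<lambda>n. s n \<ge> 2 * s0) sequentially"
    by (rule eventually_compose_filterlim[OF eventually_ge_at_top s_lim])
  have "eventually (\<lambda>n. 1 \<le> j n \<and> 2 * real (j n) < real n \<and> real (j n) \<le> 2 * real (m n) \<and> \<tau> / 2 * real (m n) \<le> real (j n)
     \<and> m n > 0 \<and> s n \<ge> 2 * s0 \<and> \<alpha> (s' n) \<le> R * \<alpha> (s n)
     \<and> - B \<le> (U (real n / (2 * real (j n))) - U (s n)) / \<alpha> (s n)) sequentially"
    using ev_R m_pos ev_B ev_small ev_j ev_s eventually_gt_at_top[of 0]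
  proof eventually_elim
    case (elim n)
    have "s n > 0" using elim C(2) by auto
    have 1: "\<tau> / 2 * real (m n) < real (j n)" "real (j n) < 2 * real (m n)"
      using elim(2,5) by (auto simp: field_simps)
    moreover have "\<tau> / 2 * real (m n) > 0" using \<tau> elim(2) by simp
    ultimately have "real (j n) > 0" by linarith
    then have 2: "1 \<le> j n" by simp
    have 3: "2 * real (j n) < real n" using elim(2,4,7) by (simp add: field_simps)
    have "\<alpha> (s n) > 0" using elim(6) C by auto
    then have 4: "\<alpha> (s' n) \<le> R * \<alpha> (s n)" using elim(1) by (simp add: field_simps)
    have eq: "s n * (1 / (2 * (real (j n) / real (m n)))) = real n / (2 * real (j n))"
      using elim(2) by (simp add: s_def)
    have "- B \<le> (U (real n / (2 * real (j n))) - U (s n)) / \<alpha> (s n)"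
      using elim(3) unfolding eq by (rule less_imp_le)
    then show ?case using 1 2 3 4 elim by auto
  qed
  then obtain n0 where n0: "1 \<le> j n" "2 * real (j n) < real n" "real (j n) \<le> 2 * real (m n)"
      "\<tau> / 2 * real (m n) \<le> real (j n)" "m n > 0" "s n \<ge> 2 * s0" "\<alpha> (s' n) \<le> R * \<alpha> (s n)"
      "- B \<le> (U (real n / (2 * real (j n))) - U (s n)) / \<alpha> (s n)" if "n \<ge> n0" for n
    unfolding eventually_sequentially by blast
  define f where "f n \<omega> i = (desc_order_stat X n i \<omega> - U (s n)) / \<alpha> (s n)" for n \<omega> i
  define Z where "Z n \<omega> t = \<bar>f n \<omega> (nat \<lceil>t * real (j n)\<rceil>) - H (1 / (\<tau> * t))\<bar>" for n \<omega> t
  \<comment> \<open>The moment bound concerns positive parts only. On \<open>G n\<close> all order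
    statistics of index at most \<open>j n\<close> are bounded below, so normalised negative parts
    are at most the constant \<open>B\<close>.\<close>
  define G where "G n = {\<omega> \<in> space M. U (real n / (2 * real (j n))) \<le> desc_order_stat X n (j n) \<omega>}" for n
  have jn: "j n \<le> n" if "n \<ge> n0" for n using n0(2)[OF that] by linarith
  have f_meas: "(\<lambda>\<omega>. f n \<omega> i) \<in> borel_measurable M" if "n \<ge> n0" "1 \<le> i" "i \<le> j n" for n i
  proof -
    have [measurable]: "desc_order_stat X n i \<in> borel_measurable M"
      using that jn[of n] by (intro order_stat_measurable) auto
    show ?thesis unfolding f_def by measurable
  qed
  have G_ev: "G n \<in> events" if "n \<ge> n0" for n
  proof -
    note [measurable] = order_stat_measurable[OF n0(1)[OF that] jn[OF that]]
    show ?thesis unfolding G_def by measurable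
  qed
  have G_prob: "prob (space M - G n) \<le> 2 / real (j n)" if n: "n \<ge> n0" for n
  proof -
    have "space M - G n = {\<omega> \<in> space M. desc_order_stat X n (j n) \<omega> < U (real n / (2 * real (j n)))}"
      by (auto simp: G_def)
    also have "prob \<dots> \<le> (1 + 1) / (1\<^sup>2 * real (j n))"
      using n0(1,2)[OF n] jn[OF n] by (intro order_stat_lower) (auto simp: field_simps)
    finally show ?thesis by simp
  qed
  have Z_meas: "(\<lambda>(\<omega>, t). Z n \<omega> t) \<in> borel_measurable (M \<Otimes>\<^sub>M unit_lborel)" if n: "n \<ge> n0" for n
  proof -
    have [measurable]: "(\<lambda>(\<omega>, t). f n \<omega> (nat \<lceil>t * real (j n)\<rceil>)) \<in> borel_measurable (M \<Otimes>\<^sub>M unit_lborel)"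
      using f_meas[OF n] n0(1)[OF n] by (intro measurable_random_index sets_unit_lborel) auto
    have [measurable]: "(\<lambda>t. H (1 / (\<tau> * t))) \<in> borel_measurable unit_lborel"
      by (intro measurable_restrict_space1) measurable
    show ?thesis unfolding Z_def by measurable
  qed
  have main: "(\<lambda>n. prob {\<omega> \<in> G n. ennreal e \<le> (\<integral>\<^sup>+t. ennreal (Z n \<omega> t) \<partial>unit_lborel)}) \<longlonglongrightarrow> 0"
  proof -
    define D where "D = B + Hb"
    have "Hb > 0" "B \<ge> 1" using C2(1) \<tau> by (auto simp: Hb_def B_def)
    then have D0: "D > 0" by (simp add: D_def)
    \<comment> \<open>The factor \<open>2 powr p\<close> comes from \<open>powr_add_le\<close>. The
      factor \<open>4 / \<tau>\<close> comes from \<open>n / (i * s') = 2 * m / i\<close> together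
      with \<open>i \<ge> t * j\<close> and \<open>j \<ge> \<tau> / 2 * m\<close>.\<close>
    define K0 where "K0 = 2 powr p * (D powr p + R powr p * (C * (4 / \<tau>) powr (p * g)))"
    have K0: "K0 > 0" using D0 R0 C(1) \<tau> by (auto simp: K0_def intro!: mult_pos_pos add_pos_pos)
    define L where "L t = K0 powr (1 / p) * t powr (- g)" for t
    show ?thesis
    proof (rule nn_integral_tendsto_0_in_prob[where p = p and L = L and ?n0.0 = n0])
      show "sigma_finite_measure unit_lborel"
        using finite_measure_unit_lborel by (simp add: finite_measure_def)
      show "L t > 0" if "t \<in> space unit_lborel" for t using that K0 by (auto simp: L_def)
      show "L \<in> borel_measurable unit_lborel"
        unfolding L_def by (intro measurable_restrict_space1) measurable
      have "(\<integral>\<^sup>+t. ennreal (L t) \<partial>unit_lborel) = (\<integral>\<^sup>+t. ennreal (K0 powr (1 / p)) * ennreal (t powr (- g)) \<partial>unit_lborel)"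
        by (simp add: L_def ennreal_mult)
      also have "\<dots> = ennreal (K0 powr (1 / p)) * (\<integral>\<^sup>+t. ennreal (t powr (- g)) \<partial>unit_lborel)"
        by (intro nn_integral_cmult measurable_compose[OF _ measurable_ennreal] measurable_restrict_space1) measurable
      finally show "(\<integral>\<^sup>+t. ennreal (L t) \<partial>unit_lborel) < \<infinity>"
        by (simp add: nn_integral_unit_lborel_powr[OF g(3)] ennreal_mult_less_top)
      show "(\<lambda>n. prob {\<omega> \<in> G n. Z n \<omega> t > e'}) \<longlonglongrightarrow> 0" if t: "t \<in> space unit_lborel" and e': "e' > 0" for t e'
      proof -
        have t': "0 < t" "t \<le> 1" using t by auto
        have "(\<lambda>n. real (nat \<lceil>t * real (j n)\<rceil>) / real (m n)) \<longlonglongrightarrow> t * \<tau>"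
        proof (rule real_tendsto_sandwich)
          show "(\<lambda>n. t * (real (j n) / real (m n))) \<longlonglongrightarrow> t * \<tau>" by (intro tendsto_intros j)
          have "(\<lambda>n. 1 / real (m n)) \<longlonglongrightarrow> 0"
            by (rule real_tendsto_divide_at_top[OF tendsto_const filterlim_compose[OF filterlim_real_sequentially m(1)]])
          then show "(\<lambda>n. t * (real (j n) / real (m n)) + 1 / real (m n)) \<longlonglongrightarrow> t * \<tau>"
            using tendsto_add[OF tendsto_mult_left[OF j, of t]] by fastforce
          show "eventually (\<lambda>n. t * (real (j n) / real (m n)) \<le> real (nat \<lceil>t * real (j n)\<rceil>) / real (m n)) sequentially"
            using eventually_ge_at_top[of n0]
          proof eventually_elim
            case (elim n)
            show ?case using divide_right_mono[OF nat_ceiling_bounds(3)[OF t' n0(1)[OF elim]], of "real (m n)"] by simp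
          qed
          show "eventually (\<lambda>n. real (nat \<lceil>t * real (j n)\<rceil>) / real (m n) \<le> t * (real (j n) / real (m n)) + 1 / real (m n)) sequentially"
            using eventually_ge_at_top[of n0]
          proof eventually_elim
            case (elim n)
            show ?case using divide_right_mono[OF less_imp_le[OF nat_ceiling_bounds(4)[OF t' n0(1)[OF elim]]], of "real (m n)"]
              by (simp add: add_divide_distrib)
          qed
        qed
        from order_stat_in_prob[OF m this _ e'] t' \<tau>
        have lim0: "(\<lambda>n. prob {\<omega> \<in> space M. Z n \<omega> t > e'}) \<longlonglongrightarrow> 0"
          by (simp add: Z_def f_def s_def mult.commute)
        show ?thesis
        proof (rule tendsto_sandwich[OF _ _ tendsto_const lim0])
          show "eventually (\<lambda>n. prob {\<omega> \<in> G n. Z n \<omega> t > e'} \<le> prob {\<omega> \<in> space M. Z n \<omega> t > e'}) sequentially"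
            using eventually_ge_at_top[of n0]
          proof eventually_elim
            case (elim n)
            have [measurable]: "(\<lambda>\<omega>. f n \<omega> (nat \<lceil>t * real (j n)\<rceil>)) \<in> borel_measurable M"
              using nat_ceiling_bounds[OF t' n0(1)[OF elim]] elim by (intro f_meas) auto
            show ?case unfolding Z_def
              by (intro finite_measure_mono) (auto simp: G_def)
          qed
        qed simp
      qed
      show "(\<integral>\<^sup>+\<omega>. ennreal (Z n \<omega> t powr p) * indicator (G n) \<omega> \<partial>M) \<le> ennreal (L t powr p)"
        if n: "n \<ge> n0" and t: "t \<in> space unit_lborel" for n t
      proof -
        have t': "0 < t" "t \<le> 1" using t by auto
        define i where "i = nat \<lceil>t * real (j n)\<rceil>"
        have i: "1 \<le> i" "i \<le> j n" "t * real (j n) \<le> real i"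
          using nat_ceiling_bounds[OF t' n0(1)[OF n]] by (auto simp: i_def)
        have i_n: "i \<le> n" using i(2) jn[OF n] by simp
        define V where "V \<omega> = max 0 ((desc_order_stat X n i \<omega> - U (s' n)) / \<alpha> (s' n))" for \<omega>
        have s'0: "s' n \<ge> s0" "\<alpha> (s' n) > 0" "\<alpha> (s n) > 0" using n0(6)[OF n] C by (auto simp: s'_def)
        note [measurable] = order_stat_measurable[OF i(1) i_n]
        have [measurable]: "V \<in> borel_measurable M" unfolding V_def by measurable
        have tg: "t powr (- g) \<ge> 1" using t' g powr_mono2'[of "- g" t 1] by simp
        have Z_le: "Z n \<omega> t \<le> D * t powr (- g) + R * V \<omega>" if \<omega>: "\<omega> \<in> G n" for \<omega>
        proof -
          have "U (real n / (2 * real (j n))) \<le> desc_order_stat X n i \<omega>"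
            using \<omega> desc_order_stat_antimono[OF i(1,2) jn[OF n], of X \<omega>] by (simp add: G_def)
          then have "(U (real n / (2 * real (j n))) - U (s n)) / \<alpha> (s n) \<le> f n \<omega> i"
            unfolding f_def using s'0 by (intro divide_right_mono) auto
          then have f1: "- B \<le> f n \<omega> i" using n0(8)[OF n] by simp
          have "U (s' n) \<le> U (s n)" using s'0(1) C(2) n0(6)[OF n] by (intro U_mono) (auto simp: s'_def)
          then have "f n \<omega> i \<le> (desc_order_stat X n i \<omega> - U (s' n)) / \<alpha> (s n)"
            unfolding f_def using s'0 by (intro divide_right_mono) auto
          also have "\<dots> = (desc_order_stat X n i \<omega> - U (s' n)) / \<alpha> (s' n) * (\<alpha> (s' n) / \<alpha> (s n))"
            using s'0 by simp
          also have "\<dots> \<le> V \<omega> * (\<alpha> (s' n) / \<alpha> (s n))"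
            using s'0 by (intro mult_right_mono) (auto simp: V_def)
          also have "\<dots> \<le> V \<omega> * R"
            using n0(7)[OF n] s'0 by (intro mult_left_mono) (auto simp: V_def field_simps)
          finally have f2: "f n \<omega> i \<le> R * V \<omega>" by (simp add: mult.commute)
          have "R * V \<omega> \<ge> 0" using R0 by (simp add: V_def)
          moreover have "B * 1 \<le> B * t powr (- g)" using tg by (intro mult_left_mono) (auto simp: B_def)
          moreover have "B \<ge> 0" by (simp add: B_def)
          ultimately have "\<bar>f n \<omega> i\<bar> \<le> B * t powr (- g) + R * V \<omega>"
            using f1 f2 by linarith
          then show ?thesis using H_abs[of t] t' by (simp add: Z_def i_def[symmetric] D_def distrib_right)
        qed
        have Z_powr: "ennreal (Z n \<omega> t powr p) * indicator (G n) \<omega>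
            \<le> ennreal (2 powr p * (D * t powr (- g)) powr p) + ennreal (2 powr p * R powr p) * ennreal (V \<omega> powr p)" for \<omega>
        proof (cases "\<omega> \<in> G n")
          case True
          have "Z n \<omega> t powr p \<le> (D * t powr (- g) + R * V \<omega>) powr p"
            using Z_le[OF True] p by (intro powr_mono2) (auto simp: Z_def)
          also have "\<dots> \<le> 2 powr p * ((D * t powr (- g)) powr p + (R * V \<omega>) powr p)"
            using D0 R0 p by (intro powr_add_le) (auto simp: V_def)
          also have "\<dots> = 2 powr p * (D * t powr (- g)) powr p + 2 powr p * R powr p * V \<omega> powr p"
            using R0 by (simp add: powr_mult V_def distrib_left mult.assoc)
          finally have "ennreal (Z n \<omega> t powr p)
              \<le> ennreal (2 powr p * (D * t powr (- g)) powr p + 2 powr p * R powr p * V \<omega> powr p)"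
            by (rule ennreal_leI)
          then show ?thesis using True by (simp add: ennreal_mult)
        qed simp
        have "(\<integral>\<^sup>+\<omega>. ennreal (Z n \<omega> t powr p) * indicator (G n) \<omega> \<partial>M)
            \<le> (\<integral>\<^sup>+\<omega>. ennreal (2 powr p * (D * t powr (- g)) powr p) + ennreal (2 powr p * R powr p) * ennreal (V \<omega> powr p) \<partial>M)"
          by (intro nn_integral_mono Z_powr)
        also have "\<dots> = ennreal (2 powr p * (D * t powr (- g)) powr p) + ennreal (2 powr p * R powr p) * (\<integral>\<^sup>+\<omega>. ennreal (V \<omega> powr p) \<partial>M)"
          by (simp add: nn_integral_add nn_integral_cmult emeasure_space_1)
        also have "(\<integral>\<^sup>+\<omega>. ennreal (V \<omega> powr p) \<partial>M) \<le> ennreal (C * (real n / (real i * s' n)) powr (p * g))"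
        proof -
          have "real i \<le> 2 * real (m n)" using i(2) n0(3)[OF n] by linarith
          then have "real i * real n \<le> 2 * real (m n) * real n" by (rule mult_right_mono) simp
          then have "real i * s' n \<le> real n"
            using n0(5)[OF n] by (simp add: s'_def s_def field_simps)
          then show ?thesis unfolding V_def by (intro C(4) s'0 i i_n)
        qed
        also have "(real n / (real i * s' n)) powr (p * g) \<le> (4 / \<tau>) powr (p * g) * t powr (- (p * g))"
        proof -
          have n_pos: "real n > 0" using n0(2)[OF n] by linarith
          have "real n / (real i * s' n) = 2 * real (m n) / real i"
            using n_pos n0(5)[OF n] by (simp add: s'_def s_def)
          also have "\<dots> \<le> 2 * real (m n) / (t * (\<tau> / 2 * real (m n)))"
          proof (rule divide_left_mono)
            have "t * (\<tau> / 2 * real (m n)) \<le> t * real (j n)" using n0(4)[OF n] t' by (intro mult_left_mono) auto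
            then show "t * (\<tau> / 2 * real (m n)) \<le> real i" using i(3) by linarith
            show "0 < real i * (t * (\<tau> / 2 * real (m n)))" using i(1) t' \<tau> n0(5)[OF n] by auto
          qed simp
          also have "\<dots> = 4 / \<tau> * (1 / t)" using n0(5)[OF n] t' \<tau> by (simp add: field_simps)
          finally have "(real n / (real i * s' n)) powr (p * g) \<le> (4 / \<tau> * (1 / t)) powr (p * g)"
            using p g s'0(1) C(2) by (intro powr_mono2) auto
          also have "\<dots> = (4 / \<tau>) powr (p * g) * t powr (- (p * g))"
            using \<tau> t' by (simp add: powr_mult powr_divide powr_minus_divide)
          finally show ?thesis .
        qed
        also have "ennreal (2 powr p * (D * t powr (- g)) powr p) + ennreal (2 powr p * R powr p) *
            ennreal (C * ((4 / \<tau>) powr (p * g) * t powr (- (p * g)))) = ennreal (L t powr p)"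
        proof -
          have "L t powr p = K0 * t powr (- (p * g))"
            using K0 p t' by (simp add: L_def powr_mult powr_powr mult.commute)
          moreover have "(D * t powr (- g)) powr p = D powr p * t powr (- (p * g))"
            using D0 by (simp add: powr_mult powr_powr mult.commute)
          ultimately show ?thesis
            using C(1) by (simp add: ennreal_mult[symmetric] K0_def algebra_simps flip: ennreal_plus)
        qed
        finally show ?thesis using C(1) by (simp add: mult_left_mono add_left_mono ennreal_leI)
      qed
    qed (use p e G_ev Z_meas in \<open>auto simp: Z_def\<close>)
  qed
  let ?\<psi> = "\<integral>t. H (1 / (\<tau> * t)) \<partial>unit_lborel"
  let ?W = "\<lambda>n \<omega>. (cvar_order_stat X n (j n) \<omega> - U (s n)) / \<alpha> (s n)"
  have W_le: "ennreal \<bar>?W n \<omega> - ?\<psi>\<bar> \<le> (\<integral>\<^sup>+t. ennreal (Z n \<omega> t) \<partial>unit_lborel)" if n: "n \<ge> n0" for n \<omega>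
  proof -
    have j0: "real (j n) > 0" using n0(1)[OF n] by simp
    have "(\<Sum>i = 1..j n. f n \<omega> i) / real (j n) = ?W n \<omega>"
      using j0 by (simp add: f_def cvar_order_stat_def sum_divide_distrib[symmetric] sum_subtractf field_simps)
    then have eq: "?W n \<omega> = (\<integral>t. f n \<omega> (nat \<lceil>t * real (j n)\<rceil>) \<partial>unit_lborel)"
      using integral_step(2)[OF n0(1)[OF n], of "f n \<omega>"] by simp
    note int = integral_step(1)[OF n0(1)[OF n], of "f n \<omega>"] H_int
    have "?W n \<omega> - ?\<psi> = (\<integral>t. f n \<omega> (nat \<lceil>t * real (j n)\<rceil>) - H (1 / (\<tau> * t)) \<partial>unit_lborel)"
      unfolding eq using int by simp
    also have "\<bar>\<dots>\<bar> \<le> (\<integral>t. Z n \<omega> t \<partial>unit_lborel)"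
      using integral_norm_bound[of unit_lborel "\<lambda>t. f n \<omega> (nat \<lceil>t * real (j n)\<rceil>) - H (1 / (\<tau> * t))"]
      by (simp add: Z_def)
    finally have "ennreal \<bar>?W n \<omega> - ?\<psi>\<bar> \<le> ennreal (\<integral>t. Z n \<omega> t \<partial>unit_lborel)" by (rule ennreal_leI)
    also have "\<dots> = (\<integral>\<^sup>+t. ennreal (Z n \<omega> t) \<partial>unit_lborel)"
      using int unfolding Z_def by (intro nn_integral_eq_integral[symmetric]) auto
    finally show ?thesis .
  qed
  have lim0: "(\<lambda>n. 2 / real (j n) + prob {\<omega> \<in> G n. ennreal e \<le> (\<integral>\<^sup>+t. ennreal (Z n \<omega> t) \<partial>unit_lborel)}) \<longlonglongrightarrow> 0"
  proof -
    have "filterlim (\<lambda>n. \<tau> / 2 * real (m n)) at_top sequentially"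
      using \<tau> by (intro filterlim_tendsto_pos_mult_at_top[OF tendsto_const _ filterlim_compose[OF filterlim_real_sequentially m(1)]]) auto
    moreover have "eventually (\<lambda>n. \<tau> / 2 * real (m n) \<le> real (j n)) sequentially"
      using eventually_ge_at_top[of n0] by eventually_elim (rule n0(4))
    ultimately have j_inf: "filterlim (\<lambda>n. real (j n)) at_top sequentially"
      by (rule filterlim_at_top_mono)
    show ?thesis
      using tendsto_add[OF real_tendsto_divide_at_top[OF tendsto_const j_inf] main] by simp
  qed
  have "(\<lambda>n. prob {\<omega> \<in> space M. \<bar>?W n \<omega> - ?\<psi>\<bar> > e}) \<longlonglongrightarrow> 0"
  proof (rule tendsto_sandwich[OF _ _ tendsto_const lim0])
    show "eventually (\<lambda>n. prob {\<omega> \<in> space M. \<bar>?W n \<omega> - ?\<psi>\<bar> > e}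
        \<le> 2 / real (j n) + prob {\<omega> \<in> G n. ennreal e \<le> (\<integral>\<^sup>+t. ennreal (Z n \<omega> t) \<partial>unit_lborel)}) sequentially"
      using eventually_ge_at_top[of n0]
    proof eventually_elim
      case (elim n)
      interpret L: finite_measure unit_lborel by (rule finite_measure_unit_lborel)
      have [measurable]: "(\<lambda>\<omega>. \<integral>\<^sup>+t. ennreal (Z n \<omega> t) \<partial>unit_lborel) \<in> borel_measurable M"
      proof -
        note [measurable] = Z_meas[OF elim]
        show ?thesis by measurable
      qed
      note [measurable] = G_ev[OF elim]
      have ev: "{\<omega> \<in> G n. ennreal e \<le> (\<integral>\<^sup>+t. ennreal (Z n \<omega> t) \<partial>unit_lborel)} \<in> events"
      proof -
        have "{\<omega> \<in> G n. ennreal e \<le> (\<integral>\<^sup>+t. ennreal (Z n \<omega> t) \<partial>unit_lborel)}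
          = G n \<inter> {\<omega> \<in> space M. ennreal e \<le> (\<integral>\<^sup>+t. ennreal (Z n \<omega> t) \<partial>unit_lborel)}" by (auto simp: G_def)
        then show ?thesis by simp
      qed
      have "prob {\<omega> \<in> space M. \<bar>?W n \<omega> - ?\<psi>\<bar> > e}
        \<le> prob ((space M - G n) \<union> {\<omega> \<in> G n. ennreal e \<le> (\<integral>\<^sup>+t. ennreal (Z n \<omega> t) \<partial>unit_lborel)})"
      proof (rule finite_measure_mono)
        show "{\<omega> \<in> space M. \<bar>?W n \<omega> - ?\<psi>\<bar> > e}
          \<subseteq> (space M - G n) \<union> {\<omega> \<in> G n. ennreal e \<le> (\<integral>\<^sup>+t. ennreal (Z n \<omega> t) \<partial>unit_lborel)}"
        proof (intro subsetI)
          fix \<omega> assume \<omega>: "\<omega> \<in> {\<omega> \<in> space M. \<bar>?W n \<omega> - ?\<psi>\<bar> > e}"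
          then have "ennreal e \<le> ennreal \<bar>?W n \<omega> - ?\<psi>\<bar>" by (intro ennreal_leI) simp
          from order_trans[OF this W_le[OF elim]] \<omega>
          show "\<omega> \<in> (space M - G n) \<union> {\<omega> \<in> G n. ennreal e \<le> (\<integral>\<^sup>+t. ennreal (Z n \<omega> t) \<partial>unit_lborel)}"
            by auto
        qed
      qed (use ev in auto)
      also have "\<dots> \<le> prob (space M - G n) + prob {\<omega> \<in> G n. ennreal e \<le> (\<integral>\<^sup>+t. ennreal (Z n \<omega> t) \<partial>unit_lborel)}"
        using ev by (intro measure_Un_le) auto
      finally show ?case using G_prob[OF elim] by simp
    qed
  qed simp
  then show "(\<lambda>n. prob {\<omega> \<in> space M. \<bar>(cvar_order_stat X n (j n) \<omega> - U (real n / real (m n))) / \<alpha> (real n / real (m n))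
      - ?\<psi>\<bar> > e}) \<longlonglongrightarrow> 0"
    unfolding s_def .
qed

end

section \<open>Gaps of CVaR order statistics\<close>

context iid_extremes
begin

text \<open>Indexed by the integer \<open>k\<close>, because the integrand of the estimator depends
  on \<open>t\<close> only through the ceiling of \<open>t * m\<close>.\<close>

definition cvar_gap :: "real \<Rightarrow> nat \<Rightarrow> nat \<Rightarrow> 'a \<Rightarrow> real" where
  "cvar_gap c n k \<omega> = cvar_order_stat X n (nat \<lfloor>c * real k\<rfloor> + 1) \<omega> - cvar_order_stat X n (k + 1) \<omega>"

lemma cvar_gap_measurable [measurable]:
  assumes "0 < c" "c < 1" "1 \<le> k" "k < n"
  shows "cvar_gap c n k \<in> borel_measurable M"
  unfolding cvar_gap_def[abs_def] using nat_floor_bounds[OF assms(1-3) refl] assms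
  by (intro borel_measurable_diff borel_measurable_cvar_order_stat) auto

lemma cvar_gap_ge:
  assumes "0 < c" "c < 1" "1 \<le> k" "k < n" "1 \<le> i" "i \<le> j" and j: "j = nat \<lfloor>c * real k\<rfloor> + 1"
  shows "cvar_gap c n k \<omega>
    \<ge> (1 - c) / 2 * (real i / real j * (desc_order_stat X n i \<omega> - desc_order_stat X n (j + 1) \<omega>))"
  using avg_diff_lower_bound[of n "\<lambda>i. desc_order_stat X n i \<omega>" c k i j, OF desc_order_stat_antimono] assms
  by (simp add: cvar_gap_def cvar_order_stat_def)

lemma cvar_gap_le:
  assumes "0 < c" "c < 1" "1 \<le> k" "k \<le> m" "m < n" "u \<le> desc_order_stat X n (m + 1) \<omega>"
  shows "cvar_gap c n k \<omega> \<le> real m / (c * real k) * (cvar_order_stat X n m \<omega> - u)"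
proof -
  define j where "j = nat \<lfloor>c * real k\<rfloor> + 1"
  note j = nat_floor_bounds[OF assms(1-3) j_def]
  have anti: "desc_order_stat X n k \<omega> \<le> desc_order_stat X n i \<omega>" if "1 \<le> i" "i \<le> k" "k \<le> n" for i k
    using that by (rule desc_order_stat_antimono)
  have "cvar_gap c n k \<omega> \<le> real m / real j * (cvar_order_stat X n m \<omega> - u)"
    unfolding cvar_gap_def cvar_order_stat_def j_def[symmetric] using assms j
    by (intro avg_diff_upper_bound[of n "\<lambda>i. desc_order_stat X n i \<omega>"] anti) auto
  also have "\<dots> \<le> real m / (c * real k) * (cvar_order_stat X n m \<omega> - u)"
  proof (rule mult_right_mono)
    show "real m / real j \<le> real m / (c * real k)"
      using j assms by (intro divide_left_mono mult_pos_pos) auto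
    have "real m * u = (\<Sum>i = 1..m. u)" by simp
    also have "\<dots> \<le> (\<Sum>i = 1..m. desc_order_stat X n i \<omega>)"
      using assms by (intro sum_mono order_trans[OF assms(6) anti]) auto
    finally show "0 \<le> cvar_order_stat X n m \<omega> - u"
      using assms by (simp add: cvar_order_stat_def field_simps)
  qed
  finally show ?thesis .
qed

text \<open>For \<open>i\<close> about \<open>j / 16\<close>, two Chebyshev bounds place
  \<open>X_i\<close> above \<open>U (n / (2 * i))\<close> and \<open>X_(j+1)\<close> below
  \<open>U s'\<close> with \<open>s' = 2 * n / (j + 1)\<close>. Since
  \<open>n / (2 * i) \<ge> 2 * s'\<close>, their difference is at least \<open>\<alpha> s'\<close>,
  which is comparable to \<open>\<alpha> (n / k)\<close>, and \<open>cvar_gap_ge\<close> passes this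
  on to the averages.\<close>

lemma cvar_gap_lower_prob:
  assumes c: "0 < c" "c < 1"
  obtains c0 s0 where "c0 > 0" "s0 > 1"
    "\<And>n k. 1 \<le> k \<Longrightarrow> k < n \<Longrightarrow> real n / real k \<ge> s0 \<Longrightarrow>
      prob {\<omega> \<in> space M. cvar_gap c n k \<omega> < c0 * \<alpha> (real n / real k)} \<le> 36 / (c * real k)"
proof -
  obtain c1 \<kappa> s1 where a: "c1 > 0" "\<kappa> > 0" "s1 > 1"
    "\<And>s x. s \<ge> s1 \<Longrightarrow> x \<ge> 1 \<Longrightarrow> \<alpha> (s * x) \<ge> c1 * x powr (- \<kappa>) * \<alpha> s"
    using \<alpha>_lower_bound by blast
  obtain s2 where s2: "\<And>s. s \<ge> s2 \<Longrightarrow> \<alpha> s > 0"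
    using eventually_\<alpha>_pos by (auto simp: eventually_at_top_linorder)
  define c2 where "c2 = c1 * (2 / c) powr (- \<kappa>)"
  have c2: "c2 > 0" using a c by (simp add: c2_def)
  define c0 where "c0 = (1 - c) / 2 * (1 / 16 * c2)"
  show ?thesis
  proof
    show "c0 > 0" using c c2 by (simp add: c0_def)
    show "max s1 s2 > 1" using a(3) by simp
    fix n k :: nat
    assume k: "1 \<le> k" "k < n" and nk: "max s1 s2 \<le> real n / real k"
    define j where "j = nat \<lfloor>c * real k\<rfloor> + 1"
    note j = nat_floor_bounds[OF c k(1) j_def]
    show "prob {\<omega> \<in> space M. cvar_gap c n k \<omega> < c0 * \<alpha> (real n / real k)} \<le> 36 / (c * real k)"
    \<comment> \<open>For small \<open>j\<close> the claimed bound is at least 1 and there is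
      nothing to prove.\<close>
    proof (cases "j < 13")
      case True
      then have "c * real k \<le> 36" using j(3) by simp
      then have "1 \<le> 36 / (c * real k)" using c k by (simp add: le_divide_eq_1)
      then show ?thesis using prob_le_1 order_trans by blast
    next
      case False
      \<comment> \<open>\<open>j / 16\<close> rounded up: \<open>8 * i \<le> j + 1\<close> separates
        the two quantile levels by a factor of two, while \<open>j \<le> 16 * i\<close> keeps the
        loss \<open>i / j\<close> above 1 / 16.\<close>
      define i where "i = (j + 15) div 16"
      have i: "1 \<le> i" "i \<le> j" "8 * i \<le> j + 1" "j \<le> 16 * i"
        using False unfolding i_def by linarith+
      have n0: "real n > 0" using k by simp
      define s where "s = real n / real k"
      define s' where "s' = s * (2 * real k / real (j + 1))"
      have s: "s \<ge> s1" "s \<ge> s2" "s > 1" "\<alpha> s > 0" using nk a(3) s2 by (auto simp: s_def)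
      have x: "2 * real k / real (j + 1) \<ge> 1" "2 * real k / real (j + 1) \<le> 2 / c"
      proof -
        show "2 * real k / real (j + 1) \<ge> 1" using j k by simp
        have "c * real k \<le> real (j + 1)" using j(3) by simp
        then show "2 * real k / real (j + 1) \<le> 2 / c" using c by (simp add: field_simps)
      qed
      \<comment> \<open>The levels \<open>s\<close> and \<open>s'\<close> differ by a factor in
        \<open>[1, 2 / c]\<close>, so the lower bound on \<open>\<alpha>\<close> compares them with
        a constant that depends on \<open>c\<close> alone.\<close>
      have "c2 * \<alpha> s \<le> c1 * (2 * real k / real (j + 1)) powr (- \<kappa>) * \<alpha> s"
        unfolding c2_def using x a s c
        by (intro mult_right_mono mult_left_mono powr_mono2') auto
      also have "\<dots> \<le> \<alpha> s'" unfolding s'_def by (rule a(4)[OF s(1) x(1)])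
      finally have \<alpha>': "c2 * \<alpha> s \<le> \<alpha> s'" .
      have s'_eq: "s' = real n / (1 / 2 * real (j + 1))" using k by (simp add: s'_def s_def field_simps)
      have s'1: "s' > 1" unfolding s'_def using s x by (intro one_less_mult_ge_1) auto
      have ni: "real n / (2 * real i) \<ge> s' * 2"
      proof -
        have "8 * real i \<le> real (j + 1)" using i(3) by linarith
        then have "real n / real (j + 1) \<le> real n / (8 * real i)"
          using i(1) by (intro divide_left_mono mult_pos_pos) auto
        then show ?thesis by (simp add: s'_eq)
      qed
      let ?Xi = "desc_order_stat X n i" and ?Xj = "desc_order_stat X n (j + 1)"
      have [measurable]: "?Xi \<in> borel_measurable M" "?Xj \<in> borel_measurable M"
        using i j k by (auto intro!: order_stat_measurable)
      have "{\<omega> \<in> space M. cvar_gap c n k \<omega> < c0 * \<alpha> s}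
        \<subseteq> {\<omega> \<in> space M. ?Xi \<omega> < U (real n / (2 * real i))} \<union> {\<omega> \<in> space M. U s' < ?Xj \<omega>}"
      proof (safe, rule ccontr)
        fix \<omega> assume *: "cvar_gap c n k \<omega> < c0 * \<alpha> s" "\<not> U s' < ?Xj \<omega>" "\<not> ?Xi \<omega> < U (real n / (2 * real i))"
        have "U (s' * 2) \<le> U (real n / (2 * real i))" using s'1 ni by (intro U_mono) auto
        then have "c2 * \<alpha> s \<le> ?Xi \<omega> - ?Xj \<omega>" using * \<alpha>' by (simp add: \<alpha>_def)
        moreover have "1 / 16 \<le> real i / real j" using i j by (simp add: field_simps)
        ultimately have "1 / 16 * (c2 * \<alpha> s) \<le> real i / real j * (?Xi \<omega> - ?Xj \<omega>)"
          using c2 s by (intro mult_mono) auto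
        then have "(1 - c) / 2 * (1 / 16 * (c2 * \<alpha> s)) \<le> (1 - c) / 2 * (real i / real j * (?Xi \<omega> - ?Xj \<omega>))"
          using c by (intro mult_left_mono) auto
        also have "\<dots> \<le> cvar_gap c n k \<omega>" using c k i j by (intro cvar_gap_ge j_def) auto
        finally show False using *(1) by (simp add: c0_def mult.assoc)
      qed
      then have "prob {\<omega> \<in> space M. cvar_gap c n k \<omega> < c0 * \<alpha> s}
        \<le> prob ({\<omega> \<in> space M. ?Xi \<omega> < U (real n / (2 * real i))} \<union> {\<omega> \<in> space M. U s' < ?Xj \<omega>})"
        by (rule finite_measure_mono) measurable
      also have "\<dots> \<le> prob {\<omega> \<in> space M. ?Xi \<omega> < U (real n / (2 * real i))} + prob {\<omega> \<in> space M. U s' < ?Xj \<omega>}"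
        by (rule measure_Un_le) measurable
      also have "\<dots> \<le> (1 + 1) / (1\<^sup>2 * real i) + 1 / ((1 / 2)\<^sup>2 * real (j + 1))"
        using i j k s'1 ni n0 by (intro add_mono order_stat_lower order_stat_upper) (auto simp: s'_eq)
      also have "\<dots> = 2 / real i + 4 / real (j + 1)" by (simp add: power2_eq_square)
      also have "\<dots> \<le> 32 / real j + 4 / real j"
      proof (rule add_mono)
        have "real j \<le> 16 * real i" using i(4) by linarith
        then show "2 / real i \<le> 32 / real j" using i j by (simp add: field_simps)
        show "4 / real (j + 1) \<le> 4 / real j" using j by (intro divide_left_mono) auto
      qed
      also have "\<dots> = 36 / real j" by simp
      also have "\<dots> \<le> 36 / (c * real k)"
        using j c k by (intro divide_left_mono mult_pos_pos) auto
      finally show ?thesis by (simp add: s_def)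
    qed
  qed
qed

text \<open>Both averages are centred at the same \<open>U (n / m)\<close>, so the centring cancels.
  The limits differ by the integral of \<open>H (1 / (c * t * u)) - H (1 / (t * u)) = (t * u) powr
  (- \<gamma>) * H (1 / c)\<close> over \<open>u\<close>, and \<open>u powr (- \<gamma>)\<close>
  integrates to \<open>1 / (1 - \<gamma>)\<close>.\<close>

lemma cvar_gap_in_prob:
  fixes m :: "nat \<Rightarrow> nat"
  assumes \<gamma>: "\<gamma> < 1" and c: "0 < c" "c < 1"
    and m: "filterlim m at_top sequentially" "(\<lambda>n. real (m n) / real n) \<longlonglongrightarrow> 0"
    and t: "0 < t" "t \<le> 1" and e: "e > 0"
  shows "(\<lambda>n. prob {\<omega> \<in> space M. \<bar>cvar_gap c n (nat \<lceil>t * real (m n)\<rceil>) \<omega> / \<alpha> (real n / real (m n))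
      - t powr (- \<gamma>) * (H (1 / c) / (1 - \<gamma>))\<bar> > e}) \<longlonglongrightarrow> 0"
proof -
  define k where "k n = nat \<lceil>t * real (m n)\<rceil>" for n
  define j where "j n = nat \<lfloor>c * real (k n)\<rfloor> + 1" for n
  define s where "s n = real n / real (m n)" for n
  have m_inv: "(\<lambda>n. 1 / real (m n)) \<longlonglongrightarrow> 0"
    by (rule real_tendsto_divide_at_top[OF tendsto_const filterlim_compose[OF filterlim_real_sequentially m(1)]])
  have m_pos: "eventually (\<lambda>n. 1 \<le> m n) sequentially"
    by (rule eventually_compose_filterlim[OF eventually_ge_at_top m(1)])
  have k_lim: "(\<lambda>n. real (k n) / real (m n)) \<longlonglongrightarrow> t"
  proof (rule real_tendsto_sandwich[OF _ _ tendsto_const])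
    show "(\<lambda>n. t + 1 / real (m n)) \<longlonglongrightarrow> t" using tendsto_add[OF tendsto_const m_inv, of t] by simp
    show "eventually (\<lambda>n. t \<le> real (k n) / real (m n)) sequentially"
      using m_pos
    proof eventually_elim
      case (elim n)
      show ?case using nat_ceiling_bounds(3)[OF t elim] elim by (simp add: k_def field_simps)
    qed
    show "eventually (\<lambda>n. real (k n) / real (m n) \<le> t + 1 / real (m n)) sequentially"
      using m_pos
    proof eventually_elim
      case (elim n)
      show ?case using nat_ceiling_bounds(4)[OF t elim] elim by (simp add: k_def field_simps)
    qed
  qed
  have k1_lim: "(\<lambda>n. real (k n + 1) / real (m n)) \<longlonglongrightarrow> t"
    using tendsto_add[OF m_inv k_lim] by (simp add: add_divide_distrib)
  have ck_lim: "(\<lambda>n. c * (real (k n) / real (m n))) \<longlonglongrightarrow> c * t" by (intro tendsto_intros k_lim)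
  have j_lim: "(\<lambda>n. real (j n) / real (m n)) \<longlonglongrightarrow> c * t"
  proof (rule real_tendsto_sandwich[OF _ _ ck_lim])
    show "(\<lambda>n. c * (real (k n) / real (m n)) + 1 / real (m n)) \<longlonglongrightarrow> c * t"
      using tendsto_add[OF ck_lim m_inv] by simp
    show "eventually (\<lambda>n. c * (real (k n) / real (m n)) \<le> real (j n) / real (m n)) sequentially"
      using m_pos
    proof eventually_elim
      case (elim n)
      have "1 \<le> k n" using nat_ceiling_bounds(1)[OF t elim] by (simp add: k_def)
      from divide_right_mono[OF less_imp_le[OF nat_floor_bounds(3)[OF c this refl]], of "real (m n)"]
      show ?case by (simp add: j_def)
    qed
    show "eventually (\<lambda>n. real (j n) / real (m n) \<le> c * (real (k n) / real (m n)) + 1 / real (m n)) sequentially"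
      using m_pos
    proof eventually_elim
      case (elim n)
      have "1 \<le> k n" using nat_ceiling_bounds(1)[OF t elim] by (simp add: k_def)
      from divide_right_mono[OF nat_floor_bounds(4)[OF c this refl], of "real (m n)"]
      show ?case by (simp add: j_def add_divide_distrib)
    qed
  qed
  have ct: "0 < c * t" "c * t \<le> 1" using c t by (auto intro!: mult_le_one)
  let ?\<psi> = "\<lambda>\<tau>. \<integral>u. H (1 / (\<tau> * u)) \<partial>unit_lborel"
  have "?\<psi> (c * t) - ?\<psi> t = (\<integral>u. H (1 / (c * t * u)) - H (1 / (t * u)) \<partial>unit_lborel)"
    using cvar_order_stat_in_prob(2)[OF \<gamma> m j_lim ct e] cvar_order_stat_in_prob(2)[OF \<gamma> m k1_lim t e]
    by simp
  also have "\<dots> = (\<integral>u. t powr (- \<gamma>) * H (1 / c) * u powr (- \<gamma>) \<partial>unit_lborel)"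
  proof (intro Bochner_Integration.integral_cong refl)
    fix u assume "u \<in> space unit_lborel"
    then have u: "u > 0" by simp
    have "H (1 / (c * t * u)) = H (1 / (t * u) * (1 / c))" by (simp add: field_simps)
    also have "\<dots> = H (1 / (t * u)) + (1 / (t * u)) powr \<gamma> * H (1 / c)"
      using c t u by (intro H_mult) auto
    also have "(1 / (t * u)) powr \<gamma> = t powr (- \<gamma>) * u powr (- \<gamma>)"
      using t u by (simp add: powr_divide powr_mult powr_minus_divide)
    finally show "H (1 / (c * t * u)) - H (1 / (t * u)) = t powr (- \<gamma>) * H (1 / c) * u powr (- \<gamma>)"
      by (simp add: mult_ac)
  qed
  also have "\<dots> = t powr (- \<gamma>) * (H (1 / c) / (1 - \<gamma>))"
    using integral_unit_lborel_powr[OF \<gamma>] by simp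
  finally have \<psi>: "?\<psi> (c * t) - ?\<psi> t = t powr (- \<gamma>) * (H (1 / c) / (1 - \<gamma>))" .
  have e2: "e / 2 > 0" using e by simp
  let ?W = "\<lambda>n i \<tau> \<omega>. (cvar_order_stat X n i \<omega> - U (s n)) / \<alpha> (s n) - ?\<psi> \<tau>"
  have lim0: "(\<lambda>n. prob {\<omega> \<in> space M. \<bar>?W n (j n) (c * t) \<omega>\<bar> > e / 2}
      + prob {\<omega> \<in> space M. \<bar>?W n (k n + 1) t \<omega>\<bar> > e / 2}) \<longlonglongrightarrow> 0"
    using tendsto_add[OF cvar_order_stat_in_prob(1)[OF \<gamma> m j_lim ct e2] cvar_order_stat_in_prob(1)[OF \<gamma> m k1_lim t e2]]
    by (simp add: s_def)
  have ev: "eventually (\<lambda>n. 1 \<le> k n \<and> k n < n) sequentially"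
    using m_pos order_tendstoD(2)[OF m(2) zero_less_one] eventually_gt_at_top[of 0]
  proof eventually_elim
    case (elim n)
    have "m n < n" using elim by simp
    then show ?case using nat_ceiling_bounds(1,2)[OF t elim(1)] unfolding k_def by linarith
  qed
  have "(\<lambda>n. prob {\<omega> \<in> space M. \<bar>cvar_gap c n (k n) \<omega> / \<alpha> (s n)
      - t powr (- \<gamma>) * (H (1 / c) / (1 - \<gamma>))\<bar> > e}) \<longlonglongrightarrow> 0"
  proof (rule tendsto_sandwich[OF _ _ tendsto_const lim0])
    show "eventually (\<lambda>n. prob {\<omega> \<in> space M. \<bar>cvar_gap c n (k n) \<omega> / \<alpha> (s n)
        - t powr (- \<gamma>) * (H (1 / c) / (1 - \<gamma>))\<bar> > e}
      \<le> prob {\<omega> \<in> space M. \<bar>?W n (j n) (c * t) \<omega>\<bar> > e / 2}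
      + prob {\<omega> \<in> space M. \<bar>?W n (k n + 1) t \<omega>\<bar> > e / 2}) sequentially"
      using ev
    proof eventually_elim
      case (elim n)
      have "j n \<le> k n" using nat_floor_bounds(2)[OF c _ refl, of "k n"] elim by (simp add: j_def)
      then have [measurable]: "cvar_order_stat X n (j n) \<in> borel_measurable M"
        "cvar_order_stat X n (k n + 1) \<in> borel_measurable M"
        using elim by (auto intro!: borel_measurable_cvar_order_stat)
      have "{\<omega> \<in> space M. \<bar>cvar_gap c n (k n) \<omega> / \<alpha> (s n) - t powr (- \<gamma>) * (H (1 / c) / (1 - \<gamma>))\<bar> > e}
        \<subseteq> {\<omega> \<in> space M. \<bar>?W n (j n) (c * t) \<omega>\<bar> > e / 2} \<union> {\<omega> \<in> space M. \<bar>?W n (k n + 1) t \<omega>\<bar> > e / 2}"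
      proof (safe, rule ccontr)
        fix \<omega> assume *: "\<bar>cvar_gap c n (k n) \<omega> / \<alpha> (s n) - t powr (- \<gamma>) * (H (1 / c) / (1 - \<gamma>))\<bar> > e"
          "\<not> \<bar>?W n (k n + 1) t \<omega>\<bar> > e / 2" "\<not> \<bar>?W n (j n) (c * t) \<omega>\<bar> > e / 2"
        have "cvar_gap c n (k n) \<omega> / \<alpha> (s n) - t powr (- \<gamma>) * (H (1 / c) / (1 - \<gamma>))
          = ?W n (j n) (c * t) \<omega> - ?W n (k n + 1) t \<omega>"
          unfolding \<psi>[symmetric] by (simp add: cvar_gap_def j_def diff_divide_distrib)
        then show False using * by linarith
      qed
      then have "prob {\<omega> \<in> space M. \<bar>cvar_gap c n (k n) \<omega> / \<alpha> (s n) - t powr (- \<gamma>) * (H (1 / c) / (1 - \<gamma>))\<bar> > e}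
        \<le> prob ({\<omega> \<in> space M. \<bar>?W n (j n) (c * t) \<omega>\<bar> > e / 2} \<union> {\<omega> \<in> space M. \<bar>?W n (k n + 1) t \<omega>\<bar> > e / 2})"
        by (rule finite_measure_mono) measurable
      also have "\<dots> \<le> prob {\<omega> \<in> space M. \<bar>?W n (j n) (c * t) \<omega>\<bar> > e / 2}
        + prob {\<omega> \<in> space M. \<bar>?W n (k n + 1) t \<omega>\<bar> > e / 2}"
        by (rule measure_Un_le) measurable
      finally show ?case .
    qed
  qed simp
  then show ?thesis unfolding k_def s_def .
qed

text \<open>The first-moment bound for each order statistic is summed; the average of
  \<open>(m / i) powr g\<close> is dominated by the integral of \<open>t powr (- g)\<close>. The
  level \<open>n / (4 * m)\<close> is low enough that the order statistic of index
  \<open>m + 1\<close> lies above it with high probability.\<close>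

lemma mean_excess_bound:
  assumes \<gamma>: "\<gamma> < 1"
  obtains C s0 where "C > 0" "s0 > 1" "\<And>s. s \<ge> s0 \<Longrightarrow> \<alpha> s > 0"
    "\<And>n m s. s = real n / (4 * real m) \<Longrightarrow> s \<ge> s0 \<Longrightarrow> 1 \<le> m \<Longrightarrow> m \<le> n \<Longrightarrow>
      (\<integral>\<^sup>+\<omega>. ennreal ((\<Sum>i = 1..m. max 0 ((desc_order_stat X n i \<omega> - U s) / \<alpha> s)) / real m) \<partial>M) \<le> ennreal C"
proof -
  define g where "g = (max 0 \<gamma> + 1) / 2"
  have g: "\<gamma> < g" "0 < g" "g < 1" using \<gamma> by (auto simp: g_def)
  have g1: "1 * g < 1" using g by simp
  obtain C s0 where C: "C > 0" "s0 > 1" "\<And>s. s \<ge> s0 \<Longrightarrow> \<alpha> s > 0"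
    "\<And>s n i. s \<ge> s0 \<Longrightarrow> 1 \<le> i \<Longrightarrow> i \<le> n \<Longrightarrow> real i * s \<le> real n \<Longrightarrow>
      (\<integral>\<^sup>+\<omega>. ennreal (max 0 ((desc_order_stat X n i \<omega> - U s) / \<alpha> s) powr 1) \<partial>M)
        \<le> ennreal (C * (real n / (real i * s)) powr (1 * g))"
    using order_stat_moment[OF g(1,2) zero_less_one g1] by blast
  show ?thesis
  proof
    show "C * 4 powr g * (1 / (1 - g)) > 0" using C g by simp
    fix n m :: nat and s :: real
    assume s: "s = real n / (4 * real m)" "s \<ge> s0" and m: "1 \<le> m" "m \<le> n"
    let ?V = "\<lambda>i \<omega>. max 0 ((desc_order_stat X n i \<omega> - U s) / \<alpha> s)"
    have V_meas: "?V i \<in> borel_measurable M" if "i \<in> {1..m}" for i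
    proof -
      have [measurable]: "desc_order_stat X n i \<in> borel_measurable M" using that m by auto
      show ?thesis by measurable
    qed
    have V_le: "(\<integral>\<^sup>+\<omega>. ennreal (?V i \<omega>) \<partial>M) \<le> ennreal (C * 4 powr g * (real m / real i) powr g)"
      if i: "i \<in> {1..m}" for i
    proof -
      have n: "real n > 0" using m by simp
      have "real i * s \<le> 4 * real m * s" using i s(2) C(2) by (intro mult_right_mono) auto
      also have "\<dots> = real n" using m by (simp add: s(1))
      finally have "real i * s \<le> real n" .
      from C(4)[OF s(2) _ _ this] i m
      have "(\<integral>\<^sup>+\<omega>. ennreal (?V i \<omega>) \<partial>M) \<le> ennreal (C * (real n / (real i * s)) powr g)" by simp
      also have "real n / (real i * s) = 4 * (real m / real i)" using n m by (simp add: s(1))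
      also have "(4 * (real m / real i)) powr g = 4 powr g * (real m / real i) powr g"
        by (rule powr_mult)
      finally show ?thesis by (simp only: mult.assoc)
    qed
    have "(\<integral>\<^sup>+\<omega>. ennreal ((\<Sum>i = 1..m. ?V i \<omega>) / real m) \<partial>M)
        = (\<integral>\<^sup>+\<omega>. ennreal (1 / real m) * (\<Sum>i = 1..m. ennreal (?V i \<omega>)) \<partial>M)"
    proof (intro nn_integral_cong)
      fix \<omega>
      have "(\<Sum>i = 1..m. ennreal (?V i \<omega>)) = ennreal (\<Sum>i = 1..m. ?V i \<omega>)"
        by (rule sum_ennreal) simp
      moreover have "ennreal (1 / real m * (\<Sum>i = 1..m. ?V i \<omega>)) = ennreal (1 / real m) * ennreal (\<Sum>i = 1..m. ?V i \<omega>)"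
        by (rule ennreal_mult) (auto intro!: sum_nonneg)
      ultimately show "ennreal ((\<Sum>i = 1..m. ?V i \<omega>) / real m) = ennreal (1 / real m) * (\<Sum>i = 1..m. ennreal (?V i \<omega>))"
        by (simp only: times_divide_eq_left mult_1_left)
    qed
    also have "\<dots> = ennreal (1 / real m) * (\<integral>\<^sup>+\<omega>. (\<Sum>i = 1..m. ennreal (?V i \<omega>)) \<partial>M)"
      by (intro nn_integral_cmult borel_measurable_sum measurable_compose[OF V_meas measurable_ennreal])
    also have "(\<integral>\<^sup>+\<omega>. (\<Sum>i = 1..m. ennreal (?V i \<omega>)) \<partial>M) = (\<Sum>i = 1..m. \<integral>\<^sup>+\<omega>. ennreal (?V i \<omega>) \<partial>M)"
      by (intro nn_integral_sum measurable_compose[OF V_meas measurable_ennreal])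
    also have "ennreal (1 / real m) * \<dots> \<le> ennreal (1 / real m) * (\<Sum>i = 1..m. ennreal (C * 4 powr g * (real m / real i) powr g))"
      by (intro mult_left_mono sum_mono V_le) auto
    also have "\<dots> = ennreal (1 / real m * (\<Sum>i = 1..m. C * 4 powr g * (real m / real i) powr g))"
    proof -
      have "(\<Sum>i = 1..m. ennreal (C * 4 powr g * (real m / real i) powr g))
          = ennreal (\<Sum>i = 1..m. C * 4 powr g * (real m / real i) powr g)"
        by (rule sum_ennreal) (use C(1) in auto)
      moreover have "ennreal (1 / real m * (\<Sum>i = 1..m. C * 4 powr g * (real m / real i) powr g))
          = ennreal (1 / real m) * ennreal (\<Sum>i = 1..m. C * 4 powr g * (real m / real i) powr g)"
        by (rule ennreal_mult) (use C(1) in \<open>auto intro!: sum_nonneg\<close>)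
      ultimately show ?thesis by (simp only:)
    qed
    also have "1 / real m * (\<Sum>i = 1..m. C * 4 powr g * (real m / real i) powr g)
        = C * 4 powr g * ((\<Sum>i = 1..m. (real m / real i) powr g) / real m)"
      by (simp add: sum_distrib_left[symmetric])
    also have "(\<Sum>i = 1..m. (real m / real i) powr g) / real m
        = (\<integral>t. (real m / real (nat \<lceil>t * real m\<rceil>)) powr g \<partial>unit_lborel)"
      by (rule integral_step(2)[OF m(1), symmetric])
    also have "ennreal (C * 4 powr g * \<dots>) \<le> ennreal (C * 4 powr g * (\<integral>t. t powr (- g) \<partial>unit_lborel))"
    proof (intro ennreal_leI mult_left_mono integral_mono)
      show "integrable unit_lborel (\<lambda>t. (real m / real (nat \<lceil>t * real m\<rceil>)) powr g)"
        by (rule integral_step(1)[OF m(1)])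
      show "integrable unit_lborel (\<lambda>t. t powr (- g))" by (rule integral_unit_lborel_powr[OF g(3)])
      fix t assume "t \<in> space unit_lborel"
      then have t: "0 < t" "t \<le> 1" by auto
      have "real m / real (nat \<lceil>t * real m\<rceil>) \<le> real m / (t * real m)"
        using nat_ceiling_bounds[OF t m(1)] t m by (intro divide_left_mono mult_pos_pos) auto
      also have "\<dots> = 1 / t" using m by simp
      finally have "(real m / real (nat \<lceil>t * real m\<rceil>)) powr g \<le> (1 / t) powr g"
        using g by (intro powr_mono2) auto
      then show "(real m / real (nat \<lceil>t * real m\<rceil>)) powr g \<le> t powr (- g)"
        using t by (simp add: powr_divide powr_minus_divide)
    qed (use C(1) in auto)
    finally show "(\<integral>\<^sup>+\<omega>. ennreal ((\<Sum>i = 1..m. ?V i \<omega>) / real m) \<partial>M) \<le> ennreal (C * 4 powr g * (1 / (1 - g)))"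
      by (simp add: integral_unit_lborel_powr(2)[OF g(3)])
  qed (use C in auto)
qed

end

section \<open>Logarithms of the gaps\<close>

text \<open>The roots are matched to what can be averaged after squaring: \<open>sqrt\<close> turns
  a squared logarithm into a first moment, and the fourth root turns the squared \<open>ln m\<close>
  into \<open>sqrt m\<close>, which is paid for by a probability of order \<open>1 / k\<close> when
  \<open>k\<close> exceeds \<open>sqrt m\<close>.\<close>

lemma ln_le_root:
  fixes x :: real assumes "x > 0"
  shows "ln x \<le> 2 * sqrt x" "ln x \<le> 4 * sqrt (sqrt x)"
proof -
  have "ln (sqrt x) \<le> sqrt x - 1" "ln (sqrt (sqrt x)) \<le> sqrt (sqrt x) - 1"
    using assms by (auto intro!: ln_le_minus_one)
  then show "ln x \<le> 2 * sqrt x" "ln x \<le> 4 * sqrt (sqrt x)"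
    using assms by (auto simp: ln_sqrt)
qed

lemma power2_sum3_le:
  fixes a b c :: real shows "(a + b + c)\<^sup>2 \<le> 3 * (a\<^sup>2 + b\<^sup>2 + c\<^sup>2)"
  using sum_squares_bound[of a b] sum_squares_bound[of a c] sum_squares_bound[of b c]
  by (simp add: power2_eq_square algebra_simps)

context iid_extremes
begin

text \<open>Neither condition mentions \<open>k\<close>, so a single event serves all
  \<open>t\<close>. The first is the floor required by \<open>cvar_gap_le\<close>; the second makes
  every gap with \<open>k \<le> m\<close> positive, with a polynomial lower bound in
  \<open>m\<close>.\<close>

definition regular_event :: "real \<Rightarrow> nat \<Rightarrow> nat \<Rightarrow> 'a set" where
  "regular_event \<delta> n m = {\<omega> \<in> space M. U (real n / (4 * real m)) \<le> desc_order_stat X n (m + 1) \<omega> \<and>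
     \<delta> * \<alpha> (real n) < desc_order_stat X n 1 \<omega> - desc_order_stat X n 2 \<omega>}"

lemma regular_event_measurable:
  assumes "1 \<le> m" "m < n" shows "regular_event \<delta> n m \<in> events"
proof -
  have [measurable]: "desc_order_stat X n (m + 1) \<in> borel_measurable M"
    "desc_order_stat X n 1 \<in> borel_measurable M" "desc_order_stat X n (Suc 0) \<in> borel_measurable M"
    "desc_order_stat X n 2 \<in> borel_measurable M"
    using assms by (auto intro!: order_stat_measurable)
  show ?thesis unfolding regular_event_def by measurable
qed

text \<open>The case \<open>i = 1\<close> of \<open>cvar_gap_ge\<close>: since
  \<open>j \<ge> 1\<close>, the order statistic of index \<open>j + 1\<close> lies at or below the
  second largest observation, and \<open>j \<le> k\<close>.\<close>

lemma cvar_gap_ge_top_gap: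
  assumes "0 < c" "c < 1" "1 \<le> k" "k < n"
  shows "(1 - c) / (2 * real k) * (desc_order_stat X n 1 \<omega> - desc_order_stat X n 2 \<omega>) \<le> cvar_gap c n k \<omega>"
proof -
  define j where "j = nat \<lfloor>c * real k\<rfloor> + 1"
  note j = nat_floor_bounds[OF assms(1-3) j_def]
  have "desc_order_stat X n (j + 1) \<omega> \<le> desc_order_stat X n 2 \<omega>"
    "desc_order_stat X n 2 \<omega> \<le> desc_order_stat X n 1 \<omega>"
    using j assms by (auto intro!: desc_order_stat_antimono)
  moreover have "1 / real k \<le> 1 / real j" using j by (intro divide_left_mono) auto
  ultimately have "1 / real k * (desc_order_stat X n 1 \<omega> - desc_order_stat X n 2 \<omega>)
      \<le> real 1 / real j * (desc_order_stat X n 1 \<omega> - desc_order_stat X n (j + 1) \<omega>)"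
    by (intro mult_mono) auto
  then have "(1 - c) / 2 * (1 / real k * (desc_order_stat X n 1 \<omega> - desc_order_stat X n 2 \<omega>))
      \<le> (1 - c) / 2 * (real 1 / real j * (desc_order_stat X n 1 \<omega> - desc_order_stat X n (j + 1) \<omega>))"
    using assms by (intro mult_left_mono) auto
  also have "\<dots> \<le> cvar_gap c n k \<omega>" using assms j by (intro cvar_gap_ge j_def) auto
  finally show ?thesis by simp
qed

text \<open>
  On \<^const>\<open>regular_event\<close> the logarithm of the normalised gap is \<open>O (log m)\<close> for all \<open>k\<close>. For
  \<open>k \<le> sqrt m\<close> this is already \<open>O (log (m / k))\<close>, and for larger \<open>k\<close> the gap is of the correct
  order up to an event of probability \<open>O (1 / k) = o (1 / (log m)\<^sup>2)\<close>.
\<close>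

lemma log_gap_moment:
  assumes \<gamma>: "\<gamma> < 1" and c: "0 < c" "c < 1" and \<delta>: "\<delta> > 0"
  obtains C s0 where "C > 0" "s0 > 1" "\<And>s. s \<ge> s0 \<Longrightarrow> \<alpha> s > 0"
    "\<And>n m k \<omega>. real n / real m \<ge> s0 \<Longrightarrow> 1 \<le> k \<Longrightarrow> k \<le> m \<Longrightarrow> m < n \<Longrightarrow>
      \<omega> \<in> regular_event \<delta> n m \<Longrightarrow> cvar_gap c n k \<omega> > 0"
    "\<And>n m k. real n / real m \<ge> s0 \<Longrightarrow> 1 \<le> k \<Longrightarrow> k \<le> m \<Longrightarrow> m < n \<Longrightarrow>
      (\<integral>\<^sup>+\<omega>. ennreal ((ln (cvar_gap c n k \<omega> / \<alpha> (real n / real m)))\<^sup>2) * indicator (regular_event \<delta> n m) \<omega> \<partial>M)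
      \<le> ennreal (C * (1 + ln (real m / real k))\<^sup>2)"
proof -
  obtain c1 \<kappa> s1 where a: "c1 > 0" "\<kappa> > 0" "s1 > 1"
    "\<And>s x. s \<ge> s1 \<Longrightarrow> x \<ge> 1 \<Longrightarrow> \<alpha> (s * x) \<ge> c1 * x powr (- \<kappa>) * \<alpha> s"
    using \<alpha>_lower_bound by blast
  obtain c0 s2 where b: "c0 > 0" "s2 > 1"
    "\<And>n k. 1 \<le> k \<Longrightarrow> k < n \<Longrightarrow> real n / real k \<ge> s2 \<Longrightarrow>
      prob {\<omega> \<in> space M. cvar_gap c n k \<omega> < c0 * \<alpha> (real n / real k)} \<le> 36 / (c * real k)"
    using cvar_gap_lower_prob[OF c] by blast
  obtain Ce s3 where d: "Ce > 0" "s3 > 1" "\<And>s. s \<ge> s3 \<Longrightarrow> \<alpha> s > 0"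
    "\<And>n m s. s = real n / (4 * real m) \<Longrightarrow> s \<ge> s3 \<Longrightarrow> 1 \<le> m \<Longrightarrow> m \<le> n \<Longrightarrow>
      (\<integral>\<^sup>+\<omega>. ennreal ((\<Sum>i = 1..m. max 0 ((desc_order_stat X n i \<omega> - U s) / \<alpha> s)) / real m) \<partial>M) \<le> ennreal Ce"
    using mean_excess_bound[OF \<gamma>] by blast
  \<comment> \<open>Converts the scale at \<open>n / (4 * m)\<close>, where the mean excess is
    controlled, into the scale at \<open>n / m\<close>.\<close>
  define R where "R = 1 / (c1 * 4 powr (- \<kappa>))"
  have R: "R > 0" using a by (simp add: R_def)
  define C3 where "C3 = (1 - c) / 2 * \<delta> * c1"
  have C3: "C3 > 0" using c \<delta> a by (simp add: C3_def)
  \<comment> \<open>Large enough to serve every case of the pointwise bound at once: one constant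
    each for the upper bound, the crude lower bound and the Chebyshev lower bound, and
    \<open>2 * (\<kappa> + 1)\<close> for \<open>ln m \<le> 2 * l\<close>. The value of
    \<open>a2\<close> below is \<open>\<kappa> + 1\<close> times the 4 of
    \<open>ln_le_root\<close>.\<close>
  define a1 where "a1 = 1 + \<bar>ln (R / c)\<bar> + \<bar>ln C3\<bar> + \<bar>ln (c0 * c1)\<bar> + 2 * (\<kappa> + 1)"
  define a2 where "a2 = 4 * (\<kappa> + 1)"
  have a12: "a1 \<ge> 1" "a2 > 0" using a by (auto simp: a1_def a2_def)
  define C where "C = 3 * (a1\<^sup>2 + 4 * Ce + a2\<^sup>2 * (36 / c))"
  \<comment> \<open>The factor 4 keeps \<open>n / (4 * m)\<close> beyond all thresholds as
    well.\<close>
  define s0 where "s0 = 4 * max s1 (max s2 s3)"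
  have s0: "s0 > 1" using a(3) by (simp add: s0_def)
  have pos_gap: "cvar_gap c n k \<omega> / \<alpha> (real n / real m) \<ge> C3 * real m powr (- \<kappa> - 1)" "cvar_gap c n k \<omega> > 0"
    if s: "real n / real m \<ge> s0" and k: "1 \<le> k" "k \<le> m" "m < n" and \<omega>: "\<omega> \<in> regular_event \<delta> n m" for n m k \<omega>
  proof -
    define A where "A = \<alpha> (real n / real m)"
    have A: "A > 0" using s a(3) d(3) unfolding A_def s0_def by auto
    have m: "real m \<ge> 1" using k by simp
    have "c1 * real m powr (- \<kappa>) * A \<le> \<alpha> (real n / real m * real m)"
      unfolding A_def using s a(3) m by (intro a(4)) (auto simp: s0_def)
    then have "\<delta> * (c1 * real m powr (- \<kappa>) * A) \<le> \<delta> * \<alpha> (real n)"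
      using \<delta> m by (intro mult_left_mono) auto
    also have "\<dots> \<le> desc_order_stat X n 1 \<omega> - desc_order_stat X n 2 \<omega>" using \<omega> by (simp add: regular_event_def)
    finally have "(1 - c) / (2 * real m) * (\<delta> * (c1 * real m powr (- \<kappa>) * A))
        \<le> (1 - c) / (2 * real k) * (desc_order_stat X n 1 \<omega> - desc_order_stat X n 2 \<omega>)"
      using c k \<delta> a A by (intro mult_mono divide_left_mono mult_pos_pos) auto
    also have "\<dots> \<le> cvar_gap c n k \<omega>" using c k by (intro cvar_gap_ge_top_gap) auto
    also have "(1 - c) / (2 * real m) * (\<delta> * (c1 * real m powr (- \<kappa>) * A)) = C3 * real m powr (- \<kappa> - 1) * A"
      using m by (simp add: C3_def powr_diff)
    finally have *: "C3 * real m powr (- \<kappa> - 1) * A \<le> cvar_gap c n k \<omega>" .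
    then show "cvar_gap c n k \<omega> / \<alpha> (real n / real m) \<ge> C3 * real m powr (- \<kappa> - 1)"
      using A by (simp add: A_def field_simps)
    have "0 < C3 * real m powr (- \<kappa> - 1) * A" using C3 A m by simp
    then show "cvar_gap c n k \<omega> > 0" using * by linarith
  qed
  show ?thesis
  proof
    show "C > 0" using a12 d(1) c by (auto simp: C_def intro!: add_pos_pos add_pos_nonneg)
    show "s0 > 1" by (rule s0)
    show "\<alpha> s > 0" if "s \<ge> s0" for s using that d(2) by (intro d(3)) (auto simp: s0_def)
    show "cvar_gap c n k \<omega> > 0" if "real n / real m \<ge> s0" "1 \<le> k" "k \<le> m" "m < n" "\<omega> \<in> regular_event \<delta> n m" for n m k \<omega>
      using that by (rule pos_gap(2))
    fix n m k :: nat
    assume s: "real n / real m \<ge> s0" and k: "1 \<le> k" "k \<le> m" and mn: "m < n"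
    define A where "A = \<alpha> (real n / real m)"
    define s' where "s' = real n / (4 * real m)"
    have m1: "real m \<ge> 1" "real k \<ge> 1" using k by auto
    have ss: "real n / real m = s' * 4" using m1 by (simp add: s'_def)
    have s': "s' \<ge> s1" "s' \<ge> s3" using s unfolding ss s0_def by auto
    have A: "A > 0" "\<alpha> s' > 0"
      using s d(2,3) s' unfolding A_def s0_def by auto
    have \<alpha>': "\<alpha> s' \<le> R * A"
    proof -
      have "c1 * 4 powr (- \<kappa>) * \<alpha> s' \<le> A" unfolding A_def ss by (rule a(4)[OF s'(1)]) simp
      then show ?thesis using a(1) by (simp add: R_def field_simps)
    qed
    define l where "l = ln (real m / real k)"
    have l: "l \<ge> 0" "l = ln (real m) - ln (real k)" using k m1 by (auto simp: l_def ln_div)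
    define Q where "Q \<omega> = (\<Sum>i = 1..m. max 0 ((desc_order_stat X n i \<omega> - U s') / \<alpha> s')) / real m" for \<omega>
    have Q0: "Q \<omega> \<ge> 0" for \<omega> unfolding Q_def by (intro divide_nonneg_nonneg sum_nonneg) auto
    \<comment> \<open>The exceptional event matters for \<open>k\<close> above \<open>sqrt m\<close>
      only; for smaller \<open>k\<close> it is empty by definition, since the crude bound through
      \<open>ln m\<close> is then already of order \<open>l\<close>.\<close>
    define E where "E = {\<omega> \<in> space M. real m < (real k)\<^sup>2 \<and> cvar_gap c n k \<omega> < c0 * \<alpha> (real n / real k)}"
    define x where "x \<omega> = cvar_gap c n k \<omega> / A" for \<omega>
    have kn: "k < n" using k mn by simp
    note [measurable] = cvar_gap_measurable[OF c k(1) kn]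
    have E_meas [measurable]: "E \<in> events" unfolding E_def by measurable
    have Q_meas [measurable]: "Q \<in> borel_measurable M"
      unfolding Q_def[abs_def]
      by (intro borel_measurable_divide borel_measurable_sum borel_measurable_max borel_measurable_diff
          borel_measurable_const order_stat_measurable) (use mn in auto)
    have bound: "\<bar>ln (x \<omega>)\<bar> \<le> a1 * (1 + l) + 2 * sqrt (Q \<omega>) + a2 * sqrt (sqrt (real m)) * indicator E \<omega>"
      if \<omega>: "\<omega> \<in> regular_event \<delta> n m" for \<omega>
    proof -
      have x_low: "x \<omega> \<ge> C3 * real m powr (- \<kappa> - 1)" unfolding x_def A_def by (rule pos_gap(1)[OF s k mn \<omega>])
      have x_pos: "x \<omega> > 0" using pos_gap(2)[OF s k mn \<omega>] A by (simp add: x_def)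
      have nn: "(\<kappa> + 1) * l \<ge> 0" "\<kappa> * l \<le> (\<kappa> + 1) * l"
        using l a by (auto simp: algebra_simps)
      have a1l: "\<bar>ln (R / c)\<bar> + \<bar>ln C3\<bar> + \<bar>ln (c0 * c1)\<bar> + l + 2 * ((\<kappa> + 1) * l) \<le> a1 * (1 + l)"
      proof -
        have "(1 + \<bar>ln (R / c)\<bar> + \<bar>ln C3\<bar> + \<bar>ln (c0 * c1)\<bar>) * 1
            \<le> (1 + \<bar>ln (R / c)\<bar> + \<bar>ln C3\<bar> + \<bar>ln (c0 * c1)\<bar>) * (1 + l)"
          using l(1) by (intro mult_left_mono) auto
        moreover have "1 * l \<le> (1 + \<bar>ln (R / c)\<bar> + \<bar>ln C3\<bar> + \<bar>ln (c0 * c1)\<bar>) * l"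
          using l(1) by (intro mult_right_mono) auto
        moreover have "a1 * (1 + l) = (1 + \<bar>ln (R / c)\<bar> + \<bar>ln C3\<bar> + \<bar>ln (c0 * c1)\<bar>) * (1 + l)
            + 2 * (\<kappa> + 1) + 2 * ((\<kappa> + 1) * l)"
          by (simp add: a1_def distrib_left distrib_right)
        moreover have "l \<le> 2 * (\<kappa> + 1) + (1 + \<bar>ln (R / c)\<bar> + \<bar>ln C3\<bar> + \<bar>ln (c0 * c1)\<bar>) * (1 + l)
            - (1 + \<bar>ln (R / c)\<bar> + \<bar>ln C3\<bar> + \<bar>ln (c0 * c1)\<bar>)"
          using calculation(2) a(2) by (simp add: distrib_left)
        ultimately show ?thesis by linarith
      qed
      have E_nn: "a2 * sqrt (sqrt (real m)) * indicator E \<omega> \<ge> 0" using a12 by simp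
      have low: "- ln (x \<omega>) \<le> \<bar>ln C3\<bar> + (\<kappa> + 1) * ln (real m)"
      proof -
        have "ln (C3 * real m powr (- \<kappa> - 1)) \<le> ln (x \<omega>)" using x_low C3 m1 x_pos by (subst ln_le_cancel_iff) auto
        moreover have "ln (C3 * real m powr (- \<kappa> - 1)) = ln C3 - (\<kappa> + 1) * ln (real m)"
          using C3 m1 by (simp add: ln_mult ln_powr algebra_simps)
        ultimately show ?thesis by linarith
      qed
      show ?thesis
      \<comment> \<open>For \<open>x \<omega> \<ge> 1\<close> only an upper bound on the gap
        matters, and the mean excess \<open>Q\<close> supplies it with the factor
        \<open>m / k\<close>, hence the summand \<open>l\<close>. For \<open>x \<omega> < 1\<close>
        only the lower bounds matter.\<close>
      proof (cases "x \<omega> \<ge> 1")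
        case True
        have gap: "cvar_gap c n k \<omega> \<le> real m / (c * real k) * (cvar_order_stat X n m \<omega> - U s')"
          using \<omega> by (intro cvar_gap_le c k mn) (simp add: regular_event_def s'_def)
        have "cvar_order_stat X n m \<omega> - U s' \<le> \<alpha> s' * Q \<omega>"
        proof -
          have "cvar_order_stat X n m \<omega> - U s' = (\<Sum>i = 1..m. desc_order_stat X n i \<omega> - U s') / real m"
            using m1 by (simp add: cvar_order_stat_def sum_subtractf field_simps)
          also have "\<dots> \<le> (\<Sum>i = 1..m. \<alpha> s' * max 0 ((desc_order_stat X n i \<omega> - U s') / \<alpha> s')) / real m"
          proof (intro divide_right_mono sum_mono)
            fix i
            have "desc_order_stat X n i \<omega> - U s' = \<alpha> s' * ((desc_order_stat X n i \<omega> - U s') / \<alpha> s')"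
              using A by simp
            also have "\<dots> \<le> \<alpha> s' * max 0 ((desc_order_stat X n i \<omega> - U s') / \<alpha> s')"
              using A by (intro mult_left_mono) auto
            finally show "desc_order_stat X n i \<omega> - U s' \<le> \<alpha> s' * max 0 ((desc_order_stat X n i \<omega> - U s') / \<alpha> s')" .
          qed simp
          also have "\<dots> = \<alpha> s' * Q \<omega>" by (simp add: Q_def sum_distrib_left)
          finally show ?thesis .
        qed
        also have "\<alpha> s' * Q \<omega> \<le> R * A * Q \<omega>" using \<alpha>' Q0 by (rule mult_right_mono)
        finally have "real m / (c * real k) * (cvar_order_stat X n m \<omega> - U s') \<le> real m / (c * real k) * (R * A * Q \<omega>)"
          using c by (intro mult_left_mono) auto
        with gap have "cvar_gap c n k \<omega> \<le> real m / (c * real k) * (R * A * Q \<omega>)" by linarith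
        then have xle: "x \<omega> \<le> real m / real k * (R / c) * Q \<omega>"
          using A c m1 by (simp add: x_def field_simps)
        have Qpos: "Q \<omega> > 0"
        proof (rule ccontr)
          assume "\<not> Q \<omega> > 0"
          then have "Q \<omega> = 0" using Q0[of \<omega>] by simp
          then show False using xle True by simp
        qed
        have "ln (x \<omega>) \<le> ln (real m / real k * (R / c) * Q \<omega>)"
          using xle x_pos by simp
        also have "\<dots> = l + ln (R / c) + ln (Q \<omega>)"
          using Qpos R c m1 by (simp add: ln_mult ln_div l_def)
        also have "\<dots> \<le> l + ln (R / c) + 2 * sqrt (Q \<omega>)" using ln_le_root(1)[OF Qpos] by simp
        finally have "ln (x \<omega>) \<le> l + \<bar>ln (R / c)\<bar> + 2 * sqrt (Q \<omega>)" by linarith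
        moreover have "ln (x \<omega>) \<ge> 0" using True by simp
        ultimately show ?thesis using a1l nn E_nn l(1) by linarith
      next
        case False
        then have abs: "\<bar>ln (x \<omega>)\<bar> = - ln (x \<omega>)" using x_pos by simp
        have sQ: "sqrt (Q \<omega>) \<ge> 0" using Q0 by simp
        show ?thesis
        proof (cases "real m < (real k)\<^sup>2")
          case False
          then have "ln ((real k)\<^sup>2) \<le> ln (real m)" using m1 by (subst ln_le_cancel_iff) auto
          then have "2 * ln (real k) \<le> ln (real m)" using m1 by (simp add: ln_realpow)
          then have "ln (real m) \<le> 2 * l" using l(2) by linarith
          then have "(\<kappa> + 1) * ln (real m) \<le> (\<kappa> + 1) * (2 * l)" using a by (intro mult_left_mono) auto
          then have "- ln (x \<omega>) \<le> \<bar>ln C3\<bar> + 2 * ((\<kappa> + 1) * l)" using low by simp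
          then show ?thesis using abs a1l nn E_nn sQ l(1) by linarith
        next
          case True
          show ?thesis
          proof (cases "\<omega> \<in> E")
            case True
            have "(\<kappa> + 1) * ln (real m) \<le> (\<kappa> + 1) * (4 * sqrt (sqrt (real m)))"
              using a m1 ln_le_root(2)[of "real m"] by (intro mult_left_mono) auto
            also have "\<dots> = a2 * sqrt (sqrt (real m)) * indicator E \<omega>" using True by (simp add: a2_def)
            finally show ?thesis using low abs a1l nn sQ l(1) by linarith
          next
            case notE: False
            have sk: "real n / real k = real n / real m * (real m / real k)" using m1 by simp
            have mk: "real m / real k \<ge> 1" using k by simp
            have "c0 * (c1 * (real m / real k) powr (- \<kappa>) * A) \<le> c0 * \<alpha> (real n / real k)"
              unfolding sk A_def using s a b(1) mk by (intro mult_left_mono a(4)) (auto simp: s0_def)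
            also have "\<dots> \<le> cvar_gap c n k \<omega>"
              using notE True \<omega> by (auto simp: E_def regular_event_def not_less)
            finally have "c0 * c1 * (real m / real k) powr (- \<kappa>) \<le> x \<omega>"
              using A by (simp add: x_def field_simps)
            then have "ln (c0 * c1 * (real m / real k) powr (- \<kappa>)) \<le> ln (x \<omega>)"
              using x_pos a b m1 by (subst ln_le_cancel_iff) auto
            moreover have "ln (c0 * c1 * (real m / real k) powr (- \<kappa>)) = ln (c0 * c1) - \<kappa> * l"
              using a b m1 by (simp add: ln_mult ln_powr l_def)
            ultimately have "- ln (x \<omega>) \<le> \<bar>ln (c0 * c1)\<bar> + \<kappa> * l" by linarith
            then show ?thesis using abs a1l nn sQ l(1) E_nn by linarith
          qed
        qed
      qed
    qed
    have sq_bound: "ennreal ((ln (x \<omega>))\<^sup>2) * indicator (regular_event \<delta> n m) \<omega>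
        \<le> ennreal (3 * (a1 * (1 + l))\<^sup>2) + 12 * ennreal (Q \<omega>) + ennreal (3 * a2\<^sup>2 * sqrt (real m)) * indicator E \<omega>" for \<omega>
    proof (cases "\<omega> \<in> regular_event \<delta> n m")
      case True
      let ?i = "indicator E \<omega> :: real"
      have "(ln (x \<omega>))\<^sup>2 \<le> (a1 * (1 + l) + 2 * sqrt (Q \<omega>) + a2 * sqrt (sqrt (real m)) * ?i)\<^sup>2"
        using power_mono[OF bound[OF True] abs_ge_zero, of 2] by simp
      also have "\<dots> \<le> 3 * ((a1 * (1 + l))\<^sup>2 + (2 * sqrt (Q \<omega>))\<^sup>2 + (a2 * sqrt (sqrt (real m)) * ?i)\<^sup>2)"
        by (rule power2_sum3_le)
      also have "\<dots> = 3 * (a1 * (1 + l))\<^sup>2 + 12 * Q \<omega> + 3 * a2\<^sup>2 * sqrt (real m) * ?i"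
        using Q0[of \<omega>] by (simp add: power_mult_distrib indicator_def)
      finally have "ennreal ((ln (x \<omega>))\<^sup>2) \<le> ennreal (3 * (a1 * (1 + l))\<^sup>2 + 12 * Q \<omega> + 3 * a2\<^sup>2 * sqrt (real m) * ?i)"
        by (rule ennreal_leI)
      also have "\<dots> = ennreal (3 * (a1 * (1 + l))\<^sup>2) + 12 * ennreal (Q \<omega>) + ennreal (3 * a2\<^sup>2 * sqrt (real m)) * indicator E \<omega>"
        using Q0[of \<omega>] by (auto simp: ennreal_mult indicator_def)
      finally show ?thesis using True by simp
    qed simp
    have "(\<integral>\<^sup>+\<omega>. ennreal ((ln (x \<omega>))\<^sup>2) * indicator (regular_event \<delta> n m) \<omega> \<partial>M)
      \<le> (\<integral>\<^sup>+\<omega>. ennreal (3 * (a1 * (1 + l))\<^sup>2) + 12 * ennreal (Q \<omega>) + ennreal (3 * a2\<^sup>2 * sqrt (real m)) * indicator E \<omega> \<partial>M)"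
      by (intro nn_integral_mono sq_bound)
    also have "\<dots> = ennreal (3 * (a1 * (1 + l))\<^sup>2) + 12 * (\<integral>\<^sup>+\<omega>. ennreal (Q \<omega>) \<partial>M)
        + ennreal (3 * a2\<^sup>2 * sqrt (real m)) * emeasure M E"
      by (simp add: nn_integral_add nn_integral_cmult emeasure_space_1)
    also have "\<dots> \<le> ennreal (3 * (a1 * (1 + l))\<^sup>2) + 12 * ennreal Ce + ennreal (3 * a2\<^sup>2 * (36 / c))"
    proof (intro add_mono order_refl)
      show "12 * (\<integral>\<^sup>+\<omega>. ennreal (Q \<omega>) \<partial>M) \<le> 12 * ennreal Ce"
        unfolding Q_def using s'(2) k mn by (intro mult_left_mono d(4) s'_def) auto
      \<comment> \<open>Squaring the crude bound costs \<open>sqrt m\<close>. Whenever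
        \<open>E\<close> can be nonempty, \<open>sqrt m \<le> k\<close>, so the cost is balanced by
        \<open>prob E \<le> 36 / (c * k)\<close>.\<close>
      have "sqrt (real m) * prob E \<le> 36 / c"
      proof (cases "real m < (real k)\<^sup>2")
        case True
        then have E_eq: "E = {\<omega> \<in> space M. cvar_gap c n k \<omega> < c0 * \<alpha> (real n / real k)}" by (auto simp: E_def)
        have "real n / real m \<le> real n / real k" using k by (intro divide_left_mono) auto
        then have "prob E \<le> 36 / (c * real k)"
          unfolding E_eq using k kn s b(2) by (intro b(3)) (auto simp: s0_def)
        moreover have "sqrt (real m) \<le> real k" using True by (intro real_le_lsqrt) auto
        ultimately have "sqrt (real m) * prob E \<le> real k * (36 / (c * real k))" by (intro mult_mono) auto
        then show ?thesis using k by simp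
      next
        case False
        then have "E = {}" by (auto simp: E_def)
        then show ?thesis using c by simp
      qed
      then have "3 * a2\<^sup>2 * (sqrt (real m) * prob E) \<le> 3 * a2\<^sup>2 * (36 / c)" by (intro mult_left_mono) auto
      then have "ennreal (3 * a2\<^sup>2 * sqrt (real m) * prob E) \<le> ennreal (3 * a2\<^sup>2 * (36 / c))"
        by (intro ennreal_leI) (simp add: mult.assoc)
      then show "ennreal (3 * a2\<^sup>2 * sqrt (real m)) * emeasure M E \<le> ennreal (3 * a2\<^sup>2 * (36 / c))"
        by (simp add: emeasure_eq_measure ennreal_mult)
    qed
    also have "\<dots> = ennreal (3 * (a1 * (1 + l))\<^sup>2 + 12 * Ce + 3 * a2\<^sup>2 * (36 / c))"
      using d(1) c by (simp add: ennreal_mult)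
    also have "\<dots> \<le> ennreal (C * (1 + l)\<^sup>2)"
    proof (rule ennreal_leI)
      have "1 \<le> (1 + l)\<^sup>2" using l by simp
      then have "(12 * Ce + 3 * a2\<^sup>2 * (36 / c)) * 1 \<le> (12 * Ce + 3 * a2\<^sup>2 * (36 / c)) * (1 + l)\<^sup>2"
        using d(1) c by (intro mult_left_mono) auto
      moreover have "C * w = 3 * (a1\<^sup>2 * w) + (12 * Ce + 3 * a2\<^sup>2 * (36 / c)) * w" for w
        by (simp add: C_def algebra_simps)
      ultimately show "3 * (a1 * (1 + l))\<^sup>2 + 12 * Ce + 3 * a2\<^sup>2 * (36 / c) \<le> C * (1 + l)\<^sup>2"
        by (simp only: power_mult_distrib mult_1_right)
    qed
    finally show "(\<integral>\<^sup>+\<omega>. ennreal ((ln (cvar_gap c n k \<omega> / \<alpha> (real n / real m)))\<^sup>2) * indicator (regular_event \<delta> n m) \<omega> \<partial>M)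
      \<le> ennreal (C * (1 + ln (real m / real k))\<^sup>2)"
      by (simp add: x_def A_def l_def)
  qed
qed

end

section \<open>Consistency of the estimator\<close>

context iid_extremes
begin

text \<open>\<open>\<delta>\<close> comes from \<open>top_gap\<close> and depends on
  \<open>e\<close>, so for each \<open>\<delta>\<close> only a small failure probability is
  obtained, not a vanishing one. The other condition fails with probability at most
  \<open>2 / m\<close>, as the level \<open>n / (4 * m)\<close> has about \<open>4 * m\<close>
  expected exceedances.\<close>

lemma regular_event_prob:
  fixes m :: "nat \<Rightarrow> nat"
  assumes m: "filterlim m at_top sequentially" "(\<lambda>n. real (m n) / real n) \<longlonglongrightarrow> 0" and e: "e > 0"
  obtains \<delta> where "\<delta> > 0"
    "eventually (\<lambda>n. prob (space M - regular_event \<delta> n (m n)) \<le> e) sequentially"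
proof -
  obtain \<delta> where \<delta>: "\<delta> > 0" "eventually (\<lambda>n. prob {\<omega> \<in> space M.
      desc_order_stat X n 1 \<omega> - desc_order_stat X n 2 \<omega> \<le> \<delta> * \<alpha> (real n)} \<le> e / 2) sequentially"
    using top_gap[of "e / 2"] e by auto
  have m_real: "filterlim (\<lambda>n. real (m n)) at_top sequentially"
    by (rule filterlim_compose[OF filterlim_real_sequentially m(1)])
  have "(\<lambda>n. 2 / real (m n)) \<longlonglongrightarrow> 0" by (rule real_tendsto_divide_at_top[OF tendsto_const m_real])
  then have ev: "eventually (\<lambda>n. 2 / real (m n) < e / 2) sequentially"
    using e by (intro order_tendstoD(2)) auto
  have quarter: "(1 / 4 :: real) > 0" by simp
  have "eventually (\<lambda>n. prob (space M - regular_event \<delta> n (m n)) \<le> e) sequentially"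
    using \<delta>(2) ev eventually_compose_filterlim[OF eventually_ge_at_top[of 1] m(1)]
      order_tendstoD(2)[OF m(2) quarter] eventually_gt_at_top[of 0]
  proof eventually_elim
    case (elim n)
    have mn: "4 * real (m n) < real n" using elim(4,5) by (simp add: field_simps)
    have m1: "1 \<le> m n" "m n + 1 \<le> n" "2 \<le> n" using mn elim(3) by linarith+
    have [measurable]: "desc_order_stat X n (m n + 1) \<in> borel_measurable M"
      "desc_order_stat X n 1 \<in> borel_measurable M" "desc_order_stat X n (Suc 0) \<in> borel_measurable M"
      "desc_order_stat X n 2 \<in> borel_measurable M"
      using m1 by (auto intro!: order_stat_measurable)
    have "space M - regular_event \<delta> n (m n)
      = {\<omega> \<in> space M. desc_order_stat X n (m n + 1) \<omega> < U (real n / (4 * real (m n)))}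
      \<union> {\<omega> \<in> space M. desc_order_stat X n 1 \<omega> - desc_order_stat X n 2 \<omega> \<le> \<delta> * \<alpha> (real n)}"
      by (auto simp: regular_event_def)
    then have "prob (space M - regular_event \<delta> n (m n))
      \<le> prob {\<omega> \<in> space M. desc_order_stat X n (m n + 1) \<omega> < U (real n / (4 * real (m n)))}
      + prob {\<omega> \<in> space M. desc_order_stat X n 1 \<omega> - desc_order_stat X n 2 \<omega> \<le> \<delta> * \<alpha> (real n)}"
      by (simp only:) (rule measure_Un_le; measurable)
    also have "prob {\<omega> \<in> space M. desc_order_stat X n (m n + 1) \<omega> < U (real n / (4 * real (m n)))}
      \<le> (1 + 1) / (1\<^sup>2 * real (m n + 1))"
      using m1 mn by (intro order_stat_lower) (auto simp: less_divide_eq_1)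
    also have "(1 + 1) / (1\<^sup>2 * real (m n + 1)) \<le> 2 / real (m n)"
      using m1 by (simp add: divide_left_mono)
    finally show ?case using elim by linarith
  qed
  with \<delta>(1) show ?thesis by (rule that)
qed

text \<open>Stated for a positive measure so that it applies to each Jordan part of the weight. The
  centring contains the logarithm of the scale, which need not converge; it is constant in
  \<open>t\<close> and disappears only when the two parts are subtracted.\<close>

lemma log_gap_integral_in_prob:
  fixes m :: "nat \<Rightarrow> nat" and \<mu> :: "real measure"
  assumes \<gamma>: "\<gamma> < 1" and c: "0 < c" "c < 1"
    and m: "filterlim m at_top sequentially" "(\<lambda>n. real (m n) / real n) \<longlonglongrightarrow> 0"
    and \<mu>: "finite_measure \<mu>" "sets \<mu> = sets unit_borel" "(\<integral>\<^sup>+t. ennreal (ln (1 / t)) \<partial>\<mu>) < \<infinity>"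
    and e: "e > 0"
  shows "(\<lambda>n. prob {\<omega> \<in> space M. ennreal e \<le> (\<integral>\<^sup>+t. ennreal
     \<bar>log_conv (cvar_gap c n (nat \<lceil>t * real (m n)\<rceil>) \<omega>)
       - (ln (\<alpha> (real n / real (m n))) + ln (H (1 / c) / (1 - \<gamma>)) + \<gamma> * ln (1 / t))\<bar> \<partial>\<mu>)}) \<longlonglongrightarrow> 0"
proof -
  interpret \<mu>: finite_measure \<mu> by fact
  have space_\<mu>: "space \<mu> = {0<..1}"
    using sets_eq_imp_space_eq[OF \<mu>(2)] by (simp add: space_restrict_space)
  define K where "K = H (1 / c) / (1 - \<gamma>)"
  have K: "K > 0" using H_pos[of "1 / c"] c \<gamma> by (simp add: K_def)
  define A where "A n = \<alpha> (real n / real (m n))" for n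
  define k where "k n t = nat \<lceil>t * real (m n)\<rceil>" for n t
  define Z where "Z n \<omega> t = \<bar>log_conv (cvar_gap c n (k n t) \<omega>) - (ln (A n) + ln K + \<gamma> * ln (1 / t))\<bar>" for n \<omega> t
  define J where "J n \<omega> = (\<integral>\<^sup>+t. ennreal (Z n \<omega> t) \<partial>\<mu>)" for n \<omega>
  have ln_meas [measurable]: "(\<lambda>t. ln (1 / t)) \<in> borel_measurable \<mu>"
    unfolding measurable_cong_sets[OF \<mu>(2) refl] by (intro measurable_restrict_space1) measurable
  have log_conv_meas [measurable]: "log_conv \<in> borel_measurable borel"
    unfolding log_conv_def[abs_def] by measurable
  have Z_meas: "(\<lambda>(\<omega>, t). Z n \<omega> t) \<in> borel_measurable (M \<Otimes>\<^sub>M \<mu>)" if "1 \<le> m n" "m n < n" for n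
  proof -
    have "cvar_gap c n i \<in> borel_measurable M" if "i \<in> {1..m n}" for i
      using that \<open>m n < n\<close> by (intro cvar_gap_measurable c) auto
    from measurable_random_index[OF this that(1) \<mu>(2)]
    have [measurable]: "(\<lambda>(\<omega>, t). cvar_gap c n (k n t) \<omega>) \<in> borel_measurable (M \<Otimes>\<^sub>M \<mu>)"
      by (simp add: k_def)
    show ?thesis unfolding Z_def by measurable
  qed
  have J_meas: "J n \<in> borel_measurable M" if "1 \<le> m n" "m n < n" for n
  proof -
    note [measurable] = Z_meas[OF that]
    show ?thesis unfolding J_def[abs_def] by measurable
  qed
  have m_ev: "eventually (\<lambda>n. 1 \<le> m n \<and> m n < n) sequentially"
    using eventually_compose_filterlim[OF eventually_ge_at_top[of 1] m(1)]
      order_tendstoD(2)[OF m(2) zero_less_one] eventually_gt_at_top[of 0]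
    by eventually_elim simp
  have "(\<lambda>n. prob {\<omega> \<in> space M. ennreal e \<le> J n \<omega>}) \<longlonglongrightarrow> 0"
  proof (rule tendstoI)
    fix \<epsilon> :: real assume \<epsilon>: "\<epsilon> > 0"
    \<comment> \<open>The event depends on the tolerance through \<open>\<delta>\<close>, so the
      limit is verified for one \<open>\<epsilon>\<close> at a time: half of it is spent on the
      complement of the event, half on the event.\<close>
    obtain \<delta> where \<delta>: "\<delta> > 0"
      "eventually (\<lambda>n. prob (space M - regular_event \<delta> n (m n)) \<le> \<epsilon> / 2) sequentially"
      using regular_event_prob[OF m, of "\<epsilon> / 2"] \<epsilon> by auto
    obtain C s0 where C: "C > 0" "s0 > 1" "\<And>s. s \<ge> s0 \<Longrightarrow> \<alpha> s > 0"
      "\<And>n m k \<omega>. real n / real m \<ge> s0 \<Longrightarrow> 1 \<le> k \<Longrightarrow> k \<le> m \<Longrightarrow> m < n \<Longrightarrow>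
        \<omega> \<in> regular_event \<delta> n m \<Longrightarrow> cvar_gap c n k \<omega> > 0"
      "\<And>n m k. real n / real m \<ge> s0 \<Longrightarrow> 1 \<le> k \<Longrightarrow> k \<le> m \<Longrightarrow> m < n \<Longrightarrow>
        (\<integral>\<^sup>+\<omega>. ennreal ((ln (cvar_gap c n k \<omega> / \<alpha> (real n / real m)))\<^sup>2) * indicator (regular_event \<delta> n m) \<omega> \<partial>M)
        \<le> ennreal (C * (1 + ln (real m / real k))\<^sup>2)"
      using log_gap_moment[OF \<gamma> c \<delta>(1)] by blast
    define G where "G n = regular_event \<delta> n (m n)" for n
    have "eventually (\<lambda>n. 1 \<le> m n \<and> m n < n \<and> real n / real (m n) \<ge> s0) sequentially"
      using m_ev eventually_compose_filterlim[OF eventually_ge_at_top[of s0] ratio_at_top[OF m]]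
      by eventually_elim auto
    then obtain n0 where n0: "\<And>n. n \<ge> n0 \<Longrightarrow> 1 \<le> m n \<and> m n < n \<and> real n / real (m n) \<ge> s0"
      unfolding eventually_sequentially by blast
    have G_ev: "G n \<in> events" if "n \<ge> n0" for n
      unfolding G_def using n0[OF that] by (intro regular_event_measurable) auto
    have G_sub: "G n \<subseteq> space M" for n by (auto simp: G_def regular_event_def)
    have A_pos: "A n > 0" if "n \<ge> n0" for n unfolding A_def using n0[OF that] by (intro C(3)) auto
    have k_bounds: "1 \<le> k n t" "k n t \<le> m n" "t * real (m n) \<le> real (k n t)" if "n \<ge> n0" "t \<in> {0<..1}" for n t
      using nat_ceiling_bounds[of t "m n"] n0[OF that(1)] that(2) by (auto simp: k_def)
    have gap_pos: "cvar_gap c n (k n t) \<omega> > 0" if "n \<ge> n0" "t \<in> {0<..1}" "\<omega> \<in> G n" for n t \<omega>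
      using that(3) n0[OF that(1)] k_bounds[OF that(1,2)] unfolding G_def by (intro C(4)[of n "m n"]) auto
    \<comment> \<open>On \<open>G n\<close> the gap is positive, so \<open>log_conv\<close> is the
      true logarithm and the scale can be moved inside it. Off \<open>G n\<close> nothing is
      estimated.\<close>
    have Z_eq: "Z n \<omega> t = \<bar>ln (cvar_gap c n (k n t) \<omega> / A n) - (ln K + \<gamma> * ln (1 / t))\<bar>"
      if "n \<ge> n0" "t \<in> {0<..1}" "\<omega> \<in> G n" for n t \<omega>
      using gap_pos[OF that] A_pos[OF that(1)] by (simp add: Z_def log_conv_def ln_div)
    have main: "(\<lambda>n. prob {\<omega> \<in> G n. ennreal e \<le> J n \<omega>}) \<longlonglongrightarrow> 0"
    proof -
      \<comment> \<open>From \<open>(\<bar>x\<bar> + b)\<^sup>2 \<le> 2 * x\<^sup>2 + 2 *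
        b\<^sup>2\<close>: the moment of the log gap contributes \<open>C\<close>, the logarithm of
        the limit contributes at most
        \<open>(\<bar>ln K\<bar> + \<bar>\<gamma>\<bar>) * (1 + ln (1 / t))\<close>.\<close>
      define K1 where "K1 = 2 * C + 2 * (\<bar>ln K\<bar> + \<bar>\<gamma>\<bar>)\<^sup>2"
      have K1: "K1 > 0" using C(1) by (auto simp: K1_def intro!: add_pos_nonneg)
      define L where "L t = sqrt K1 * (1 + ln (1 / t))" for t
      have ln_nn: "ln (1 / t) \<ge> 0" if "t \<in> {0<..1}" for t :: real
        using that by (intro ln_ge_zero) auto
      show ?thesis
        unfolding J_def
      proof (rule nn_integral_tendsto_0_in_prob[where p = 2 and L = L and ?n0.0 = n0])
        show "sigma_finite_measure \<mu>" ..
        show "(\<lambda>(\<omega>, t). Z n \<omega> t) \<in> borel_measurable (M \<Otimes>\<^sub>M \<mu>)" if "n \<ge> n0" for n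
          using n0[OF that] by (intro Z_meas) auto
        show "L t > 0" if "t \<in> space \<mu>" for t
          using that ln_nn[of t] K1 by (auto simp: L_def space_\<mu> intro!: mult_pos_pos add_pos_nonneg)
        show "L \<in> borel_measurable \<mu>" unfolding L_def by measurable
        have "(\<integral>\<^sup>+t. ennreal (L t) \<partial>\<mu>) = (\<integral>\<^sup>+t. ennreal (sqrt K1) * (1 + ennreal (ln (1 / t))) \<partial>\<mu>)"
        proof (intro nn_integral_cong)
          fix t assume "t \<in> space \<mu>"
          then have nn: "ln (1 / t) \<ge> 0" using ln_nn space_\<mu> by auto
          then have "1 + ennreal (ln (1 / t)) = ennreal (1 + ln (1 / t))" by simp
          then show "ennreal (L t) = ennreal (sqrt K1) * (1 + ennreal (ln (1 / t)))"
            using nn K1 by (simp only: L_def) (intro ennreal_mult, auto)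
        qed
        also have "\<dots> = ennreal (sqrt K1) * (emeasure \<mu> (space \<mu>) + (\<integral>\<^sup>+t. ennreal (ln (1 / t)) \<partial>\<mu>))"
          by (subst nn_integral_cmult, measurable, subst nn_integral_add) (auto intro!: measurable_compose[OF ln_meas measurable_ennreal])
        also have "\<dots> < \<infinity>"
        proof -
          have "emeasure \<mu> (space \<mu>) < \<infinity>" by (simp add: less_top[symmetric])
          then show ?thesis using \<mu>(3) by (simp add: ennreal_mult_less_top)
        qed
        finally show "(\<integral>\<^sup>+t. ennreal (L t) \<partial>\<mu>) < \<infinity>" .
        show "(\<lambda>n. prob {\<omega> \<in> G n. Z n \<omega> t > e'}) \<longlonglongrightarrow> 0" if t: "t \<in> space \<mu>" and e': "e' > 0" for t e'
        proof -
          have t': "0 < t" "t \<le> 1" "t \<in> {0<..1}" using t space_\<mu> by auto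
          define \<kappa> where "\<kappa> = t powr (- \<gamma>) * K"
          have \<kappa>: "\<kappa> > 0" "ln \<kappa> = ln K + \<gamma> * ln (1 / t)"
            using t' K by (auto simp: \<kappa>_def ln_mult ln_powr ln_div)
          \<comment> \<open>Positivity of the limit \<open>\<kappa>\<close> lets convergence in
            probability of the normalised gap pass to its logarithm by continuity at this one
            point.\<close>
          have "isCont (ln :: real \<Rightarrow> real) \<kappa>" using \<kappa>(1) by (intro isCont_ln) auto
          then obtain d where d: "d > 0" "\<And>x. \<bar>x - \<kappa>\<bar> < d \<Longrightarrow> \<bar>ln x - ln \<kappa>\<bar> < e'"
            using e' unfolding continuous_at_eps_delta by (auto simp: dist_real_def)
          have d2: "d / 2 > 0" using d(1) by simp
          have lim0: "(\<lambda>n. prob {\<omega> \<in> space M. \<bar>cvar_gap c n (k n t) \<omega> / A n - \<kappa>\<bar> > d / 2}) \<longlonglongrightarrow> 0"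
            using cvar_gap_in_prob[OF \<gamma> c m t'(1,2) d2] by (simp add: k_def A_def \<kappa>_def K_def)
          show ?thesis
          proof (rule tendsto_sandwich[OF _ _ tendsto_const lim0])
            show "eventually (\<lambda>n. prob {\<omega> \<in> G n. Z n \<omega> t > e'}
              \<le> prob {\<omega> \<in> space M. \<bar>cvar_gap c n (k n t) \<omega> / A n - \<kappa>\<bar> > d / 2}) sequentially"
              using eventually_ge_at_top[of n0]
            proof eventually_elim
              case (elim n)
              have kn: "1 \<le> k n t" "k n t < n" using k_bounds[OF elim t'(3)] n0[OF elim] by auto
              note [measurable] = cvar_gap_measurable[OF c kn]
              show ?case
              proof (rule finite_measure_mono)
                show "{\<omega> \<in> G n. Z n \<omega> t > e'} \<subseteq> {\<omega> \<in> space M. \<bar>cvar_gap c n (k n t) \<omega> / A n - \<kappa>\<bar> > d / 2}"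
                proof safe
                  fix \<omega> assume \<omega>: "\<omega> \<in> G n" "Z n \<omega> t > e'"
                  then have "\<not> \<bar>ln (cvar_gap c n (k n t) \<omega> / A n) - ln \<kappa>\<bar> < e'"
                    using Z_eq[OF elim t'(3) \<omega>(1)] \<kappa>(2) by simp
                  then have "\<not> \<bar>cvar_gap c n (k n t) \<omega> / A n - \<kappa>\<bar> < d" using d(2) by blast
                  then show "\<bar>cvar_gap c n (k n t) \<omega> / A n - \<kappa>\<bar> > d / 2" using d(1) by linarith
                qed (use G_sub in auto)
              qed measurable
            qed
          qed simp
        qed
        show "(\<integral>\<^sup>+\<omega>. ennreal (Z n \<omega> t powr 2) * indicator (G n) \<omega> \<partial>M) \<le> ennreal (L t powr 2)"
          if n: "n \<ge> n0" and t: "t \<in> space \<mu>" for n t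
        proof -
          have t': "0 < t" "t \<le> 1" "t \<in> {0<..1}" using t space_\<mu> by auto
          have kn: "1 \<le> k n t" "k n t < n" using k_bounds[OF n t'(3)] n0[OF n] by auto
          note [measurable] = cvar_gap_measurable[OF c kn] G_ev[OF n]
          define l where "l = ln (1 / t)"
          have l: "l \<ge> 0" using ln_nn t' by (simp add: l_def)
          define x where "x \<omega> = ln (cvar_gap c n (k n t) \<omega> / A n)" for \<omega>
          have [measurable]: "x \<in> borel_measurable M" unfolding x_def by measurable
          define b where "b = (\<bar>ln K\<bar> + \<bar>\<gamma>\<bar>) * (1 + l)"
          have Z_le: "Z n \<omega> t powr 2 \<le> 2 * (x \<omega>)\<^sup>2 + 2 * b\<^sup>2" if \<omega>: "\<omega> \<in> G n" for \<omega>
          proof -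
            have "\<bar>ln K + \<gamma> * l\<bar> \<le> \<bar>ln K\<bar> + \<bar>\<gamma>\<bar> * l" using l abs_triangle_ineq[of "ln K" "\<gamma> * l"] by (simp add: abs_mult)
            also have "\<dots> \<le> b" using l by (simp add: b_def distrib_left distrib_right)
            finally have "Z n \<omega> t \<le> \<bar>x \<omega>\<bar> + b"
              using Z_eq[OF n t'(3) \<omega>] unfolding l_def[symmetric] x_def by linarith
            moreover have "Z n \<omega> t \<ge> 0" by (simp add: Z_def)
            ultimately have "(Z n \<omega> t)\<^sup>2 \<le> (\<bar>x \<omega>\<bar> + b)\<^sup>2" by (intro power_mono) auto
            also have "\<dots> \<le> 2 * (x \<omega>)\<^sup>2 + 2 * b\<^sup>2"
              using sum_squares_bound[of "\<bar>x \<omega>\<bar>" b] by (simp add: power2_sum)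
            finally show ?thesis using \<open>Z n \<omega> t \<ge> 0\<close> by (simp add: powr_numeral)
          qed
          have "(\<integral>\<^sup>+\<omega>. ennreal (Z n \<omega> t powr 2) * indicator (G n) \<omega> \<partial>M)
            \<le> (\<integral>\<^sup>+\<omega>. 2 * (ennreal ((x \<omega>)\<^sup>2) * indicator (G n) \<omega>) + ennreal (2 * b\<^sup>2) \<partial>M)"
          proof (intro nn_integral_mono)
            fix \<omega>
            show "ennreal (Z n \<omega> t powr 2) * indicator (G n) \<omega> \<le> 2 * (ennreal ((x \<omega>)\<^sup>2) * indicator (G n) \<omega>) + ennreal (2 * b\<^sup>2)"
            proof (cases "\<omega> \<in> G n")
              case True
              have "ennreal (Z n \<omega> t powr 2) \<le> ennreal (2 * (x \<omega>)\<^sup>2 + 2 * b\<^sup>2)" by (intro ennreal_leI Z_le True)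
              also have "\<dots> = 2 * ennreal ((x \<omega>)\<^sup>2) + ennreal (2 * b\<^sup>2)" by (simp add: ennreal_mult)
              finally show ?thesis using True by simp
            qed simp
          qed
          also have "\<dots> = 2 * (\<integral>\<^sup>+\<omega>. ennreal ((x \<omega>)\<^sup>2) * indicator (G n) \<omega> \<partial>M) + ennreal (2 * b\<^sup>2)"
            by (simp add: nn_integral_add nn_integral_cmult emeasure_space_1)
          also have "(\<integral>\<^sup>+\<omega>. ennreal ((x \<omega>)\<^sup>2) * indicator (G n) \<omega> \<partial>M) \<le> ennreal (C * (1 + ln (real (m n) / real (k n t)))\<^sup>2)"
            unfolding x_def A_def G_def using k_bounds[OF n t'(3)] n0[OF n] by (intro C(5)) auto
          also have "ennreal (C * (1 + ln (real (m n) / real (k n t)))\<^sup>2) \<le> ennreal (C * (1 + l)\<^sup>2)"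
          proof (intro ennreal_leI mult_left_mono power_mono add_left_mono)
            have "real (m n) / real (k n t) \<le> real (m n) / (t * real (m n))"
              using k_bounds[OF n t'(3)] n0[OF n] t' by (intro divide_left_mono mult_pos_pos) auto
            also have "\<dots> = 1 / t" using n0[OF n] by auto
            finally show "ln (real (m n) / real (k n t)) \<le> l"
              unfolding l_def using k_bounds[OF n t'(3)] t' by (subst ln_le_cancel_iff) auto
            show "0 \<le> 1 + ln (real (m n) / real (k n t))"
              using k_bounds[OF n t'(3)] by (intro add_nonneg_nonneg ln_ge_zero) auto
          qed (use C(1) in simp)
          also have "2 * ennreal (C * (1 + l)\<^sup>2) + ennreal (2 * b\<^sup>2) = ennreal (L t powr 2)"
          proof -
            have "L t powr 2 = (sqrt K1 * (1 + l))\<^sup>2"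
              using l K1 by (simp add: L_def l_def[symmetric] powr_numeral)
            also have "\<dots> = 2 * (C * (1 + l)\<^sup>2) + 2 * b\<^sup>2"
              using K1 by (simp add: power_mult_distrib b_def) (simp add: K1_def algebra_simps)
            finally show ?thesis using C(1) by (simp add: ennreal_mult)
          qed
          finally show ?thesis by (simp add: add_right_mono mult_left_mono)
        qed
      qed (use e G_ev in \<open>auto simp: Z_def\<close>)
    qed
    have "eventually (\<lambda>n. prob {\<omega> \<in> G n. ennreal e \<le> J n \<omega>} < \<epsilon> / 2) sequentially"
      by (rule order_tendstoD(2)[OF main]) (use \<epsilon> in simp)
    with \<delta>(2) eventually_ge_at_top[of n0]
    show "eventually (\<lambda>n. dist (prob {\<omega> \<in> space M. ennreal e \<le> J n \<omega>}) 0 < \<epsilon>) sequentially"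
    proof eventually_elim
      case (elim n)
      have [measurable]: "J n \<in> borel_measurable M" using n0[OF elim(2)] by (intro J_meas) auto
      note [measurable] = G_ev[OF elim(2)]
      have "{\<omega> \<in> G n. ennreal e \<le> J n \<omega>} = G n \<inter> {\<omega> \<in> space M. ennreal e \<le> J n \<omega>}" using G_sub by auto
      then have ev: "{\<omega> \<in> G n. ennreal e \<le> J n \<omega>} \<in> events" by simp
      have "prob {\<omega> \<in> space M. ennreal e \<le> J n \<omega>} \<le> prob ((space M - G n) \<union> {\<omega> \<in> G n. ennreal e \<le> J n \<omega>})"
        using ev by (intro finite_measure_mono) auto
      also have "\<dots> \<le> prob (space M - G n) + prob {\<omega> \<in> G n. ennreal e \<le> J n \<omega>}"
        using ev by (intro measure_Un_le) auto
      also have "\<dots> < \<epsilon>" using elim by (simp add: G_def)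
      finally show ?case by simp
    qed
  qed
  then show ?thesis unfolding J_def Z_def A_def K_def k_def .
qed

end

theorem theorem3p1:
  fixes M :: "'a measure"
    and X :: "nat \<Rightarrow> 'a \<Rightarrow> real"
    and F :: "real \<Rightarrow> real"
    and \<gamma> c :: real
    and \<nu> :: "real set \<Rightarrow> real"
    and m :: "nat \<Rightarrow> nat"
  assumes "\<gamma> < 1"
    and "F \<in> attraction_domain \<gamma>"
    and "prob_space M"
    and "prob_space.indep_vars M (\<lambda>_. borel) X {1..}"
    and "\<And>i. i \<ge> 1 \<Longrightarrow> cdf (distr M borel (X i)) = F"
    and "0 < c" "c < 1"
    and "\<nu> \<in> \<Lambda>"
    and "intermediate_sequence m"
  shows "tendsto_in_prob M (\<lambda>n. cvar_estimator X n (m n) c \<nu>) \<gamma>"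
proof -
  interpret prob_space M by fact
  define N where "N = distr M borel (X 1)"
  have X_meas: "X i \<in> borel_measurable M" if "1 \<le> i" for i
    using assms(4) that unfolding indep_vars_def by auto
  have real_distr: "real_distribution (distr M borel (X i))" if "1 \<le> i" for i
    using X_meas[OF that] by simp
  interpret N: real_distribution N unfolding N_def by (rule real_distr) simp
  have F: "F = cdf N" unfolding N_def using assms(5)[of 1] by simp
  \<comment> \<open>A distribution function determines its law, so equal distribution functions make
    the sample identically distributed.\<close>
  have distr_eq: "distr M borel (X i) = N" if "1 \<le> i" for i
    using assms(5)[OF that] F by (intro cdf_unique real_distr that N.real_distribution_axioms) simp
  interpret iid_extremes M N X \<gamma>
  proof unfold_locales
    show "indep_vars (\<lambda>_. borel) X {1..}" by fact
    show "distr M borel (X i) = N" if "1 \<le> i" for i by (rule distr_eq[OF that])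
    show "tail_quantile (cdf N) s \<le> tail_quantile (cdf N) t" if "1 < s" "s \<le> t" for s t
      using that by (rule N.tail_quantile_mono)
    show "((\<lambda>s. (tail_quantile (cdf N) (s * x) - tail_quantile (cdf N) s)
        / (tail_quantile (cdf N) (s * 2) - tail_quantile (cdf N) s))
      \<longlongrightarrow> gev_quantile \<gamma> x / gev_quantile \<gamma> 2) at_top" if "x > 0" for x
      using assms(2) that unfolding F by (rule N.tail_quantile_regular_variation)
  qed
  have c: "0 < c" "c < 1" by fact+
  have m: "filterlim m at_top sequentially" "(\<lambda>n. real (m n) / real n) \<longlonglongrightarrow> 0"
    and m_le: "\<And>n. n \<ge> 2 \<Longrightarrow> 1 \<le> m n \<and> m n \<le> n - 1"
    using assms(9) by (auto simp: intermediate_sequence_def)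
  define P where "P = upper_variation unit_borel \<nu>"
  define Q where "Q = lower_variation unit_borel \<nu>"
  have \<nu>: "signed_measure unit_borel \<nu>" "\<nu> {0<..1} = 0"
    "(\<integral>\<^sup>+t. ennreal (ln (1 / t)) \<partial>total_variation unit_borel \<nu>) < \<infinity>"
    "signed_integral unit_borel \<nu> (\<lambda>t. ln (1 / t)) = 1"
    using assms(8) by (auto simp: weight_class_def)
  have sets_PQ: "sets P = sets unit_borel" "sets Q = sets unit_borel" by (simp_all add: P_def Q_def)
  have space_PQ: "space P = {0<..1}" "space Q = {0<..1}" by (simp_all add: P_def Q_def space_restrict_space)
  have fin: "finite_measure P" "finite_measure Q"
    unfolding P_def Q_def by (rule finite_measure_variation[OF \<nu>(1)])+
  interpret P: finite_measure P by fact
  interpret Q: finite_measure Q by fact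
  have total: "measure P {0<..1} = measure Q {0<..1}"
    using variation_space_eq[OF \<nu>(1)] \<nu>(2) by (simp add: P_def Q_def space_restrict_space)
  have ln_meas: "(\<lambda>t. ln (1 / t)) \<in> borel_measurable unit_borel"
    by (intro measurable_restrict_space1) measurable
  have ln_fin: "(\<integral>\<^sup>+t. ennreal (ln (1 / t)) \<partial>P) < \<infinity>" "(\<integral>\<^sup>+t. ennreal (ln (1 / t)) \<partial>Q) < \<infinity>"
    using nn_integral_variation_le[OF measurable_compose[OF ln_meas measurable_ennreal], of \<nu>] \<nu>(3)
    unfolding P_def Q_def by (auto intro: le_less_trans)
  have ln_int: "integrable P (\<lambda>t. ln (1 / t))" "integrable Q (\<lambda>t. ln (1 / t))"
    using ln_fin ln_meas
    by (auto intro!: integrableI_nonneg AE_I2 simp: space_PQ measurable_cong_sets[OF sets_PQ(1) refl]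
        measurable_cong_sets[OF sets_PQ(2) refl])
  have ln_diff: "(\<integral>t. ln (1 / t) \<partial>P) - (\<integral>t. ln (1 / t) \<partial>Q) = 1"
    using \<nu>(4) by (simp add: signed_integral_def P_def Q_def)
  define W where "W n \<omega> t = log_conv (cvar_gap c n (nat \<lceil>t * real (m n)\<rceil>) \<omega>)" for n \<omega> t
  define w where "w n t = ln (\<alpha> (real n / real (m n))) + ln (H (1 / c) / (1 - \<gamma>)) + \<gamma> * ln (1 / t)" for n t
  have w_int: "integrable P (w n)" "integrable Q (w n)" for n
    unfolding w_def[abs_def] using ln_int by (auto intro!: Bochner_Integration.integrable_add integrable_mult_right)
  \<comment> \<open>Both parts have the same total mass, so the constant \<open>a\<close> cancels,
    and with it the unknown scale; the normalisation of the weight leaves exactly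
    \<open>\<gamma>\<close>, for every \<open>n\<close>.\<close>
  have w_diff: "(\<integral>t. w n t \<partial>P) - (\<integral>t. w n t \<partial>Q) = \<gamma>" for n
  proof -
    define a where "a = ln (\<alpha> (real n / real (m n))) + ln (H (1 / c) / (1 - \<gamma>))"
    have "(\<integral>t. w n t \<partial>P) = measure P {0<..1} * a + \<gamma> * (\<integral>t. ln (1 / t) \<partial>P)"
      unfolding w_def a_def[symmetric] using ln_int(1) by (simp add: space_PQ)
    moreover have "(\<integral>t. w n t \<partial>Q) = measure Q {0<..1} * a + \<gamma> * (\<integral>t. ln (1 / t) \<partial>Q)"
      unfolding w_def a_def[symmetric] using ln_int(2) by (simp add: space_PQ)
    ultimately have "(\<integral>t. w n t \<partial>P) - (\<integral>t. w n t \<partial>Q)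
        = \<gamma> * ((\<integral>t. ln (1 / t) \<partial>P) - (\<integral>t. ln (1 / t) \<partial>Q))"
      unfolding total by (simp add: right_diff_distrib)
    then show ?thesis by (simp add: ln_diff)
  qed
  have est: "cvar_estimator X n (m n) c \<nu> \<omega> = (\<integral>t. W n \<omega> t \<partial>P) - (\<integral>t. W n \<omega> t \<partial>Q)" for n \<omega>
  proof -
    have "log_conv (cvar_order_stat X n (nat \<lfloor>c * real_of_int \<lceil>t * real (m n)\<rceil>\<rfloor> + 1) \<omega>
               - cvar_order_stat X n (nat \<lceil>t * real (m n)\<rceil> + 1) \<omega>) = W n \<omega> t" if "t \<in> {0<..1}" for t :: real
    proof -
      have "t * real (m n) \<ge> 0" using that by simp
      then have "real_of_int \<lceil>t * real (m n)\<rceil> = real (nat \<lceil>t * real (m n)\<rceil>)" by linarith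
      then show ?thesis by (simp add: W_def cvar_gap_def)
    qed
    then show ?thesis
      unfolding cvar_estimator_def signed_integral_def P_def[symmetric] Q_def[symmetric]
      by (intro arg_cong2[where f = "(-)"] Bochner_Integration.integral_cong refl) (auto simp: space_PQ)
  qed
  have log_conv_meas [measurable]: "log_conv \<in> borel_measurable borel"
    unfolding log_conv_def[abs_def] by measurable
  have W_meas: "(\<lambda>(\<omega>, t). W n \<omega> t) \<in> borel_measurable (M \<Otimes>\<^sub>M R)"
    if n: "n \<ge> 2" and R: "sets R = sets unit_borel" for n R
  proof -
    have mn: "1 \<le> m n" "m n < n" using m_le[OF n] n by auto
    have "cvar_gap c n i \<in> borel_measurable M" if "i \<in> {1..m n}" for i
      using that mn by (intro cvar_gap_measurable c) auto
    from measurable_random_index[OF this mn(1) R]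
    have [measurable]: "(\<lambda>(\<omega>, t). cvar_gap c n (nat \<lceil>t * real (m n)\<rceil>) \<omega>) \<in> borel_measurable (M \<Otimes>\<^sub>M R)" .
    show ?thesis unfolding W_def by measurable
  qed
  have W_int: "integrable R (W n \<omega>)"
    if n: "n \<ge> 2" and R: "sets R = sets unit_borel" "finite_measure R" and \<omega>: "\<omega> \<in> space M" for n R \<omega>
  proof -
    have mn: "1 \<le> m n" using m_le[OF n] by auto
    have space_R: "space R = {0<..1}" using sets_eq_imp_space_eq[OF R(1)] by (simp add: space_restrict_space)
    have "(\<lambda>t. W n \<omega> t) \<in> borel_measurable R"
      using measurable_compose[OF measurable_Pair1'[OF \<omega>] W_meas[OF n R(1)]] by simp
    \<comment> \<open>For fixed \<open>\<omega>\<close> the integrand takes at most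
      \<open>m n\<close> values, so it is bounded, and a finite measure integrates it without any
      moment condition.\<close>
    moreover have "\<bar>W n \<omega> t\<bar> \<le> (\<Sum>i = 1..m n. \<bar>log_conv (cvar_gap c n i \<omega>)\<bar>)" if "t \<in> space R" for t
      unfolding W_def using nat_ceiling_bounds[of t "m n"] mn that
      by (intro member_le_sum[of _ _ "\<lambda>i. \<bar>log_conv (cvar_gap c n i \<omega>)\<bar>"]) (auto simp: space_R)
    ultimately show ?thesis
      by (intro finite_measure.integrable_const_bound[OF R(2), of _ "\<Sum>i = 1..m n. \<bar>log_conv (cvar_gap c n i \<omega>)\<bar>"]) auto
  qed
  define J where "J R n \<omega> = (\<integral>\<^sup>+t. ennreal \<bar>W n \<omega> t - w n t\<bar> \<partial>R)" for R n \<omega>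
  have J_lim: "(\<lambda>n. prob {\<omega> \<in> space M. ennreal e \<le> J P n \<omega>}) \<longlonglongrightarrow> 0"
    "(\<lambda>n. prob {\<omega> \<in> space M. ennreal e \<le> J Q n \<omega>}) \<longlonglongrightarrow> 0" if e: "e > 0" for e
    unfolding J_def W_def w_def
    using log_gap_integral_in_prob[OF assms(1) c m fin(1) sets_PQ(1) ln_fin(1) e]
      log_gap_integral_in_prob[OF assms(1) c m fin(2) sets_PQ(2) ln_fin(2) e] by auto
  have J_meas: "J R n \<in> borel_measurable M"
    if n: "n \<ge> 2" and R: "sets R = sets unit_borel" "finite_measure R" for n R
  proof -
    interpret R: finite_measure R by fact
    have [measurable]: "w n \<in> borel_measurable R"
      unfolding w_def[abs_def] measurable_cong_sets[OF R(1) refl] using ln_meas by measurable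
    note [measurable] = W_meas[OF n R(1)]
    show ?thesis unfolding J_def[abs_def] by measurable
  qed
  have J_ge: "ennreal \<bar>(\<integral>t. W n \<omega> t \<partial>R) - (\<integral>t. w n t \<partial>R)\<bar> \<le> J R n \<omega>"
    if n: "n \<ge> 2" and R: "sets R = sets unit_borel" "finite_measure R" and \<omega>: "\<omega> \<in> space M" and w: "integrable R (w n)" for n R \<omega>
  proof -
    note int = W_int[OF n R \<omega>] w
    have "\<bar>(\<integral>t. W n \<omega> t \<partial>R) - (\<integral>t. w n t \<partial>R)\<bar> = \<bar>\<integral>t. W n \<omega> t - w n t \<partial>R\<bar>" using int by simp
    also have "\<dots> \<le> (\<integral>t. \<bar>W n \<omega> t - w n t\<bar> \<partial>R)"
      using integral_norm_bound[of R "\<lambda>t. W n \<omega> t - w n t"] by simp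
    finally have "ennreal \<bar>(\<integral>t. W n \<omega> t \<partial>R) - (\<integral>t. w n t \<partial>R)\<bar> \<le> ennreal (\<integral>t. \<bar>W n \<omega> t - w n t\<bar> \<partial>R)"
      by (rule ennreal_leI)
    also have "\<dots> = J R n \<omega>"
      unfolding J_def using int by (intro nn_integral_eq_integral[symmetric]) auto
    finally show ?thesis .
  qed
  show ?thesis
    unfolding tendsto_in_prob_def
  proof (intro conjI allI impI)
    \<comment> \<open>From \<open>n = 2\<close> on the bounds on \<open>m n\<close> hold, and all
      indices that occur stay within the sample.\<close>
    show "eventually (\<lambda>n. cvar_estimator X n (m n) c \<nu> \<in> borel_measurable M) sequentially"
      using eventually_ge_at_top[of 2]
    proof eventually_elim
      case (elim n)
      have "(\<lambda>\<omega>. (\<integral>t. W n \<omega> t \<partial>P) - (\<integral>t. W n \<omega> t \<partial>Q)) \<in> borel_measurable M"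
        by (intro borel_measurable_diff P.borel_measurable_lebesgue_integral Q.borel_measurable_lebesgue_integral
            W_meas elim sets_PQ)
      then show ?case unfolding est[symmetric] .
    qed
  next
    fix e :: real assume e: "e > 0"
    have e2: "e / 2 > 0" using e by simp
    have lim0: "(\<lambda>n. prob {\<omega> \<in> space M. ennreal (e / 2) \<le> J P n \<omega>}
        + prob {\<omega> \<in> space M. ennreal (e / 2) \<le> J Q n \<omega>}) \<longlonglongrightarrow> 0"
      using tendsto_add[OF J_lim(1)[OF e2] J_lim(2)[OF e2]] by simp
    show "(\<lambda>n. prob {\<omega> \<in> space M. \<bar>cvar_estimator X n (m n) c \<nu> \<omega> - \<gamma>\<bar> > e}) \<longlonglongrightarrow> 0"
    proof (rule tendsto_sandwich[OF _ _ tendsto_const lim0])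
      show "eventually (\<lambda>n. prob {\<omega> \<in> space M. \<bar>cvar_estimator X n (m n) c \<nu> \<omega> - \<gamma>\<bar> > e}
        \<le> prob {\<omega> \<in> space M. ennreal (e / 2) \<le> J P n \<omega>} + prob {\<omega> \<in> space M. ennreal (e / 2) \<le> J Q n \<omega>}) sequentially"
        using eventually_ge_at_top[of 2]
      proof eventually_elim
        case (elim n)
        note [measurable] = J_meas[OF elim sets_PQ(1) fin(1)] J_meas[OF elim sets_PQ(2) fin(2)]
        have "{\<omega> \<in> space M. \<bar>cvar_estimator X n (m n) c \<nu> \<omega> - \<gamma>\<bar> > e}
          \<subseteq> {\<omega> \<in> space M. ennreal (e / 2) \<le> J P n \<omega>} \<union> {\<omega> \<in> space M. ennreal (e / 2) \<le> J Q n \<omega>}"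
        proof (intro subsetI)
          fix \<omega> assume "\<omega> \<in> {\<omega> \<in> space M. \<bar>cvar_estimator X n (m n) c \<nu> \<omega> - \<gamma>\<bar> > e}"
          then have \<omega>: "\<omega> \<in> space M" "\<bar>cvar_estimator X n (m n) c \<nu> \<omega> - \<gamma>\<bar> > e" by auto
          \<comment> \<open>Inserting the centring \<open>w n\<close> is free, since its signed
            integral is \<open>\<gamma>\<close>; a total error above \<open>e\<close> then forces an
            error of at least \<open>e / 2\<close> in one of the two Jordan parts.\<close>
          have "cvar_estimator X n (m n) c \<nu> \<omega> - \<gamma>
            = ((\<integral>t. W n \<omega> t \<partial>P) - (\<integral>t. w n t \<partial>P)) - ((\<integral>t. W n \<omega> t \<partial>Q) - (\<integral>t. w n t \<partial>Q))"
            unfolding est using w_diff[of n] by linarith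
          then have "e / 2 \<le> \<bar>(\<integral>t. W n \<omega> t \<partial>P) - (\<integral>t. w n t \<partial>P)\<bar> \<or> e / 2 \<le> \<bar>(\<integral>t. W n \<omega> t \<partial>Q) - (\<integral>t. w n t \<partial>Q)\<bar>"
            using \<omega>(2) by linarith
          then show "\<omega> \<in> {\<omega> \<in> space M. ennreal (e / 2) \<le> J P n \<omega>} \<union> {\<omega> \<in> space M. ennreal (e / 2) \<le> J Q n \<omega>}"
            using order_trans[OF ennreal_leI J_ge[OF elim sets_PQ(1) fin(1) \<omega>(1) w_int(1)]]
              order_trans[OF ennreal_leI J_ge[OF elim sets_PQ(2) fin(2) \<omega>(1) w_int(2)]] \<omega>(1)
            by blast
        qed
        then have "prob {\<omega> \<in> space M. \<bar>cvar_estimator X n (m n) c \<nu> \<omega> - \<gamma>\<bar> > e}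
          \<le> prob ({\<omega> \<in> space M. ennreal (e / 2) \<le> J P n \<omega>} \<union> {\<omega> \<in> space M. ennreal (e / 2) \<le> J Q n \<omega>})"
          by (rule finite_measure_mono) measurable
        also have "\<dots> \<le> prob {\<omega> \<in> space M. ennreal (e / 2) \<le> J P n \<omega>} + prob {\<omega> \<in> space M. ennreal (e / 2) \<le> J Q n \<omega>}"
          by (rule measure_Un_le) measurable
        finally show ?case .
      qed
    qed simp
  qed
qed

end
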